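(* Let $\bar u$ be a nonconstant $T$-periodic stationary solution of $u_t+f(u)_x=(B(u)u_x)_x$, with associated rest point $u_-$, periodic Evans function $D$, transversality coefficient $\gamma$ and mass derivative $\partial\bar u_m/\partial u_-$ as defined in the context. Assume: (i) $f,B\in C^2$; (ii) $\operatorname{Re}\sigma(B(\bar u(x)))>0$ for all $x$; (iii) $df(u_-)$ is invertible; (iv) $\gamma\neq 0$; and suppose in addition that (v) the traveling-wave ODE is quasi-Hamiltonian for the value of $s$ associated with $\bar u$ (i.e. $s=0$). Then, for $k\in\mathbb R$, $\lambda\in\mathbb C$ sufficiently small, $$D(k,\lambda)=\gamma\,\lambda\,\det\Big(-\lambda\,(\partial\bar u_m/\partial u_-)\,df(u_-)^{-1}-ikT\,I\Big)+\mathcal O\big((|k|+|\lambda|)^{n+2}\big).$$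
   Context: Setting. Consider $u_t+f(u)_x=(B(u)u_x)_x$, $x\in\mathbb R$, $u,f(u)\in\mathbb R^n$, $B(u)\in\mathbb R^{n\times n}$. Periodic traveling waves $\bar u(x-st)$ are taken, in their rest frame (replacing $f(u)$ by $f(u)-su$), to have speed $s=0$. Thus $\bar u(x)$ is a nonconstant $T$-periodic solution of $B(u)u'=f(u)-f(u_-)$ with $\bar u(0)=\bar u(T)=u_0$, where $u_-\in\mathbb R^n$ is a rest point of this ODE. Coordinates in $\mathbb R^n$ are chosen so that $\bar u'(0)=e_1$, the first standard basis vector. Linearized operator: $Lv=(Bv_x)_x-(Av)_x$, where $B=B(\bar u(x))$ and $A(x)v=df(\bar u(x))v-(dB(\bar u(x))v)\bar u'(x)$ are $T$-periodic. Evans function: the eigenvalue equation $(Bw')'=(Aw)'+\lambda w$ is written as $W'=\mathbb A(\lambda,x)W$, $W=(w,w')^t$, $\mathbb A=\begin{pmatrix}0&I\\ B^{-1}(\lambda I+A')&B^{-1}(A-B')\end{pmatrix}$. Let $\Psi'=\mathbb A\Psi$, $\Psi(0,\lambda)=I$, $M(\lambda)=\Psi(T,\lambda)$, and $D(k,\lambda)=\det(M(\lambda)-e^{ikT}I)$ for $k\in\mathbb R$, $\lambda\in\mathbb C$. Variations: for parameters $(u_-,u_0,s)$ near the base values (with $s=0$), let $\bar u^{(u_-,u_0,s)}(x)$ solve $B(u)u'=f(u)-f(u_-)-s(u-u_-)$, $u(0)=u_0$. At the base values put $w_j=(\partial\bar u/\partial u_0)e_j$, $w_{n+j}=(\partial\bar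 u/\partial u_-)e_j$ ($1\le j\le n$), $\tilde z_1=-\partial\bar u/\partial s$. Write $[g]=g(T)-g(0)$. The transversality coefficient is $\gamma=\det([\tilde z_1],[w_2],\dots,[w_n])$. Mass derivative: if $\gamma\ne0$, then by the Implicit Function Theorem, near the base point the parameters for which $\bar u^{(u_-,u_0,s)}(T)=u_0$ form an $(n+1)$-dimensional surface parametrized by $(u_-,u_0^1)$, $u_0^1=u_0\cdot e_1$. On it define $\bar u_m=\int_0^T\bar u^{(u_-,u_0,s)}(y)\,dy$ (independent of $u_0^1$), and let $\partial\bar u_m/\partial u_-$ be its $n\times n$ derivative at the base point with $u_0^1$ fixed. Equivalently its $j$-th column is $\int_0^T\tilde w_{n+j}$, where $\tilde w_{n+j}$ is the unique element of $w_{n+j}+\operatorname{Span}(\tilde z_1,w_2,\dots,w_n)$ with $[\tilde w_{n+j}]=0$. Quasi-Hamiltonian: the traveling-wave ODE $B(u)u'=f(u)-f(u_-)-s(u-u_-)$, with $s$ held fixed at the base value ($s=0$), admits an integral of motion $H(u_-,u)$ for each $(u_-,u_0)$, i.e. $H(u_-,u(x))\equiv H(u_-,u_0)$ for all solutions $u(\cdot)$ with $u(0)=u_0$.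
   Formalization: The integral of motion H in (v) is additionally required to be differentiable at (u_-,u_0) with nonzero u-gradient there; with a constant H, which is always conserved, hypothesis (v) would be empty and the expansion fails for hyperbolic limit cycles. *)

theory Defs
  imports "HOL-Analysis.Analysis" "HOL-Library.Landau_Symbols"
begin

definition C2 :: "('a::real_normed_vector \<Rightarrow> 'b::real_normed_vector) \<Rightarrow> bool" where
  "C2 g \<longleftrightarrow>
    (\<exists>(g' :: 'a \<Rightarrow> 'a \<Rightarrow>\<^sub>L 'b) (g'' :: 'a \<Rightarrow> 'a \<Rightarrow>\<^sub>L ('a \<Rightarrow>\<^sub>L 'b)).
      (\<forall>x. (g has_derivative blinfun_apply (g' x)) (at x)) \<and>
      (\<forall>x. (g' has_derivative blinfun_apply (g'' x)) (at x)) \<and>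
      continuous_on UNIV g'')"

abbreviation cmat :: "real^'m^'n \<Rightarrow> complex^'m^'n" where
  "cmat \<equiv> map_matrix complex_of_real"

definition mat_spectrum :: "complex^'n^'n \<Rightarrow> complex set" where
  "mat_spectrum M = {\<mu>. \<exists>v. v \<noteq> 0 \<and> M *v v = \<mu> *s v}"

text \<open>The profile equation \<open>B(u) u' = f(u) - f(u\<^sub>-) - s (u - u\<^sub>-)\<close> on a set \<open>S\<close> of points,
  with one-sided derivatives at the ends if \<open>S\<close> is a compact interval.\<close>

definition profile_solution ::
  "(real^'n \<Rightarrow> real^'n) \<Rightarrow> (real^'n \<Rightarrow> real^'n^'n) \<Rightarrow> real^'n \<Rightarrow> real \<Rightarrow> real set \<Rightarrow>
    (real \<Rightarrow> real^'n) \<Rightarrow> bool" where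
  "profile_solution f B um s S u \<longleftrightarrow>
    (\<forall>x\<in>S. \<exists>u'. (u has_vector_derivative u') (at x within S) \<and>
       B (u x) *v u' = f (u x) - f um - s *\<^sub>R (u x - um))"

definition nonconstant_periodic_profile ::
  "(real^'n \<Rightarrow> real^'n) \<Rightarrow> (real^'n \<Rightarrow> real^'n^'n) \<Rightarrow> real^'n \<Rightarrow> real \<Rightarrow>
    (real \<Rightarrow> real^'n) \<Rightarrow> bool" where
  "nonconstant_periodic_profile f B um T u \<longleftrightarrow>
    0 < T \<and> profile_solution f B um 0 UNIV u \<and> (\<forall>x. u (x + T) = u x) \<and>
    \<not> u constant_on UNIV"

definition lin_B :: "(real^'n \<Rightarrow> real^'n^'n) \<Rightarrow> (real \<Rightarrow> real^'n) \<Rightarrow> real \<Rightarrow> real^'n^'n" where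
  "lin_B B u x = B (u x)"

definition lin_A ::
  "(real^'n \<Rightarrow> real^'n) \<Rightarrow> (real^'n \<Rightarrow> real^'n^'n) \<Rightarrow> (real \<Rightarrow> real^'n) \<Rightarrow> real \<Rightarrow> real^'n^'n" where
  "lin_A f B u x =
    matrix (\<lambda>v. frechet_derivative f (at (u x)) v
                - frechet_derivative B (at (u x)) v *v vector_derivative u (at x))"

definition block_matrix ::
  "'a^'n^'n \<Rightarrow> 'a^'n^'n \<Rightarrow> 'a^'n^'n \<Rightarrow> 'a^'n^'n \<Rightarrow> 'a^('n + 'n)^('n + 'n)" where
  "block_matrix P Q R S = (\<chi> i j.
     case i of
       Inl a \<Rightarrow> (case j of Inl b \<Rightarrow> P $ a $ b | Inr b \<Rightarrow> Q $ a $ b)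
     | Inr a \<Rightarrow> (case j of Inl b \<Rightarrow> R $ a $ b | Inr b \<Rightarrow> S $ a $ b))"

text \<open>Coefficient matrix of \<open>(B w')' = (A w)' + lam w\<close>, written as a first-order system for
  \<open>W = (w, w')\<close>.\<close>

definition evans_matrix ::
  "(real^'n \<Rightarrow> real^'n) \<Rightarrow> (real^'n \<Rightarrow> real^'n^'n) \<Rightarrow> (real \<Rightarrow> real^'n) \<Rightarrow> complex \<Rightarrow> real \<Rightarrow>
    complex^('n + 'n)^('n + 'n)" where
  "evans_matrix f B u lam x =
    block_matrix
      0
      (mat 1)
      (cmat (matrix_inv (lin_B B u x)) **
         (mat lam + cmat (vector_derivative (lin_A f B u) (at x))))
      (cmat (matrix_inv (lin_B B u x)) **
         cmat (lin_A f B u x - vector_derivative (lin_B B u) (at x)))"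

definition evans_fundamental_solution ::
  "(real^'n \<Rightarrow> real^'n) \<Rightarrow> (real^'n \<Rightarrow> real^'n^'n) \<Rightarrow> (real \<Rightarrow> real^'n) \<Rightarrow>
    (real \<Rightarrow> complex \<Rightarrow> complex^('n + 'n)^('n + 'n)) \<Rightarrow> bool" where
  "evans_fundamental_solution f B u \<Psi> \<longleftrightarrow>
    (\<forall>lam. \<Psi> 0 lam = mat 1 \<and>
      (\<forall>x. ((\<lambda>y. \<Psi> y lam) has_vector_derivative evans_matrix f B u lam x ** \<Psi> x lam) (at x)))"

definition evans_D ::
  "(real \<Rightarrow> complex \<Rightarrow> complex^('m)^('m)) \<Rightarrow> real \<Rightarrow> real \<Rightarrow> complex \<Rightarrow> complex" where
  "evans_D \<Psi> T k lam = det (\<Psi> T lam - mat (exp (\<i> * complex_of_real (k * T))))"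

text \<open>\<open>U v c s x\<close> is the value at \<open>x\<close> of the solution with parameters
  \<open>(u\<^sub>-, u\<^sub>0, s) = (v, c, s)\<close>. Only parameters near the base point \<open>(um, u0, 0)\<close> matter. Existence
  and uniqueness on \<open>[0,T]\<close> for those parameters are standard ODE theory.\<close>

definition profile_family ::
  "(real^'n \<Rightarrow> real^'n) \<Rightarrow> (real^'n \<Rightarrow> real^'n^'n) \<Rightarrow> real^'n \<Rightarrow> real^'n \<Rightarrow> real \<Rightarrow>
    (real^'n \<Rightarrow> real^'n \<Rightarrow> real \<Rightarrow> real \<Rightarrow> real^'n) \<Rightarrow> bool" where
  "profile_family f B um u0 T U \<longleftrightarrow>
    (\<forall>\<^sub>F (v, c, s) in nhds (um, u0, 0).
       U v c s 0 = c \<and> profile_solution f B v s {0..T} (U v c s))"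

definition var_w ::
  "real^'n \<Rightarrow> real^'n \<Rightarrow> (real^'n \<Rightarrow> real^'n \<Rightarrow> real \<Rightarrow> real \<Rightarrow> real^'n) \<Rightarrow> 'n \<Rightarrow> real \<Rightarrow> real^'n" where
  "var_w um u0 U j x = frechet_derivative (\<lambda>c. U um c 0 x) (at u0) (axis j 1)"

definition var_z ::
  "real^'n \<Rightarrow> real^'n \<Rightarrow> (real^'n \<Rightarrow> real^'n \<Rightarrow> real \<Rightarrow> real \<Rightarrow> real^'n) \<Rightarrow> real \<Rightarrow> real^'n" where
  "var_z um u0 U x = - vector_derivative (\<lambda>s. U um u0 s x) (at 0)"

text \<open>The finite index type \<open>'n\<close> carries no order; the index \<open>i1\<close> plays the role of the
  coordinate number 1. So column \<open>i1\<close> below is \<open>[z\<^sub>1]\<close> and the other columns are \<open>[w\<^sub>j]\<close>; the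
  determinant does not depend on how the remaining indices are numbered.\<close>

definition transversality ::
  "'n \<Rightarrow> real^'n \<Rightarrow> real^'n \<Rightarrow> real \<Rightarrow>
    (real^'n \<Rightarrow> real^'n \<Rightarrow> real \<Rightarrow> real \<Rightarrow> real^'n) \<Rightarrow> real" where
  "transversality i1 um u0 T U =
    det (\<chi> i j. (if j = i1 then var_z um u0 U T - var_z um u0 U 0
                 else var_w um u0 U j T - var_w um u0 U j 0) $ i)"

text \<open>\<open>Q (v, a) = (u\<^sub>0, s)\<close> parametrizes, by \<open>v = u\<^sub>-\<close> and \<open>a = u\<^sub>0 \<bullet> e\<^sub>1\<close>, the surface of
  parameters near the base point whose solution satisfies \<open>U v u\<^sub>0 s T = u\<^sub>0\<close>. When the
  transversality coefficient is nonzero such a \<open>Q\<close> exists and is locally unique, by the implicit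
  function theorem.\<close>

definition periodic_surface ::
  "'n \<Rightarrow> real^'n \<Rightarrow> real^'n \<Rightarrow> real \<Rightarrow> (real^'n \<Rightarrow> real^'n \<Rightarrow> real \<Rightarrow> real \<Rightarrow> real^'n) \<Rightarrow>
    ((real^'n) \<times> real \<Rightarrow> (real^'n) \<times> real) \<Rightarrow> bool" where
  "periodic_surface i1 um u0 T U Q \<longleftrightarrow>
    isCont Q (um, u0 $ i1) \<and>
    (\<forall>\<^sub>F (v, a) in nhds (um, u0 $ i1). fst (Q (v, a)) $ i1 = a) \<and>
    (\<forall>\<^sub>F (v, c, s) in nhds (um, u0, 0). U v c s T = c \<longleftrightarrow> Q (v, c $ i1) = (c, s))"

definition mean_mass ::
  "real \<Rightarrow> (real^'n \<Rightarrow> real^'n \<Rightarrow> real \<Rightarrow> real \<Rightarrow> real^'n) \<Rightarrow>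
    ((real^'n) \<times> real \<Rightarrow> (real^'n) \<times> real) \<Rightarrow> real^'n \<Rightarrow> real \<Rightarrow> real^'n" where
  "mean_mass T U Q v a = integral {0..T} (U v (fst (Q (v, a))) (snd (Q (v, a))))"

definition mass_derivative ::
  "'n \<Rightarrow> real^'n \<Rightarrow> real^'n \<Rightarrow> real \<Rightarrow> (real^'n \<Rightarrow> real^'n \<Rightarrow> real \<Rightarrow> real \<Rightarrow> real^'n) \<Rightarrow>
    ((real^'n) \<times> real \<Rightarrow> (real^'n) \<times> real) \<Rightarrow> real^'n^'n" where
  "mass_derivative i1 um u0 T U Q = jacobian (\<lambda>v. mean_mass T U Q v (u0 $ i1)) (at um)"

text \<open>An integral of motion \<open>H (u\<^sub>-, u)\<close> of the profile equation at speed \<open>s\<close>, defined for all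
  \<open>u\<^sub>-\<close>. A constant \<open>H\<close> is always conserved, so an integral of motion is understood to be
  nondegenerate: \<open>\<nabla>\<^sub>u H \<noteq> 0\<close> at the base point \<open>(um, u0)\<close>.\<close>

definition quasi_Hamiltonian ::
  "(real^'n \<Rightarrow> real^'n) \<Rightarrow> (real^'n \<Rightarrow> real^'n^'n) \<Rightarrow> real \<Rightarrow> real^'n \<Rightarrow> real^'n \<Rightarrow> bool" where
  "quasi_Hamiltonian f B s um u0 \<longleftrightarrow>
    (\<exists>H :: real^'n \<Rightarrow> real^'n \<Rightarrow> real.
      (\<forall>v u I. is_interval I \<and> 0 \<in> I \<and> profile_solution f B v s I u \<longrightarrow>
         (\<forall>x\<in>I. H v (u x) = H v (u 0))) \<and>
      (\<lambda>(v, c). H v c) differentiable (at (um, u0)) \<and>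
      frechet_derivative (H um) (at u0) \<noteq> (\<lambda>h. 0))"

end

theory Submission
  imports Defs
begin

text \<open>
  Write \<open>A\<close> and \<open>B\<close> for the coefficients of the linearization along the profile. The second-order
  eigenvalue equation \<open>(B w')' = (A w)' + lam w\<close> is a conservation law: with the flux
  \<open>F = B w' - A w\<close> it is the system

    \<open>w' = C w + E F,   F' = lam w,   C = B\<^sup>-\<^sup>1 A,   E = B\<^sup>-\<^sup>1\<close>.

  The change from \<open>(w, w')\<close> to \<open>(w, F)\<close> is \<open>T\<close>-periodic, so the Evans function is the
  characteristic determinant at \<open>e\<^sup>i\<^sup>k\<^sup>T\<close> of the monodromy matrix of this system. The flux row
  integrates to \<open>F(T) - F(0) = lam \<integral>w\<close>, so after subtraction
  of \<open>e\<^sup>i\<^sup>k\<^sup>T\<close> on the diagonal every entry of the flux rows is small of first order. The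
  translation mode \<open>w = ub'\<close>, \<open>F = 0\<close> is periodic and has mean zero, so the column that it generates
  is small of first order in the upper rows and of second order in the flux rows. Hence the
  determinant is of order \<open>n + 1\<close>, and each entry is needed only to its own leading order:
  perturbing every entry by one order more changes the determinant by \<open>O((|k| + |lam|)\<^sup>n\<^sup>+\<^sup>2)\<close>
  (\<open>det_bigo_perturbation\<close>).

  At \<open>lam = 0\<close> the flux is constant, and the solutions are the variations of the profile family: the
  matrix \<open>X\<close> with \<open>X' = C X\<close>, \<open>X(0) = 1\<close> collects the derivatives in \<open>u\<^sub>0\<close>, and if \<open>K' = C K + E\<close>,
  \<open>K(0) = 0\<close>, then \<open>- K df(u\<^sub>-)\<close> collects the derivatives in \<open>u\<^sub>-\<close>. The speed variation \<open>z\<close> solves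
  \<open>z' = C z + E (ub - u\<^sub>-)\<close>, and \<open>z - K (u\<^sub>0 - u\<^sub>-)\<close> is the coefficient of \<open>lam\<close> in the solution that
  continues the translation mode. Lemma \<open>profile_expansion\<close> justifies these identifications with a
  quadratic remainder that is uniform on a period.

  The integral of motion enters through one linear functional, the derivative \<open>h\<close> of \<open>H(u\<^sub>-, .)\<close> at
  \<open>u\<^sub>0\<close>. Conservation makes \<open>h\<close> vanish on \<open>X(T) - 1\<close>, on \<open>K(T)\<close> and on \<open>ub'(0)\<close>
  (\<open>integral_annihilates_variations\<close>). As \<open>\<gamma> \<noteq> 0\<close>, the columns \<open>[w\<^sub>j]\<close> with \<open>j \<noteq> 1\<close> span the kernel
  of \<open>h\<close>. Therefore \<open>K(T) = (X(T) - 1) S\<close> for a matrix \<open>S\<close> whose first row vanishes, without any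
  contribution of \<open>[z]\<close>: periodic profiles near the base point keep their speed to first order.
  Subtracting from the flux columns of the leading matrix its other columns times \<open>S\<close> leaves a block
  triangular matrix. Its upper block has determinant \<open>lam \<gamma>\<close>, and its lower block is
  \<open>lam \<integral>(K - X S) - i k T\<close>. Since \<open>u\<^sub>0\<close> depends on \<open>u\<^sub>-\<close> along the periodic surface through
  \<open>S df(u\<^sub>-)\<close>, the mass derivative is \<open>- \<integral>(K - X S) df(u\<^sub>-)\<close>, which is the asserted formula.
\<close>

section \<open>Differential inequalities and linear differential equations\<close>

text \<open>The square root comes from estimating the squared norm, which is differentiable also where the
  function vanishes.\<close>

definition gronwall_const :: "real \<Rightarrow> real \<Rightarrow> real" where
  "gronwall_const L T = sqrt (exp ((2 * L + 1) * T) * (1 + T))"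

lemma gronwall_const_pos: "0 \<le> T \<Longrightarrow> 0 < gronwall_const L T"
  by (simp add: gronwall_const_def)

lemma gronwall_const_mono:
  assumes "0 \<le> L" "0 \<le> S" "S \<le> T"
  shows "gronwall_const L S \<le> gronwall_const L T"
  unfolding gronwall_const_def using assms
  by (intro real_sqrt_le_mono mult_mono) (auto intro!: mult_left_mono)

text \<open>For \<open>g(t) = e\<^sup>-\<^sup>c\<^sup>t |y(t)|\<^sup>2 - h\<^sup>2 t\<close> with \<open>c = 2 L + 1\<close>, the bound on \<open>y'\<close> and \<open>2 |y| h \<le> |y|\<^sup>2 + h\<^sup>2\<close>
  give \<open>g' \<le> 0\<close>.\<close>

lemma gronwall:
  fixes y :: "real \<Rightarrow> 'a::real_inner"
  assumes deriv: "\<And>x. x \<in> {0..T} \<Longrightarrow> (y has_vector_derivative y' x) (at x within {0..T})"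
    and bound: "\<And>x. x \<in> {0..T} \<Longrightarrow> norm (y' x) \<le> L * norm (y x) + h"
    and L: "0 \<le> L" and h: "0 \<le> h" and x: "x \<in> {0..T}"
  shows "norm (y x) \<le> gronwall_const L T * (norm (y 0) + h)"
proof -
  define c where "c = 2 * L + 1"
  define g where "g t = exp (- c * t) * (y t \<bullet> y t) - h\<^sup>2 * t" for t
  define g' where "g' t = exp (- c * t) * (2 * (y t \<bullet> y' t)) - c * exp (- c * t) * (y t \<bullet> y t) -
      h\<^sup>2"
    for t
  have c: "c \<ge> 1" using L by (simp add: c_def)
  have x0: "0 \<le> x" and xT: "x \<le> T" using x by auto
  have g: "(g has_vector_derivative g' t) (at t within {0..T})" if t: "t \<in> {0..T}" for t
  proof -
    have "((\<lambda>t. y t \<bullet> y t) has_vector_derivative (y t \<bullet> y' t + y' t \<bullet> y t)) (at t within {0..T})"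
      by (rule bounded_bilinear.has_vector_derivative[OF bounded_bilinear_inner deriv[OF t] deriv[OF
          t]])
    then have "((\<lambda>t. y t \<bullet> y t) has_real_derivative 2 * (y t \<bullet> y' t)) (at t within {0..T})"
      by (simp add: has_real_derivative_iff_has_vector_derivative inner_commute)
    then have "(g has_real_derivative g' t) (at t within {0..T})"
      unfolding g_def g'_def
      by (auto intro!: derivative_eq_intros simp: algebra_simps)
    then show ?thesis
      by (simp add: has_real_derivative_iff_has_vector_derivative)
  qed
  have g'_nonpos: "g' t \<le> 0" if t: "t \<in> {0..T}" for t
  proof -
    have "2 * (y t \<bullet> y' t) \<le> 2 * (norm (y t) * norm (y' t))"
      using norm_cauchy_schwarz[of "y t" "y' t"] by simp
    also have "\<dots> \<le> 2 * (norm (y t) * (L * norm (y t) + h))"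
      using bound[OF t] by (intro mult_left_mono) auto
    also have "\<dots> \<le> c * (norm (y t))\<^sup>2 + h\<^sup>2"
      using sum_squares_bound[of "norm (y t)" h]
      by (simp add: c_def algebra_simps power2_eq_square)
    finally have "2 * (y t \<bullet> y' t) - c * (y t \<bullet> y t) \<le> h\<^sup>2"
      by (simp add: power2_norm_eq_inner)
    then have "exp (- c * t) * (2 * (y t \<bullet> y' t) - c * (y t \<bullet> y t)) \<le> exp (- c * t) * h\<^sup>2"
      by (intro mult_left_mono) auto
    also have "\<dots> \<le> 1 * h\<^sup>2"
      using t c by (intro mult_right_mono) auto
    finally show ?thesis
      by (simp add: g'_def algebra_simps)
  qed
  have "g x \<le> g 0"
  proof (cases "x = 0")
    case False
    then have "0 < x" using x0 by simp
    have "\<exists>t\<in>{0<..<x}. g x - g 0 = (\<lambda>h. h * g' t) (x - 0)"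
    proof (rule mvt_simple[OF \<open>0 < x\<close>, of g "\<lambda>t h. h * g' t"])
      fix t assume "0 \<le> t" "t \<le> x"
      then have "t \<in> {0..T}" using xT by auto
      from has_vector_derivative_within_subset[OF g[OF this], of "{0..x}"]
      show "(g has_derivative (\<lambda>h. h * g' t)) (at t within {0..x})"
        using xT by (simp add: has_vector_derivative_def)
    qed
    then obtain t where t: "t \<in> {0<..<x}" "g x - g 0 = x * g' t" by auto
    have "g' t \<le> 0" using t xT by (intro g'_nonpos) auto
    then show ?thesis using t \<open>0 < x\<close> by (simp add: mult_nonneg_nonpos algebra_simps)
  qed simp
  then have "exp (- c * x) * (norm (y x))\<^sup>2 \<le> (norm (y 0))\<^sup>2 + h\<^sup>2 * x"
    by (simp add: g_def power2_norm_eq_inner)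
  then have "exp (c * x) * (exp (- c * x) * (norm (y x))\<^sup>2) \<le>
      exp (c * x) * ((norm (y 0))\<^sup>2 + h\<^sup>2 * x)"
    by (intro mult_left_mono) auto
  then have "(norm (y x))\<^sup>2 \<le> exp (c * x) * ((norm (y 0))\<^sup>2 + h\<^sup>2 * x)"
    by (simp add: mult.assoc[symmetric] exp_add[symmetric])
  also have "\<dots> \<le> exp (c * T) * ((1 + T) * (norm (y 0) + h)\<^sup>2)"
  proof (intro mult_mono)
    have "(norm (y 0))\<^sup>2 + h\<^sup>2 * x \<le> (norm (y 0))\<^sup>2 + h\<^sup>2 * T"
      using xT by (simp add: mult_left_mono)
    also have "\<dots> \<le> (1 + T) * ((norm (y 0))\<^sup>2 + h\<^sup>2)"
      using x0 xT by (simp add: algebra_simps)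
    also have "\<dots> \<le> (1 + T) * (norm (y 0) + h)\<^sup>2"
      using x0 xT h by (intro mult_left_mono) (auto simp: power2_sum)
    finally show "(norm (y 0))\<^sup>2 + h\<^sup>2 * x \<le> (1 + T) * (norm (y 0) + h)\<^sup>2" .
  qed (use c x0 xT in auto)
  also have "\<dots> = (gronwall_const L T * (norm (y 0) + h))\<^sup>2"
    using x0 xT by (simp add: gronwall_const_def c_def power_mult_distrib)
  finally show ?thesis
    by (rule power2_le_imp_le)
       (use x0 xT h in \<open>auto intro!: mult_nonneg_nonneg simp: gronwall_const_pos less_imp_le\<close>)
qed

text \<open>A differential inequality that is known only inside a ball is enough if its conclusion is a bound
  smaller than the radius: at the first time at which the norm reaches \<open>\<rho>\<close>, Gronwall's inequality on
  the interval up to that time says that the norm is less than \<open>\<rho>\<close>.\<close>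

lemma gronwall_barrier:
  fixes y :: "real \<Rightarrow> 'a::real_inner"
  assumes deriv: "\<And>x. x \<in> {0..T} \<Longrightarrow> (y has_vector_derivative y' x) (at x within {0..T})"
    and bound: "\<And>x. x \<in> {0..T} \<Longrightarrow> norm (y x) \<le> \<rho> \<Longrightarrow> norm (y' x) \<le> L * norm (y x) + h"
    and L: "0 \<le> L" and h: "0 \<le> h"
    and small: "gronwall_const L T * (norm (y 0) + h) < \<rho>" "norm (y 0) < \<rho>"
    and x: "x \<in> {0..T}"
  shows "norm (y x) \<le> gronwall_const L T * (norm (y 0) + h) \<and> norm (y x) < \<rho>"
proof -
  have T: "0 \<le> T" using x by auto
  have cont: "continuous_on {0..T} (\<lambda>t. norm (y t))"
    using deriv by (intro continuous_on_norm continuous_on_vector_derivative) auto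
  have below: "norm (y t) < \<rho>" if t: "t \<in> {0..T}" for t
  proof (rule ccontr)
    assume "\<not> norm (y t) < \<rho>"
    define Z where "Z = {0..T} \<inter> (\<lambda>t. norm (y t)) -` {\<rho>..}"
    have "closed Z" unfolding Z_def
      by (rule continuous_closed_preimage[OF cont]) auto
    moreover have "Z \<noteq> {}" "bdd_below Z"
      using t \<open>\<not> norm (y t) < \<rho>\<close> by (auto simp: Z_def bdd_below_def)
    ultimately have mem: "Inf Z \<in> Z" by (intro closed_contains_Inf)
    define S where "S = Inf Z"
    have S: "0 \<le> S" "S \<le> T" "\<rho> \<le> norm (y S)"
      using mem by (auto simp: Z_def S_def)
    have S_least: "norm (y t) < \<rho>" if "0 \<le> t" "t < S" for t
    proof (rule ccontr)
      assume "\<not> norm (y t) < \<rho>"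
      then have "t \<in> Z" using that S by (auto simp: Z_def)
      then have "S \<le> t" unfolding S_def by (intro cInf_lower) (use \<open>bdd_below Z\<close> in auto)
      then show False using that by simp
    qed
    have "0 < S" using S small(2) by (cases "S = 0") auto
    have le: "norm (y t) \<le> \<rho>" if "t \<in> {0..S}" for t
    proof (cases "t = S")
      case True
      have "continuous_on {0..S} (\<lambda>t. norm (y t))"
        using cont by (rule continuous_on_subset) (use S in auto)
      then have lim: "((\<lambda>t. norm (y t)) \<longlongrightarrow> norm (y S)) (at S within {0..S})"
        using \<open>0 < S\<close> by (auto simp: continuous_on_def)
      have "\<forall>\<^sub>F t in at S within {0..S}. norm (y t) \<le> \<rho>"
        using S_least by (auto simp: eventually_at_filter less_imp_le intro!: always_eventually)
      moreover have "at S within {0..S} \<noteq> bot"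
        using \<open>0 < S\<close> by (simp add: trivial_limit_within islimpt_Icc)
      ultimately show ?thesis
        using tendsto_upperbound[OF lim] True by blast
    next
      case False
      then show ?thesis using S_least[of t] that by auto
    qed
    have "norm (y S) \<le> gronwall_const L S * (norm (y 0) + h)"
    proof (rule gronwall[of S y y' L h])
      fix t assume t: "t \<in> {0..S}"
      then have tT: "t \<in> {0..T}" using S by auto
      show "(y has_vector_derivative y' t) (at t within {0..S})"
        by (rule has_vector_derivative_within_subset[OF deriv[OF tT]]) (use S in auto)
      show "norm (y' t) \<le> L * norm (y t) + h"
        by (rule bound[OF tT le[OF t]])
    qed (use L h S in auto)
    also have "\<dots> \<le> gronwall_const L T * (norm (y 0) + h)"
      using gronwall_const_mono[OF L S(1,2)] h by (intro mult_right_mono) auto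
    also have "\<dots> < \<rho>" by (rule small)
    finally show False using S by simp
  qed
  show ?thesis
    using gronwall[OF deriv bound[OF _ less_imp_le[OF below]] L h x] below[OF x] by blast
qed

lemma continuous_on_interval_bounded:
  fixes g :: "real \<Rightarrow> 'b::real_normed_vector"
  assumes "continuous_on {a..b} g"
  shows "\<exists>M. \<forall>x\<in>{a..b}. norm (g x) \<le> M"
  using compact_imp_bounded[OF compact_continuous_image[OF assms compact_Icc]]
  by (auto simp: bounded_iff)

text \<open>The global Picard-Lindelof theorem. In the unknown \<open>v(x) = e\<^sup>-\<^sup>M\<^sup>x y(x)\<close> with \<open>M > 2 L\<close> the integral
  equation is a contraction on all of \<open>[0, T]\<close> at once, so no continuation from short intervals
  is necessary.\<close>

theorem picard_global:
  fixes F :: "real \<Rightarrow> 'a::euclidean_space \<Rightarrow> 'a"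
  assumes T: "0 \<le> T"
    and cont: "continuous_on ({0..T} \<times> UNIV) (\<lambda>(x, y). F x y)"
    and lip: "\<And>x y z. x \<in> {0..T} \<Longrightarrow> norm (F x y - F x z) \<le> L * norm (y - z)"
  obtains y where "y 0 = a"
    and "\<And>x. x \<in> {0..T} \<Longrightarrow> (y has_vector_derivative F x (y x)) (at x within {0..T})"
proof -
  define M where "M = 2 * \<bar>L\<bar> + 1"
  have M: "M > 0" by (simp add: M_def add_nonneg_pos)
  \<comment> \<open>Retracting the line to \<open>[0, T]\<close> lets the fixed point be sought among bounded continuous functions on the line.\<close>
  define \<theta> where "\<theta> x = max 0 (min T x)" for x :: real
  have \<theta>: "\<theta> x \<in> {0..T}" for x using T by (auto simp: \<theta>_def)
  have \<theta>_id: "\<theta> x = x" if "x \<in> {0..T}" for x using that by (auto simp: \<theta>_def)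
  have c1: "continuous_on {0..T} (\<lambda>t. F t (g t))" if "continuous_on {0..T} g" for g
  proof -
    have "continuous_on {0..T} ((\<lambda>(x, y). F x y) \<circ> (\<lambda>t. (t, g t)))"
      by (intro continuous_on_compose continuous_intros that continuous_on_subset[OF cont]) auto
    then show ?thesis by (simp add: o_def)
  qed
  define G where "G v t = F t (exp (M * t) *\<^sub>R apply_bcontfun v t)" for v :: "real \<Rightarrow>\<^sub>C 'a" and t
  have Gc: "continuous_on {0..T} (G v)" for v
    unfolding G_def by (intro c1 continuous_intros continuous_on_apply_bcontfun)
  define y where "y v x = a + integral {0..x} (G v)" for v x
  have yd: "(y v has_vector_derivative G v x) (at x within {0..T})" if "x \<in> {0..T}" for v x
    unfolding y_def
    by (auto intro!: derivative_eq_intros integral_has_vector_derivative[OF Gc that])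
  have yc: "continuous_on {0..T} (y v)" for v
    by (rule continuous_on_vector_derivative[OF yd])
  define P where "P v x = exp (- M * \<theta> x) *\<^sub>R y v (\<theta> x)" for v x
  have "continuous_on {0..T} (\<lambda>x. exp (- M * x) *\<^sub>R y v x)" for v
    by (intro continuous_intros yc)
  then have hb: "bounded ((\<lambda>x. exp (- M * x) *\<^sub>R y v x) ` {0..T})" and
    hc: "continuous_on UNIV (P v)" for v
  proof -
    assume *: "\<And>v. continuous_on {0..T} (\<lambda>x. exp (- M * x) *\<^sub>R y v x)"
    show "bounded ((\<lambda>x. exp (- M * x) *\<^sub>R y v x) ` {0..T})"
      by (intro compact_imp_bounded compact_continuous_image *) auto
    have "continuous_on UNIV ((\<lambda>x. exp (- M * x) *\<^sub>R y v x) \<circ> \<theta>)"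
    proof (rule continuous_on_compose)
      show "continuous_on UNIV \<theta>" unfolding \<theta>_def by (intro continuous_intros)
      show "continuous_on (range \<theta>) (\<lambda>x. exp (- M * x) *\<^sub>R y v x)"
        by (rule continuous_on_subset[OF *]) (use \<theta> in auto)
    qed
    then show "continuous_on UNIV (P v)" by (simp add: o_def P_def)
  qed
  have Pb: "P v \<in> bcontfun" for v
  proof -
    have "range (P v) \<subseteq> (\<lambda>x. exp (- M * x) *\<^sub>R y v x) ` {0..T}"
      using \<theta> by (auto simp: P_def)
    then show ?thesis
      using hc bounded_subset[OF hb] unfolding bcontfun_def by blast
  qed
  define Q where "Q v = Bcontfun (P v)" for v
  have Q: "apply_bcontfun (Q v) = P v" for v
    unfolding Q_def by (rule Bcontfun_inverse[OF Pb])
  have contr: "dist (Q v) (Q w) \<le> (1/2) * dist v w" for v w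
  proof (rule dist_bound)
    fix x
    define s where "s = \<theta> x"
    have s: "s \<in> {0..T}" using \<theta> by (simp add: s_def)
    define D where "D = dist v w"
    have D: "0 \<le> D" by (simp add: D_def)
    have i: "G u integrable_on {0..s}" for u
      by (rule integrable_continuous_real) (rule continuous_on_subset[OF Gc], use s in auto)
    have e: "((\<lambda>t. \<bar>L\<bar> * D * exp (M * t)) has_integral
        (\<bar>L\<bar> * D * (exp (M * s) / M) - \<bar>L\<bar> * D * (exp (M * 0) / M))) {0..s}"
      using s M by (intro fundamental_theorem_of_calculus)
        (auto intro!: derivative_eq_intros simp:
            has_real_derivative_iff_has_vector_derivative[symmetric])
    have "norm (integral {0..s} (\<lambda>t. G v t - G w t)) \<le> integral {0..s} (\<lambda>t. \<bar>L\<bar> * D * exp (M * t))"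
    proof (rule integral_norm_bound_integral)
      show "(\<lambda>t. G v t - G w t) integrable_on {0..s}" by (intro integrable_diff i)
      show "(\<lambda>t. \<bar>L\<bar> * D * exp (M * t)) integrable_on {0..s}" using e by blast
      fix t assume t: "t \<in> {0..s}"
      have "norm (G v t - G w t) \<le> L * norm (exp (M * t) *\<^sub>R apply_bcontfun v t - exp (M * t) *\<^sub>R
          apply_bcontfun w t)"
        unfolding G_def by (rule lip) (use t s in auto)
      also have "\<dots> \<le> \<bar>L\<bar> * norm (exp (M * t) *\<^sub>R apply_bcontfun v t - exp (M * t) *\<^sub>R apply_bcontfun
          w t)"
        by (intro mult_right_mono) auto
      also have "\<dots> = \<bar>L\<bar> * (exp (M * t) * dist (apply_bcontfun v t) (apply_bcontfun w t))"
        by (simp add: dist_norm scaleR_diff_right[symmetric])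
      also have "\<dots> \<le> \<bar>L\<bar> * (exp (M * t) * D)"
        unfolding D_def by (intro mult_left_mono dist_bounded) auto
      finally show "norm (G v t - G w t) \<le> \<bar>L\<bar> * D * exp (M * t)" by (simp add: mult_ac)
    qed
    also have "\<dots> \<le> \<bar>L\<bar> * D * (exp (M * s) / M)"
      unfolding integral_unique[OF e] using M D by simp
    finally have *: "norm (integral {0..s} (\<lambda>t. G v t - G w t)) \<le> \<bar>L\<bar> * D * (exp (M * s) / M)" .
    have "dist (P v x) (P w x) = exp (- M * s) * norm (integral {0..s} (\<lambda>t. G v t - G w t))"
      by (simp add: P_def s_def[symmetric] y_def dist_norm scaleR_diff_right[symmetric]
          integral_diff i)
    also have "\<dots> \<le> exp (- M * s) * (\<bar>L\<bar> * D * (exp (M * s) / M))"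
      by (intro mult_left_mono *) auto
    also have "\<dots> = (\<bar>L\<bar> / M) * D"
      by (simp add: exp_minus field_simps)
    also have "\<dots> \<le> (1/2) * D"
      using M D by (intro mult_right_mono) (auto simp: M_def field_simps)
    finally show "dist (apply_bcontfun (Q v) x) (apply_bcontfun (Q w) x) \<le> (1/2) * dist v w"
      by (simp add: Q D_def)
  qed
  obtain v where v: "Q v = v"
    using banach_fix_type[of "1/2" Q] contr by auto
  have "exp (M * x) *\<^sub>R apply_bcontfun v x = y v x" if "x \<in> {0..T}" for x
  proof -
    have "apply_bcontfun v x = P v x" using Q[of v] v by simp
    then show ?thesis using \<theta>_id[OF that] by (simp add: P_def exp_minus)
  qed
  then have "(y v has_vector_derivative F x (y v x)) (at x within {0..T})" if "x \<in> {0..T}" for x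
    using yd[OF that, of v] that by (simp add: G_def)
  moreover have "y v 0 = a" by (simp add: y_def)
  ultimately show ?thesis using that by blast
qed

section \<open>Matrix calculus\<close>

abbreviation cvec :: "real^'n \<Rightarrow> complex^'n" where
  "cvec v \<equiv> \<chi> i. complex_of_real (v $ i)"

lemma bounded_bilinear_matrix_vector_mult:
  "bounded_bilinear ((*v) :: 'a::{euclidean_space,real_normed_field}^'n^'m \<Rightarrow> 'a^'n \<Rightarrow> 'a^'m)"
  unfolding bilinear_conv_bounded_bilinear[symmetric] bilinear_def
  by (auto intro!: linearI simp: vec_eq_iff matrix_vector_mult_def sum.distrib algebra_simps
      scaleR_sum_right)

lemma bounded_bilinear_matrix_matrix_mult:
  "bounded_bilinear ((**) :: 'a::{euclidean_space,real_normed_field}^'n^'m \<Rightarrow> 'a^'k^'n \<Rightarrow> 'a^'k^'m)"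
  unfolding bilinear_conv_bounded_bilinear[symmetric] bilinear_def
  by (auto intro!: linearI simp: vec_eq_iff matrix_matrix_mult_def sum.distrib algebra_simps
      scaleR_sum_right)

lemmas has_vector_derivative_matrix_vector =
  bounded_bilinear.has_vector_derivative[OF bounded_bilinear_matrix_vector_mult]

lemmas continuous_on_matrix_vector =
  bounded_bilinear.continuous_on[OF bounded_bilinear_matrix_vector_mult]

lemmas continuous_on_matrix_matrix =
  bounded_bilinear.continuous_on[OF bounded_bilinear_matrix_matrix_mult]

lemma bounded_linear_cmat: "bounded_linear (cmat :: real^'n^'m \<Rightarrow> _)"
  unfolding linear_conv_bounded_linear[symmetric]
  by (rule linearI) (simp_all add: vec_eq_iff scaleR_conv_of_real[where 'a = complex])

lemma bounded_linear_cvec: "bounded_linear (cvec :: real^'n \<Rightarrow> _)"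
  unfolding linear_conv_bounded_linear[symmetric]
  by (rule linearI) (simp_all add: vec_eq_iff scaleR_conv_of_real[where 'a = complex])

lemma cmat_mult: "cmat (A ** B) = cmat A ** cmat B"
  by (simp add: vec_eq_iff matrix_matrix_mult_def)

lemma cmat_mult_cvec: "cmat A *v cvec v = cvec (A *v v)"
  by (simp add: vec_eq_iff matrix_vector_mult_def)

lemma cmat_mat: "cmat (mat a) = mat (complex_of_real a)"
  by (simp add: vec_eq_iff mat_def)

lemma det_cmat: "det (cmat A) = complex_of_real (det A)"
  by (simp add: det_def)

text \<open>Stated for an arbitrary bilinear product, so that it covers vector equations and matrix equations
  alike.\<close>

lemma linear_ode:
  fixes times :: "'c::real_normed_vector \<Rightarrow> 'a::euclidean_space \<Rightarrow> 'a"
  assumes times: "bounded_bilinear times" and T: "0 \<le> T"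
    and C: "continuous_on {0..T} C" and g: "continuous_on {0..T} g"
  obtains y where "y 0 = a"
    and "\<And>x. x \<in> {0..T} \<Longrightarrow> (y has_vector_derivative times (C x) (y x) + g x) (at x within {0..T})"
proof -
  obtain K where K: "K > 0" "\<And>c y. norm (times c y) \<le> norm c * norm y * K"
    using bounded_bilinear.pos_bounded[OF times] by blast
  obtain b where b: "\<And>x. x \<in> {0..T} \<Longrightarrow> norm (C x) \<le> b"
    using continuous_on_interval_bounded[OF C] by metis
  show ?thesis
  proof (rule picard_global[of T "\<lambda>x y. times (C x) y + g x" "b * K" a])
    show "continuous_on ({0..T} \<times> UNIV) (\<lambda>(x, y). times (C x) y + g x)"
      unfolding case_prod_unfold
      by (intro continuous_intros bounded_bilinear.continuous_on[OF times]
          continuous_on_compose2[OF C continuous_on_fst]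
          continuous_on_compose2[OF g continuous_on_fst]) auto
    fix x :: real and y z :: 'a assume x: "x \<in> {0..T}"
    have "norm (times (C x) y + g x - (times (C x) z + g x)) = norm (times (C x) (y - z))"
      by (simp add: bounded_bilinear.diff_right[OF times])
    also have "\<dots> \<le> norm (C x) * norm (y - z) * K" by (rule K)
    also have "\<dots> \<le> b * norm (y - z) * K"
      using b[OF x] K(1) by (intro mult_right_mono) auto
    finally show "norm (times (C x) y + g x - (times (C x) z + g x)) \<le> b * K * norm (y - z)"
      by (simp add: mult_ac)
  qed (use T that in auto)
qed

lemma invertible_matrix_inv:
  assumes "invertible (A :: 'a::semiring_1^'n^'n)"
  shows "A ** matrix_inv A = mat 1" "matrix_inv A ** A = mat 1"
  using assms unfolding invertible_def matrix_inv_def by (metis (mono_tags, lifting) someI_ex)+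

text \<open>Cramer's rule writes the entries of the inverse as quotients of polynomials in the entries of the
  matrix. Thus the inverse inherits differentiability from the matrix.\<close>

lemma matrix_inv_component:
  fixes A :: "'a::field^'n^'n"
  assumes "invertible A"
  shows "matrix_inv A $ k $ j = det (\<chi> i l. if l = k then axis j 1 $ i else A $ i $ l) / det A"
proof -
  have d: "det A \<noteq> 0" using assms by (simp add: invertible_det_nz)
  have "A *v (matrix_inv A *v axis j 1) = axis j 1"
    by (simp add: matrix_vector_mul_assoc invertible_matrix_inv[OF assms])
  then have "matrix_inv A *v axis j 1 =
      (\<chi> k. det (\<chi> i l. if l = k then axis j 1 $ i else A $ i $ l) / det A)"
    by (simp only: cramer[OF d])
  moreover have "(matrix_inv A *v axis j 1) $ k = matrix_inv A $ k $ j"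
    by (simp add: matrix_vector_mult_def axis_def if_distrib cong: if_cong)
  ultimately show ?thesis by simp
qed

lemma differentiable_prod:
  fixes g :: "'i \<Rightarrow> 'a::real_normed_vector \<Rightarrow> 'b::real_normed_field"
  assumes "\<And>i. i \<in> I \<Longrightarrow> g i differentiable at x within S"
  shows "(\<lambda>x. \<Prod>i\<in>I. g i x) differentiable at x within S"
proof -
  have "\<forall>i\<in>I. \<exists>g'. (g i has_derivative g') (at x within S)"
    using assms unfolding differentiable_def by blast
  then obtain g' where "\<And>i. i \<in> I \<Longrightarrow> (g i has_derivative g' i) (at x within S)" by metis
  then have "((\<lambda>x. \<Prod>i\<in>I. g i x) has_derivative
      (\<lambda>y. \<Sum>i\<in>I. g' i y * (\<Prod>j\<in>I - {i}. g j x))) (at x within S)"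
    by (rule has_derivative_prod)
  then show ?thesis by (rule differentiableI)
qed

lemma differentiable_component:
  fixes M :: "'a::real_normed_vector \<Rightarrow> 'b::euclidean_space^'n"
  assumes "M differentiable F"
  shows "(\<lambda>x. M x $ i) differentiable F"
proof -
  obtain M' where "(M has_derivative M') F" using assms unfolding differentiable_def by blast
  from bounded_linear.has_derivative[OF bounded_linear_vec_nth this]
  show ?thesis by (rule differentiableI)
qed

lemma differentiable_vec:
  fixes M :: "'a::real_normed_vector \<Rightarrow> 'b::euclidean_space^'n"
  assumes "\<And>i. (\<lambda>x. M x $ i) differentiable (at x within S)"
  shows "M differentiable (at x within S)"
proof -
  have "(\<lambda>x. M x \<bullet> b) differentiable (at x within S)" if "b \<in> Basis" for b
  proof -
    obtain i u where b: "b = axis i u" using \<open>b \<in> Basis\<close> unfolding Basis_vec_def by blast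
    obtain M' where "((\<lambda>x. M x $ i) has_derivative M') (at x within S)"
      using assms[of i] unfolding differentiable_def by blast
    from bounded_linear.has_derivative[OF bounded_linear_inner_left this]
    have "(\<lambda>x. M x $ i \<bullet> u) differentiable (at x within S)" by (rule differentiableI)
    then show ?thesis by (simp add: b inner_axis)
  qed
  then show ?thesis by (simp add: differentiable_componentwise_within[of M])
qed

lemma differentiable_det:
  fixes M :: "'a::real_normed_vector \<Rightarrow> real^'n^'n"
  assumes "\<And>i j. (\<lambda>x. M x $ i $ j) differentiable (at x within S)"
  shows "(\<lambda>x. det (M x)) differentiable (at x within S)"
  unfolding det_def
  by (intro differentiable_sum differentiable_mult differentiable_const differentiable_prod
      assms finite_permutations ballI) auto

lemma differentiable_matrix_inv:
  fixes M :: "'a::real_normed_vector \<Rightarrow> real^'n^'n"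
  assumes M: "M differentiable (at x within S)" and inv: "\<And>y. invertible (M y)"
  shows "(\<lambda>x. matrix_inv (M x)) differentiable (at x within S)"
proof (intro differentiable_vec)
  fix i j
  have c: "(\<lambda>x. M x $ i $ j) differentiable (at x within S)" for i j
    by (intro differentiable_component M)
  have d0: "det (M x) \<noteq> 0" using inv by (simp add: invertible_det_nz)
  have d: "(\<lambda>x. det (M x)) differentiable (at x within S)"
    by (rule differentiable_det, rule c)
  have e: "(\<lambda>x. if l = i then axis j 1 $ k else M x $ k $ l) differentiable (at x within S)" for k l
    by (cases "l = i", simp, simp only: if_False, rule c)
  have "(\<lambda>x. det (\<chi> k l. if l = i then axis j 1 $ k else M x $ k $ l)) differentiable
      (at x within S)"
    by (rule differentiable_det, unfold vec_lambda_beta, rule e)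
  then have "(\<lambda>x. det (\<chi> k l. if l = i then axis j 1 $ k else M x $ k $ l) / det (M x))
      differentiable (at x within S)"
    using d0 by (rule differentiable_divide[OF _ d])
  then show "(\<lambda>x. matrix_inv (M x) $ i $ j) differentiable (at x within S)"
    unfolding matrix_inv_component[OF inv] .
qed

text \<open>All that is used of the regularity class: the first derivative is differentiable, and on each ball
  the function is Lipschitz continuous with a quadratic Taylor remainder.\<close>

lemma C2_E:
  fixes g :: "'a::euclidean_space \<Rightarrow> 'b::real_normed_vector"
  assumes "C2 g"
  obtains g' where "\<And>x. (g has_derivative blinfun_apply (g' x)) (at x)"
    and "\<And>x. g' differentiable (at x)"
    and "\<And>R. \<exists>M>0. (\<forall>x\<in>cball 0 R. \<forall>y\<in>cball 0 R.
            norm (g y - g x) \<le> M * norm (y - x) \<and>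
            norm (g y - g x - blinfun_apply (g' x) (y - x)) \<le> M * (norm (y - x))\<^sup>2)"
proof -
  obtain g' g'' where g': "\<And>x. (g has_derivative blinfun_apply (g' x)) (at x)"
    and g'': "\<And>x. (g' has_derivative blinfun_apply (g'' x)) (at x)"
    and cont: "continuous_on UNIV g''"
    using assms unfolding C2_def by blast
  have cont': "continuous_on UNIV g'"
    using g'' by (intro has_derivative_continuous_on) (auto intro: has_derivative_at_withinI)
  have "\<exists>M>0. (\<forall>x\<in>cball 0 R. \<forall>y\<in>cball 0 R. norm (g y - g x) \<le> M * norm (y - x) \<and>
            norm (g y - g x - blinfun_apply (g' x) (y - x)) \<le> M * (norm (y - x))\<^sup>2)" for R
  proof -
    have "bounded (g' ` cball 0 R)" "bounded (g'' ` cball 0 R)"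
      by (intro compact_imp_bounded compact_continuous_image continuous_on_subset[OF cont]
          continuous_on_subset[OF cont'] compact_cball; simp)+
    then obtain b1 b2 where b1: "\<And>x. x \<in> cball 0 R \<Longrightarrow> norm (g' x) \<le> b1"
      and b2: "\<And>x. x \<in> cball 0 R \<Longrightarrow> norm (g'' x) \<le> b2"
      unfolding bounded_iff by (meson imageI)
    define M where "M = max 1 (max b1 b2)"
    have "norm (g y - g x) \<le> M * norm (y - x)"
      "norm (g y - g x - blinfun_apply (g' x) (y - x)) \<le> M * (norm (y - x))\<^sup>2"
      if x: "x \<in> cball 0 R" and y: "y \<in> cball 0 R" for x y
    proof -
      have seg: "closed_segment x y \<subseteq> cball 0 R"
        using x y by (rule closed_segment_subset) (rule convex_cball)
      show "norm (g y - g x) \<le> M * norm (y - x)"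
      proof (rule differentiable_bound[OF convex_cball[of 0 R] _ _ y x])
        fix z assume z: "z \<in> cball (0::'a) R"
        show "(g has_derivative blinfun_apply (g' z)) (at z within cball 0 R)"
          using g' by (rule has_derivative_at_withinI)
        show "onorm (blinfun_apply (g' z)) \<le> M"
          using b1[OF z] by (simp add: norm_blinfun.rep_eq[symmetric] M_def)
      qed
      have lip: "norm (g' z - g' x) \<le> M * norm (z - x)" if z: "z \<in> cball 0 R" for z
      proof (rule differentiable_bound[OF convex_cball[of 0 R] _ _ z x])
        fix z assume z: "z \<in> cball (0::'a) R"
        show "(g' has_derivative blinfun_apply (g'' z)) (at z within cball 0 R)"
          using g'' by (rule has_derivative_at_withinI)
        show "onorm (blinfun_apply (g'' z)) \<le> M"
          using b2[OF z] by (simp add: norm_blinfun.rep_eq[symmetric] M_def)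
      qed
      have "norm (g y - g x - blinfun_apply (g' x) (y - x)) \<le> norm (y - x) * (M * norm (y - x))"
      proof (rule differentiable_bound_linearization[where S = "closed_segment x y"])
        show "x + t *\<^sub>R (y - x) \<in> closed_segment x y" if "t \<in> {0..1}" for t
          using that by (auto simp: closed_segment_def algebra_simps intro!: exI[of _ t])
        fix z assume z: "z \<in> closed_segment x y"
        show "(g has_derivative blinfun_apply (g' z)) (at z within closed_segment x y)"
          using g' by (rule has_derivative_at_withinI)
        have "onorm (blinfun_apply (g' z) - blinfun_apply (g' x)) = norm (g' z - g' x)"
          by (simp add: norm_blinfun.rep_eq minus_blinfun.rep_eq fun_diff_def)
        also have "\<dots> \<le> M * norm (z - x)" using lip z seg by blast
        also have "\<dots> \<le> M * norm (y - x)"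
          using segment_bound[OF z] by (intro mult_left_mono) (auto simp: M_def)
        finally show "onorm (blinfun_apply (g' z) - blinfun_apply (g' x)) \<le> M * norm (y - x)"
          .
      qed simp
      then show "norm (g y - g x - blinfun_apply (g' x) (y - x)) \<le> M * (norm (y - x))\<^sup>2"
        by (simp add: power2_eq_square mult_ac)
    qed
    moreover have "M > 0" by (simp add: M_def less_max_iff_disj)
    ultimately show ?thesis by blast
  qed
  moreover have "g' differentiable (at x)" for x
    using g''[of x] by (rule differentiableI)
  ultimately show ?thesis using that[of g'] g' by simp
qed

lemma differentiable_bilinear:
  fixes h :: "'b::real_normed_vector \<Rightarrow> 'c::real_normed_vector \<Rightarrow> 'd::real_normed_vector"
  assumes "bounded_bilinear h" "f differentiable (at x within S)" "g differentiable (at x within S)"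
  shows "(\<lambda>x. h (f x) (g x)) differentiable (at x within S)"
proof -
  obtain f' g' where "(f has_derivative f') (at x within S)" "(g has_derivative g') (at x within S)"
    using assms(2,3) unfolding differentiable_def by blast
  from bounded_bilinear.FDERIV[OF assms(1) this] show ?thesis by (rule differentiableI)
qed

text \<open>A real kernel vector would make \<open>0\<close> an eigenvalue.\<close>

lemma invertible_of_spectrum:
  fixes M :: "real^'n^'n"
  assumes "\<And>\<mu>. \<mu> \<in> mat_spectrum (cmat M) \<Longrightarrow> Re \<mu> > 0"
  shows "invertible M"
proof -
  have "v = 0" if v: "M *v v = 0" for v
  proof (rule ccontr)
    assume "v \<noteq> 0"
    then have "cvec v \<noteq> 0" by (simp add: vec_eq_iff)
    moreover have "cmat M *v cvec v = 0 *s cvec v"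
      unfolding cmat_mult_cvec v by (simp add: vec_eq_iff)
    ultimately have "0 \<in> mat_spectrum (cmat M)" unfolding mat_spectrum_def by blast
    then show False using assms by fastforce
  qed
  then show ?thesis
    using invertible_left_inverse[of M] matrix_left_invertible_ker[of M] by blast
qed

section \<open>The linearization along the profile\<close>

locale periodic_profile =
  fixes f :: "real^'n \<Rightarrow> real^'n" and B :: "real^'n \<Rightarrow> real^'n^'n" and ub :: "real \<Rightarrow> real^'n"
    and um u0 :: "real^'n" and T :: real and i1 :: 'n
  assumes profile: "nonconstant_periodic_profile f B um T ub"
    and base: "ub 0 = u0"
    and coords: "vector_derivative ub (at 0) = axis i1 1"
    and smooth_f: "C2 f" and smooth_B: "C2 B"
    and invertible_B: "\<And>x. invertible (B (ub x))"
begin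

abbreviation du :: "real \<Rightarrow> real^'n" where "du x \<equiv> vector_derivative ub (at x)"
abbreviation Bx :: "real \<Rightarrow> real^'n^'n" where "Bx \<equiv> lin_B B ub"
abbreviation A :: "real \<Rightarrow> real^'n^'n" where "A \<equiv> lin_A f B ub"
definition E :: "real \<Rightarrow> real^'n^'n" where "E x = matrix_inv (Bx x)"
definition C :: "real \<Rightarrow> real^'n^'n" where "C x = E x ** A x"

lemma T_pos: "0 < T"
  using profile by (simp add: nonconstant_periodic_profile_def)

lemma B_E: "Bx x ** E x = mat 1" and E_B: "E x ** Bx x = mat 1"
  using invertible_matrix_inv[OF invertible_B[of x]] by (simp_all add: E_def lin_B_def)

lemma E_cancel [simp]: "E x *v (Bx x *v v) = v" "Bx x *v (E x *v v) = v"
  by (simp_all add: matrix_vector_mul_assoc B_E E_B)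

lemma ub_deriv: "(ub has_vector_derivative du x) (at x)"
  and profile_eq: "Bx x *v du x = f (ub x) - f um"
proof -
  obtain u' where u': "(ub has_vector_derivative u') (at x)" "B (ub x) *v u' = f (ub x) - f um"
    using profile unfolding nonconstant_periodic_profile_def profile_solution_def by auto
  moreover have "du x = u'" using u'(1) by (rule vector_derivative_at)
  ultimately show "(ub has_vector_derivative du x) (at x)" "Bx x *v du x = f (ub x) - f um"
    by (simp_all add: lin_B_def)
qed

lemma du_eq: "du x = E x *v (f (ub x) - f um)"
  by (simp flip: profile_eq)

lemma ub_T: "ub T = u0"
proof -
  have "ub (0 + T) = ub 0" using profile unfolding nonconstant_periodic_profile_def by blast
  then show ?thesis by (simp add: base)
qed

text \<open>The derivative of the profile is recovered from the profile equation, and is therefore periodic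
  together with the profile.\<close>

lemma B_T: "Bx T = Bx 0" and du_T: "du T = du 0"
proof -
  show B: "Bx T = Bx 0" by (simp add: lin_B_def ub_T base)
  have E: "E T = E 0" by (simp add: E_def B)
  show "du T = du 0" by (simp add: du_eq E ub_T base)
qed

lemma A_T: "A T = A 0"
  by (simp add: lin_A_def du_T ub_T base)

lemma f_deriv: "(f has_derivative frechet_derivative f (at v)) (at v)"
  and B_deriv: "(B has_derivative frechet_derivative B (at v)) (at v)"
proof -
  obtain f' where "\<And>x. (f has_derivative blinfun_apply (f' x)) (at x)"
    using C2_E[OF smooth_f] by metis
  then show "(f has_derivative frechet_derivative f (at v)) (at v)"
    using frechet_derivative_works differentiableI by blast
  obtain B' where "\<And>x. (B has_derivative blinfun_apply (B' x)) (at x)"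
    using C2_E[OF smooth_B] by metis
  then show "(B has_derivative frechet_derivative B (at v)) (at v)"
    using frechet_derivative_works differentiableI by blast
qed

lemma jacobian_f: "(f has_derivative (\<lambda>h. jacobian f (at v) *v h)) (at v)"
  using f_deriv jacobian_works differentiableI by blast

lemma A_apply: "A x *v v = frechet_derivative f (at (ub x)) v - frechet_derivative B
    (at (ub x)) v *v du x"
proof -
  have "linear (frechet_derivative f (at (ub x)))" "linear (frechet_derivative B (at (ub x)))"
    using has_derivative_linear f_deriv B_deriv by blast+
  then have "linear (\<lambda>v. frechet_derivative f (at (ub x)) v - frechet_derivative B
      (at (ub x)) v *v du x)"
    by (auto intro!: linearI simp: linear_add linear_scale algebra_simps
      bounded_bilinear.scaleR_left[OF bounded_bilinear_matrix_vector_mult])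
  then show ?thesis
    unfolding lin_A_def by (simp add: matrix_works linear_matrix_vector_mul_eq)
qed

lemma ub_differentiable: "ub differentiable (at x)"
  using ub_deriv by (rule differentiableI_vector)

lemma B_differentiable: "Bx differentiable (at x)"
proof -
  have "B \<circ> ub differentiable (at x)"
    using ub_differentiable B_deriv differentiableI by (intro differentiable_chain_at) blast+
  then show ?thesis by (simp add: o_def lin_B_def[abs_def])
qed

lemma E_differentiable: "E differentiable (at x)"
  unfolding E_def[abs_def]
  by (rule differentiable_matrix_inv[OF B_differentiable]) (simp add: lin_B_def invertible_B)

lemma f_ub_differentiable: "(\<lambda>x. f (ub x)) differentiable (at x)"
proof -
  have "f \<circ> ub differentiable (at x)"
    using ub_differentiable f_deriv differentiableI by (intro differentiable_chain_at) blast+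
  then show ?thesis by (simp add: o_def)
qed

lemma du_differentiable: "du differentiable (at x)"
  unfolding du_eq
  by (intro differentiable_bilinear[OF bounded_bilinear_matrix_vector_mult] E_differentiable
    differentiable_diff f_ub_differentiable differentiable_const)

lemma A_differentiable: "A differentiable (at x)"
proof (intro differentiable_vec)
  fix i j
  obtain f' where f': "\<And>x. (f has_derivative blinfun_apply (f' x)) (at x)" "\<And>x. f' differentiable
      (at x)"
    using C2_E[OF smooth_f] by metis
  obtain B' where B': "\<And>x. (B has_derivative blinfun_apply (B' x)) (at x)" "\<And>x. B' differentiable
      (at x)"
    using C2_E[OF smooth_B] by metis
  have "f' \<circ> ub differentiable (at x)" "B' \<circ> ub differentiable (at x)"
    by (intro differentiable_chain_at ub_differentiable f' B')+
  then have "(\<lambda>x. blinfun_apply (f' (ub x)) (axis j 1) - blinfun_apply (B' (ub x)) (axis j 1) *v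
      du x)
      differentiable (at x)"
    unfolding o_def
    by (intro differentiable_diff differentiable_bilinear[OF bounded_bilinear_matrix_vector_mult]
        differentiable_bilinear[OF bounded_bilinear_blinfun_apply] du_differentiable
            differentiable_const)
  then have "(\<lambda>x. A x *v axis j 1) differentiable (at x)"
    using frechet_derivative_at[OF f'(1)] frechet_derivative_at[OF B'(1)] by (simp add: A_apply)
  then have "(\<lambda>x. (A x *v axis j 1) $ i) differentiable (at x)"
    by (rule differentiable_component)
  moreover have "(A x *v axis j 1) $ i = A x $ i $ j" for x
    by (simp add: matrix_vector_mult_def axis_def if_distrib cong: if_cong)
  ultimately show "(\<lambda>x. A x $ i $ j) differentiable (at x)" by simp
qed

lemma continuous_on_of_differentiable:
  "(\<And>x. g differentiable (at x)) \<Longrightarrow> continuous_on S g" for g :: "real \<Rightarrow> 'b::real_normed_vector"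
  by (intro continuous_at_imp_continuous_on ballI differentiable_imp_continuous_within)

lemma continuous_E: "continuous_on S E" and continuous_A: "continuous_on S A"
  and continuous_C: "continuous_on S C" and continuous_ub: "continuous_on S ub"
  and continuous_du: "continuous_on S du"
proof -
  show E: "continuous_on S E" and A: "continuous_on S A"
    by (intro continuous_on_of_differentiable E_differentiable A_differentiable)+
  show "continuous_on S C"
    unfolding C_def[abs_def] by (intro continuous_on_matrix_matrix E A)
  show "continuous_on S ub" "continuous_on S du"
    by (intro continuous_on_of_differentiable ub_differentiable du_differentiable)+
qed

text \<open>The profile equation is autonomous, so its derivative in \<open>x\<close> is the linearized equation for \<open>ub'\<close>:
  this is the translation mode.\<close>

lemma du_solves: "(du has_vector_derivative C x *v du x) (at x)"
proof -
  obtain d where d: "(du has_vector_derivative d) (at x)"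
    using du_differentiable[of x] vector_derivative_works by blast
  have "((\<lambda>x. Bx x) has_vector_derivative frechet_derivative B (at (ub x)) (du x)) (at x)"
    unfolding lin_B_def
        using vector_derivative_diff_chain_within[of ub "du x" x UNIV B] ub_deriv B_deriv
    by (simp add: o_def has_derivative_at_withinI)
  then have "((\<lambda>x. Bx x *v du x) has_vector_derivative
      (Bx x *v d + frechet_derivative B (at (ub x)) (du x) *v du x)) (at x)"
    by (rule has_vector_derivative_matrix_vector[OF _ d])
  moreover have "((\<lambda>x. f (ub x)) has_vector_derivative frechet_derivative f (at (ub x)) (du x))
      (at x)"
    using vector_derivative_diff_chain_within[of ub "du x" x UNIV f] ub_deriv f_deriv
    by (simp add: o_def has_derivative_at_withinI)
  then have "((\<lambda>x. Bx x *v du x) has_vector_derivative frechet_derivative f (at (ub x)) (du x))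
      (at x)"
    unfolding profile_eq by (auto intro!: derivative_eq_intros)
  ultimately have "Bx x *v d + frechet_derivative B (at (ub x)) (du x) *v du x =
      frechet_derivative f (at (ub x)) (du x)"
    by (rule vector_derivative_unique_at)
  then have "Bx x *v d = A x *v du x" by (simp add: A_apply algebra_simps)
  then have "E x *v (Bx x *v d) = C x *v du x" by (simp add: C_def matrix_vector_mul_assoc)
  then show ?thesis using d by simp
qed

end

section \<open>First variation of the profile family\<close>

lemma norm_matrix_vector_mult_le: "norm (P *v v) \<le> norm P * norm v"
  for P :: "'a::{real_normed_field}^'n^'m"
proof -
  have row: "norm ((P *v v) $ i) \<le> norm (P $ i) * norm v" for i
  proof -
    have "norm ((P *v v) $ i) \<le> (\<Sum>j\<in>UNIV. norm (P $ i $ j) * norm (v $ j))"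
      unfolding matrix_vector_mult_def by (simp add: norm_mult sum_norm_le)
    also have "\<dots> \<le> norm (P $ i) * norm v"
      using L2_set_mult_ineq[of "\<lambda>j. norm (P $ i $ j)" "\<lambda>j. norm (v $ j)" UNIV]
      by (simp add: norm_vec_def)
    finally show ?thesis .
  qed
  have "norm (P *v v) = L2_set (\<lambda>i. norm ((P *v v) $ i)) UNIV" by (simp add: norm_vec_def)
  also have "\<dots> \<le> L2_set (\<lambda>i. norm (P $ i) * norm v) UNIV"
    by (intro L2_set_mono row) simp
  also have "\<dots> = norm P * norm v"
    by (simp add: norm_vec_def[of P] L2_set_left_distrib)
  finally show ?thesis .
qed

context periodic_profile
begin

text \<open>The fundamental matrix \<open>X\<close> gives the variation in \<open>u\<^sub>0\<close>, \<open>K\<close> the response to a constant unit flux,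
  and \<open>z\<close> the variation in the speed, with reversed sign. The initial value problems determine them on
  \<open>[0, T]\<close>; outside this interval the choice leaves them arbitrary.\<close>

definition X :: "real \<Rightarrow> real^'n^'n" where
  "X = (SOME X. X 0 = mat 1 \<and>
     (\<forall>x\<in>{0..T}. (X has_vector_derivative C x ** X x) (at x within {0..T})))"

definition K :: "real \<Rightarrow> real^'n^'n" where
  "K = (SOME K. K 0 = 0 \<and>
     (\<forall>x\<in>{0..T}. (K has_vector_derivative C x ** K x + E x) (at x within {0..T})))"

definition z :: "real \<Rightarrow> real^'n" where
  "z = (SOME z. z 0 = 0 \<and>
     (\<forall>x\<in>{0..T}. (z has_vector_derivative C x *v z x + E x *v (ub x - um)) (at x within {0..T})))"

lemma X_0: "X 0 = mat 1"
  and X_deriv: "x \<in> {0..T} \<Longrightarrow> (X has_vector_derivative C x ** X x) (at x within {0..T})"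
proof -
  obtain Y :: "real \<Rightarrow> real^'n^'n" where "Y 0 = mat 1"
    "\<And>x. x \<in> {0..T} \<Longrightarrow> (Y has_vector_derivative C x ** Y x + 0) (at x within {0..T})"
    by (rule linear_ode[where g = "\<lambda>_. 0" and a = "mat 1",
        OF bounded_bilinear_matrix_matrix_mult less_imp_le[OF T_pos] continuous_C
            continuous_on_const])
       (rule that)
  then have "\<exists>X. X 0 = mat 1 \<and>
      (\<forall>x\<in>{0..T}. (X has_vector_derivative C x ** X x) (at x within {0..T}))"
    by auto
  from someI_ex[OF this]
  show "X 0 = mat 1" "x \<in> {0..T} \<Longrightarrow> (X has_vector_derivative C x ** X x) (at x within {0..T})"
    unfolding X_def[symmetric] by auto
qed

lemma K_0: "K 0 = 0"
  and K_deriv: "x \<in> {0..T} \<Longrightarrow> (K has_vector_derivative C x ** K x + E x) (at x within {0..T})"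
proof -
  obtain Y :: "real \<Rightarrow> real^'n^'n" where "Y 0 = 0"
    "\<And>x. x \<in> {0..T} \<Longrightarrow> (Y has_vector_derivative C x ** Y x + E x) (at x within {0..T})"
    by (rule linear_ode[where a = 0,
        OF bounded_bilinear_matrix_matrix_mult less_imp_le[OF T_pos] continuous_C continuous_E])
       (rule that)
  then have "\<exists>K. K 0 = 0 \<and>
      (\<forall>x\<in>{0..T}. (K has_vector_derivative C x ** K x + E x) (at x within {0..T}))"
    by auto
  from someI_ex[OF this]
  show "K 0 = 0" "x \<in> {0..T} \<Longrightarrow> (K has_vector_derivative C x ** K x + E x) (at x within {0..T})"
    unfolding K_def[symmetric] by auto
qed

lemma z_0: "z 0 = 0"
  and z_deriv: "x \<in> {0..T} \<Longrightarrow>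
    (z has_vector_derivative C x *v z x + E x *v (ub x - um)) (at x within {0..T})"
proof -
  have "continuous_on {0..T} (\<lambda>x. E x *v (ub x - um))"
    by (intro continuous_on_matrix_vector continuous_E continuous_intros continuous_ub)
  note inhomogeneity = this
  obtain y where "y 0 = 0"
    "\<And>x. x \<in> {0..T} \<Longrightarrow>
      (y has_vector_derivative C x *v y x + E x *v (ub x - um)) (at x within {0..T})"
    by (rule linear_ode[where a = 0,
        OF bounded_bilinear_matrix_vector_mult less_imp_le[OF T_pos] continuous_C inhomogeneity])
       (rule that)
  then have "\<exists>z. z 0 = 0 \<and> (\<forall>x\<in>{0..T}.
      (z has_vector_derivative C x *v z x + E x *v (ub x - um)) (at x within {0..T}))"
    by auto
  from someI_ex[OF this]
  show "z 0 = 0" "x \<in> {0..T} \<Longrightarrow>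
    (z has_vector_derivative C x *v z x + E x *v (ub x - um)) (at x within {0..T})"
    unfolding z_def[symmetric] by auto
qed

lemma X_vector_deriv:
  assumes "x \<in> {0..T}"
  shows "((\<lambda>x. X x *v a) has_vector_derivative C x *v (X x *v a)) (at x within {0..T})"
  using has_vector_derivative_matrix_vector[OF X_deriv[OF assms] has_vector_derivative_const[of a]]
  by (simp add: matrix_vector_mul_assoc)

lemma K_vector_deriv:
  assumes "x \<in> {0..T}"
  shows "((\<lambda>x. K x *v a) has_vector_derivative C x *v (K x *v a) + E x *v a) (at x within {0..T})"
  using has_vector_derivative_matrix_vector[OF K_deriv[OF assms] has_vector_derivative_const[of a]]
  by (simp add: matrix_vector_mul_assoc matrix_vector_mult_add_rdistrib)

lemma coefficient_bounds:
  obtains b where "b > 0"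
    and "\<And>x. x \<in> {0..T} \<Longrightarrow> norm (E x) \<le> b"
    and "\<And>x. x \<in> {0..T} \<Longrightarrow> norm (C x) \<le> b"
    and "\<And>x. x \<in> {0..T} \<Longrightarrow> norm (du x) \<le> b"
    and "\<And>x. x \<in> {0..T} \<Longrightarrow> norm (ub x) \<le> b"
proof -
  note bd = continuous_on_interval_bounded[of 0 T]
  obtain b1 where b1: "\<forall>x\<in>{0..T}. norm (E x) \<le> b1" using bd[OF continuous_E] ..
  obtain b2 where b2: "\<forall>x\<in>{0..T}. norm (C x) \<le> b2" using bd[OF continuous_C] ..
  obtain b3 where b3: "\<forall>x\<in>{0..T}. norm (du x) \<le> b3" using bd[OF continuous_du] ..
  obtain b4 where b4: "\<forall>x\<in>{0..T}. norm (ub x) \<le> b4" using bd[OF continuous_ub] ..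
  show ?thesis
  proof (rule that[of "max 1 (max (max b1 b2) (max b3 b4))"])
    fix x assume x: "x \<in> {0..T}"
    show "norm (E x) \<le> max 1 (max (max b1 b2) (max b3 b4))" using bspec[OF b1 x] by linarith
    show "norm (C x) \<le> max 1 (max (max b1 b2) (max b3 b4))" using bspec[OF b2 x] by linarith
    show "norm (du x) \<le> max 1 (max (max b1 b2) (max b3 b4))" using bspec[OF b3 x] by linarith
    show "norm (ub x) \<le> max 1 (max (max b1 b2) (max b3 b4))" using bspec[OF b4 x] by linarith
  qed simp
qed

definition perturbation :: "real^'n \<Rightarrow> real^'n \<Rightarrow> real \<Rightarrow> real" where
  "perturbation v c s = norm (v - um) + norm (c - u0) + \<bar>s\<bar>"

lemma difference_identity:
  assumes "B u *v u' = f u - f v - s *\<^sub>R (u - v)"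
  shows "Bx x *v (u' - du x) =
    (f u - f (ub x)) - (f v - f um) - s *\<^sub>R (u - v) - (B u - Bx x) *v (du x + (u' - du x))"
proof -
  have "(B u - Bx x) *v (du x + (u' - du x)) = B u *v u' - Bx x *v u'"
    by (simp add: matrix_vector_mult_diff_rdistrib)
  moreover have "Bx x *v (u' - du x) = Bx x *v u' - (f (ub x) - f um)"
    by (simp add: matrix_vector_mult_diff_distrib profile_eq)
  ultimately show ?thesis using assms by simp
qed

text \<open>The difference \<open>d\<close> of two profiles satisfies \<open>|d'| \<le> L |d| + H \<delta>\<close>, where \<open>\<delta>\<close> measures the change of
  the parameters. The matrix \<open>B\<close> is invertible only along the base profile, so the equation for \<open>d'\<close>
  is solved with \<open>B(ub)\<close>; the error \<open>(B(u) - B(ub)) d'\<close> is absorbed as long as \<open>d\<close> is small. The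
  barrier form of Gronwall's inequality shows that \<open>d\<close> stays small on the whole period.\<close>

lemma profile_lipschitz:
  obtains G \<delta> where "G > 0" "\<delta> > 0"
    and "\<And>v c s u u' x. \<lbrakk>u 0 = c;
         \<And>x. x \<in> {0..T} \<Longrightarrow> (u has_vector_derivative u' x) (at x within {0..T});
         \<And>x. x \<in> {0..T} \<Longrightarrow> B (u x) *v u' x = f (u x) - f v - s *\<^sub>R (u x - v);
         perturbation v c s < \<delta>; x \<in> {0..T}\<rbrakk> \<Longrightarrow>
         norm (u x - ub x) \<le> G * perturbation v c s \<and> norm (u' x - du x) \<le> G * perturbation v c s \<and>
         norm (u x - ub x) \<le> 1"
proof -
  obtain b where b: "b > 0" and bE: "\<And>x. x \<in> {0..T} \<Longrightarrow> norm (E x) \<le> b"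
    and bdu: "\<And>x. x \<in> {0..T} \<Longrightarrow> norm (du x) \<le> b" and bub: "\<And>x. x \<in> {0..T} \<Longrightarrow> norm (ub x) \<le> b"
    using coefficient_bounds by metis
  define R where "R = max b (norm um) + 1"
  have R: "R > 0" "b + 1 \<le> R" "norm um + 1 \<le> R" using b by (auto simp: R_def)
  obtain f' where "\<And>R. \<exists>M>0. \<forall>x\<in>cball 0 R. \<forall>y\<in>cball 0 R. norm (f y - f x) \<le> M * norm (y - x) \<and>
      norm (f y - f x - blinfun_apply (f' x) (y - x)) \<le> M * (norm (y - x))\<^sup>2"
    using C2_E[OF smooth_f] by metis
  then obtain Mf where Mf: "Mf > 0" "\<And>x y. x \<in> cball 0 R \<Longrightarrow> y \<in> cball 0 R \<Longrightarrow>
      norm (f y - f x) \<le> Mf * norm (y - x)" by metis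
  obtain B' where "\<And>R. \<exists>M>0. \<forall>x\<in>cball 0 R. \<forall>y\<in>cball 0 R. norm (B y - B x) \<le> M * norm (y - x) \<and>
      norm (B y - B x - blinfun_apply (B' x) (y - x)) \<le> M * (norm (y - x))\<^sup>2"
    using C2_E[OF smooth_B] by metis
  then obtain MB where MB: "MB > 0" "\<And>x y. x \<in> cball 0 R \<Longrightarrow> y \<in> cball 0 R \<Longrightarrow>
      norm (B y - B x) \<le> MB * norm (y - x)" by metis
  \<comment> \<open>The radius within which the term \<open>(B(u) - B(ub)) d'\<close> is absorbed: there \<open>b MB |d| \<le> 1/2\<close>.\<close>
  define \<rho> where "\<rho> = min 1 (1 / (2 * (b * MB)))"
  have \<rho>: "\<rho> > 0" "\<rho> \<le> 1" "b * MB * \<rho> \<le> 1/2"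
  proof -
    show "\<rho> > 0" "\<rho> \<le> 1" using b MB(1) by (auto simp: \<rho>_def)
    have "\<rho> \<le> 1 / (2 * (b * MB))" by (simp add: \<rho>_def)
    then show "b * MB * \<rho> \<le> 1/2" using b MB(1) by (simp add: field_simps)
  qed
  define L where "L = 2 * b * (Mf + MB * b)"
  define H where "H = 2 * b * (Mf + 2 * R)"
  have L: "L > 0" and H: "H > 0" using b Mf(1) MB(1) R(1)
      by (auto simp: L_def H_def intro!: mult_pos_pos add_pos_pos)
  define \<Gamma> where "\<Gamma> = gronwall_const L T"
  have \<Gamma>: "\<Gamma> > 0" unfolding \<Gamma>_def using T_pos by (intro gronwall_const_pos) auto
  define \<delta> where "\<delta> = \<rho> / (1 + \<Gamma> * (1 + H))"
  have den: "1 + \<Gamma> * (1 + H) > 0" using \<Gamma> H by (simp add: add_pos_pos)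
  have \<delta>: "\<delta> > 0" using \<rho> den by (simp add: \<delta>_def)
  define G where "G = \<Gamma> * (1 + H) + (L * (\<Gamma> * (1 + H)) + H)"
  have G: "G > 0" "\<Gamma> * (1 + H) \<le> G" "L * (\<Gamma> * (1 + H)) + H \<le> G"
    using \<Gamma> H L by (auto simp: G_def intro!: add_pos_pos mult_pos_pos)
  show ?thesis
  proof (rule that[OF G(1) \<delta>])
    fix v c s u u' x
    assume init: "u 0 = c"
      and du: "\<And>x. x \<in> {0..T} \<Longrightarrow> (u has_vector_derivative u' x) (at x within {0..T})"
      and eq: "\<And>x. x \<in> {0..T} \<Longrightarrow> B (u x) *v u' x = f (u x) - f v - s *\<^sub>R (u x - v)"
      and small: "perturbation v c s < \<delta>" and x: "x \<in> {0..T}"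
    define p where "p = perturbation v c s"
    have p: "0 \<le> p" "norm (v - um) \<le> p" "norm (c - u0) \<le> p" "\<bar>s\<bar> \<le> p"
      by (auto simp: p_def perturbation_def)
    have p2: "(1 + \<Gamma> * (1 + H)) * p < \<rho>"
      using small den by (simp add: p_def \<delta>_def field_simps)
    then have p3: "p + \<Gamma> * (1 + H) * p < \<rho>" by (simp add: algebra_simps)
    have p4: "\<Gamma> * (1 + H) * p < \<rho>" "p < \<rho>"
    proof -
      have "0 \<le> \<Gamma> * (1 + H) * p" using \<Gamma> H p(1) by simp
      then show "\<Gamma> * (1 + H) * p < \<rho>" "p < \<rho>" using p3 p(1) by linarith+
    qed
    have v: "v \<in> cball 0 R"
    proof -
      have "norm v \<le> norm um + norm (v - um)" using norm_triangle_ineq[of um "v - um"] by simp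
      then show ?thesis using p(2) p4 \<rho>(2) R(3) by simp
    qed
    have um: "um \<in> cball 0 R" using R by simp
    define d where "d x = u x - ub x" for x
    define d' where "d' x = u' x - du x" for x
    have dd: "(d has_vector_derivative d' x) (at x within {0..T})" if "x \<in> {0..T}" for x
      unfolding d_def d'_def
      by (intro has_vector_derivative_diff du[OF that] has_vector_derivative_at_within[OF ub_deriv])
    have d0: "norm (d 0) \<le> p" using p(3) by (simp add: d_def init base)
    have bound: "norm (d' x) \<le> L * norm (d x) + H * p" if x: "x \<in> {0..T}" and dx: "norm (d x) \<le> \<rho>"
        for x
    proof -
      have ubR: "ub x \<in> cball 0 R" using bub[OF x] R(2) by simp
      have uR: "u x \<in> cball 0 R"
      proof -
        have "norm (u x) \<le> norm (ub x) + norm (d x)"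
          using norm_triangle_ineq[of "ub x" "d x"] by (simp add: d_def)
        then show ?thesis using bub[OF x] dx \<rho>(2) R(2) by simp
      qed
      have n1: "norm (f (u x) - f (ub x)) \<le> Mf * norm (d x)" using Mf(2)[OF ubR uR]
          by (simp add: d_def)
      have n2: "norm (f v - f um) \<le> Mf * p"
        using Mf(2)[OF um v] mult_left_mono[OF p(2), of Mf] Mf(1) by linarith
      have n3: "norm (s *\<^sub>R (u x - v)) \<le> 2 * R * p"
      proof -
        have "norm (u x - v) \<le> 2 * R" using norm_triangle_ineq4[of "u x" v] uR v by simp
        then have "\<bar>s\<bar> * norm (u x - v) \<le> p * (2 * R)" using p by (intro mult_mono) auto
        then show ?thesis by (simp add: mult_ac)
      qed
      have n4: "norm ((B (u x) - Bx x) *v (du x + d' x)) \<le> MB * norm (d x) * (b + norm (d' x))"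
      proof -
        have "norm ((B (u x) - Bx x) *v (du x + d' x)) \<le> norm (B (u x) - Bx x) * norm (du x + d' x)"
          by (rule norm_matrix_vector_mult_le)
        also have "\<dots> \<le> (MB * norm (d x)) * (b + norm (d' x))"
          using MB(2)[OF ubR uR] bdu[OF x] norm_triangle_ineq[of "du x" "d' x"] MB(1)
          by (intro mult_mono) (auto simp: d_def lin_B_def)
        finally show ?thesis .
      qed
      have "norm (Bx x *v d' x) \<le> Mf * norm (d x) + Mf * p + 2 * R * p + MB * norm (d x) * (b +
          norm (d' x))"
      proof -
        have "Bx x *v d' x = (f (u x) - f (ub x)) - (f v - f um) - s *\<^sub>R (u x - v) - (B (u x) -
            Bx x) *v (du x + d' x)"
          using difference_identity[OF eq[OF x], of x] by (simp add: d'_def)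
        also have "norm \<dots> \<le> norm (f (u x) - f (ub x)) + norm (f v - f um) + norm (s *\<^sub>R (u x - v)) +
            norm ((B (u x) - Bx x) *v (du x + d' x))"
          by (smt (verit) norm_triangle_ineq4)
        finally show ?thesis using n1 n2 n3 n4 by linarith
      qed
      moreover have "norm (d' x) \<le> b * norm (Bx x *v d' x)"
      proof -
        have "norm (E x *v (Bx x *v d' x)) \<le> norm (E x) * norm (Bx x *v d' x)"
          by (rule norm_matrix_vector_mult_le)
        also have "\<dots> \<le> b * norm (Bx x *v d' x)" using bE[OF x] by (intro mult_right_mono) auto
        finally show ?thesis by simp
      qed
      ultimately have "norm (d' x) \<le> b * (Mf * norm (d x) + Mf * p + 2 * R * p + MB * norm (d x) *
          (b + norm (d' x)))"
        using b by (meson mult_left_mono order_trans less_imp_le)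
      also have "\<dots> = b * (Mf + MB * b) * norm (d x) + b * (Mf + 2 * R) * p + (b * MB * norm (d x)) *
          norm (d' x)"
        by (simp add: algebra_simps)
      also have "(b * MB * norm (d x)) * norm (d' x) \<le> (1/2) * norm (d' x)"
      proof (intro mult_right_mono)
        have "b * MB * norm (d x) \<le> b * MB * \<rho>" using dx b MB(1) by (intro mult_left_mono) auto
        then show "b * MB * norm (d x) \<le> 1/2" using \<rho>(3) by linarith
      qed auto
      finally show ?thesis by (simp add: L_def H_def algebra_simps)
    qed
    have HG: "\<Gamma> * (norm (d 0) + H * p) \<le> \<Gamma> * (1 + H) * p"
    proof -
      have "\<Gamma> * (norm (d 0) + H * p) \<le> \<Gamma> * (p + H * p)" using d0 \<Gamma> by (intro mult_left_mono) auto
      then show ?thesis by (simp add: algebra_simps)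
    qed
    have main: "norm (d x) \<le> \<Gamma> * (norm (d 0) + H * p) \<and> norm (d x) < \<rho>"
      unfolding \<Gamma>_def
    proof (rule gronwall_barrier[of T d d' \<rho> L "H * p" x])
      show "gronwall_const L T * (norm (d 0) + H * p) < \<rho>" using HG p4(1) by (simp add: \<Gamma>_def)
      show "norm (d 0) < \<rho>" using d0 p4(2) by simp
    qed (use dd bound L H p(1) x in auto)
    then have dG: "norm (d x) \<le> \<Gamma> * (1 + H) * p" using HG by linarith
    have "norm (d' x) \<le> L * norm (d x) + H * p" using bound[OF x] main by simp
    also have "\<dots> \<le> L * (\<Gamma> * (1 + H) * p) + H * p" using mult_left_mono[OF dG less_imp_le[OF L]]
        by linarith
    also have "\<dots> = (L * (\<Gamma> * (1 + H)) + H) * p" by (simp add: algebra_simps)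
    also have "\<dots> \<le> G * p" using G(3) p(1) by (intro mult_right_mono) auto
    finally have "norm (d' x) \<le> G * p" .
    moreover have "norm (d x) \<le> G * p" using dG mult_right_mono[OF G(2) p(1)] by linarith
    moreover have "norm (d x) \<le> 1" using main \<rho>(2) by linarith
    ultimately show "norm (u x - ub x) \<le> G * perturbation v c s \<and>
        norm (u' x - du x) \<le> G * perturbation v c s \<and>
        norm (u x - ub x) \<le> 1"
      by (simp add: d_def d'_def p_def)
  qed
qed

end

lemma isCont_tendsto_nhds: "isCont g a \<Longrightarrow> (g \<longlongrightarrow> g a) (nhds a)"
  unfolding isCont_def tendsto_at_iff_tendsto_nhds .

context periodic_profile
begin

definition first_variation :: "real^'n \<Rightarrow> real^'n \<Rightarrow> real \<Rightarrow> real \<Rightarrow> real^'n" where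
  "first_variation v c s x = X x *v c - K x *v (jacobian f (at um) *v v) - s *\<^sub>R z x"

lemma first_variation_0: "first_variation v c s 0 = c"
  by (simp add: first_variation_def X_0 K_0 z_0)

lemma first_variation_deriv:
  assumes x: "x \<in> {0..T}"
  shows "(first_variation v c s has_vector_derivative
      (C x *v first_variation v c s x - E x *v (jacobian f (at um) *v v + s *\<^sub>R (ub x - um))))
      (at x within {0..T})"
proof -
  have "((\<lambda>x. X x *v c - K x *v (jacobian f (at um) *v v) - s *\<^sub>R z x) has_vector_derivative
      (C x *v (X x *v c) - (C x *v (K x *v (jacobian f (at um) *v v)) + E x *v (jacobian f (at um)
          *v v))
        - s *\<^sub>R (C x *v z x + E x *v (ub x - um)))) (at x within {0..T})"
    by (intro has_vector_derivative_diff X_vector_deriv[OF x] K_vector_deriv[OF x]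
        bounded_linear.has_vector_derivative[OF bounded_linear_scaleR_right z_deriv[OF x]])
  then show ?thesis
    by (simp add: first_variation_def[abs_def] algebra_simps matrix_scaleR_vector_ac)
qed

text \<open>The remainder \<open>r\<close> of the first variation satisfies the linearized equation with an inhomogeneity
  that collects Taylor remainders. Each of them is quadratic in the parameters because the difference
  of the profiles and its derivative are already known to be of first order.\<close>

lemma profile_expansion:
  assumes family: "profile_family f B um u0 T U"
  obtains M where "M > 0"
    and "\<forall>\<^sub>F (v, c, s) in nhds (um, u0, 0). \<forall>x\<in>{0..T}.
      norm (U v c s x - ub x - first_variation (v - um) (c - u0) s x) \<le> M * (perturbation v c s)\<^sup>2"
proof -
  obtain G \<delta> where G: "G > 0" and \<delta>: "\<delta> > 0"
    and lip: "\<And>v c s u u' x. \<lbrakk>u 0 = c;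
         \<And>x. x \<in> {0..T} \<Longrightarrow> (u has_vector_derivative u' x) (at x within {0..T});
         \<And>x. x \<in> {0..T} \<Longrightarrow> B (u x) *v u' x = f (u x) - f v - s *\<^sub>R (u x - v);
         perturbation v c s < \<delta>; x \<in> {0..T}\<rbrakk> \<Longrightarrow>
         norm (u x - ub x) \<le> G * perturbation v c s \<and> norm (u' x - du x) \<le> G * perturbation v c s \<and>
         norm (u x - ub x) \<le> 1"
    using profile_lipschitz by blast
  obtain b where b: "b > 0" and bE: "\<And>x. x \<in> {0..T} \<Longrightarrow> norm (E x) \<le> b"
    and bC: "\<And>x. x \<in> {0..T} \<Longrightarrow> norm (C x) \<le> b"
    and bdu: "\<And>x. x \<in> {0..T} \<Longrightarrow> norm (du x) \<le> b" and bub: "\<And>x. x \<in> {0..T} \<Longrightarrow> norm (ub x) \<le> b"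
    using coefficient_bounds by metis
  define R where "R = max b (norm um) + 1"
  have R: "R > 0" "b + 1 \<le> R" "norm um + 1 \<le> R" using b by (auto simp: R_def)
  obtain f' where f': "\<And>x. (f has_derivative blinfun_apply (f' x)) (at x)"
    and "\<And>R. \<exists>M>0. \<forall>x\<in>cball 0 R. \<forall>y\<in>cball 0 R. norm (f y - f x) \<le> M * norm (y - x) \<and>
      norm (f y - f x - blinfun_apply (f' x) (y - x)) \<le> M * (norm (y - x))\<^sup>2"
    using C2_E[OF smooth_f] by metis
  then obtain Mf where Mf: "Mf > 0" "\<And>x y. x \<in> cball 0 R \<Longrightarrow> y \<in> cball 0 R \<Longrightarrow>
      norm (f y - f x - blinfun_apply (f' x) (y - x)) \<le> Mf * (norm (y - x))\<^sup>2" by metis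
  obtain B' where B': "\<And>x. (B has_derivative blinfun_apply (B' x)) (at x)"
    and "\<And>R. \<exists>M>0. \<forall>x\<in>cball 0 R. \<forall>y\<in>cball 0 R. norm (B y - B x) \<le> M * norm (y - x) \<and>
      norm (B y - B x - blinfun_apply (B' x) (y - x)) \<le> M * (norm (y - x))\<^sup>2"
    using C2_E[OF smooth_B] by metis
  then obtain MB where MB: "MB > 0" 
    "\<And>x y. x \<in> cball 0 R \<Longrightarrow> y \<in> cball 0 R \<Longrightarrow> norm (B y - B x) \<le> MB * norm (y - x)"
    "\<And>x y. x \<in> cball 0 R \<Longrightarrow> y \<in> cball 0 R \<Longrightarrow>
      norm (B y - B x - blinfun_apply (B' x) (y - x)) \<le> MB * (norm (y - x))\<^sup>2" by metis
  have fd: "blinfun_apply (f' v) = frechet_derivative f (at v)" for v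
    using frechet_derivative_at[OF f'] by simp
  have Bd: "blinfun_apply (B' v) = frechet_derivative B (at v)" for v
    using frechet_derivative_at[OF B'] by simp
  have dfum: "jacobian f (at um) *v h = blinfun_apply (f' um) h" for h
    using has_derivative_unique[OF jacobian_f f'] by metis
  define N where "N = MB * G\<^sup>2 * b + MB * G * G + Mf * G\<^sup>2 + Mf + (G + 1)"
  have N: "N > 0" using MB(1) G Mf(1) b by (auto simp: N_def intro!: add_pos_pos mult_pos_pos)
  define M where "M = gronwall_const b T * (b * N)"
  have M: "M > 0" unfolding M_def using gronwall_const_pos T_pos b N
    by (intro mult_pos_pos) auto
  have est: "norm (u x - ub x - first_variation (v - um) (c - u0) s x) \<le> M * (perturbation v c s)\<^sup>2"
    if init: "u 0 = c" and sol: "profile_solution f B v s {0..T} u"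
      and small: "perturbation v c s < min \<delta> 1" and x: "x \<in> {0..T}" for u v c s x
  proof -
    define p where "p = perturbation v c s"
    have p: "0 \<le> p" "norm (v - um) \<le> p" "norm (c - u0) \<le> p" "\<bar>s\<bar> \<le> p" "p \<le> 1"
      using small by (auto simp: p_def perturbation_def)
    have "\<forall>x\<in>{0..T}. \<exists>u'. (u has_vector_derivative u') (at x within {0..T}) \<and>
         B (u x) *v u' = f (u x) - f v - s *\<^sub>R (u x - v)"
      using sol by (simp add: profile_solution_def)
    then obtain u' where du: "\<And>x. x \<in> {0..T} \<Longrightarrow> (u has_vector_derivative u' x) (at x within {0..T})"
      and eq: "\<And>x. x \<in> {0..T} \<Longrightarrow> B (u x) *v u' x = f (u x) - f v - s *\<^sub>R (u x - v)" by metis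
    define d where "d x = u x - ub x" for x
    define d' where "d' x = u' x - du x" for x
    have dG: "norm (d x) \<le> G * p" "norm (d' x) \<le> G * p" "norm (d x) \<le> 1" if "x \<in> {0..T}" for x
      using lip[where u = u and u' = u' and v = v and s = s, OF init du eq _ that] small
          by (auto simp: d_def d'_def p_def)
    define h where "h = v - um"
    define l where "l = first_variation h (c - u0) s"
    define r where "r x = d x - l x" for x
    define q where "q x = Bx x *v d' x - A x *v d x + (jacobian f (at um) *v h + s *\<^sub>R (ub x - um))"
        for x
    have r0: "r 0 = 0" by (simp add: r_def d_def l_def first_variation_0 init base)
    have rd: "(r has_vector_derivative C x *v r x + E x *v q x) (at x within {0..T})"
        if x: "x \<in> {0..T}" for x
    proof -
      have "(r has_vector_derivative u' x - du x -
         (C x *v l x - E x *v (jacobian f (at um) *v h + s *\<^sub>R (ub x - um)))) (at x within {0..T})"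
        unfolding r_def d_def l_def
        by (intro has_vector_derivative_diff du[OF x] has_vector_derivative_at_within[OF ub_deriv]
             first_variation_deriv[OF x])
      moreover have "u' x - du x - (C x *v l x - E x *v (jacobian f (at um) *v h + s *\<^sub>R (ub x -
          um))) =
          C x *v r x + E x *v q x"
        by (simp add: q_def d'_def r_def matrix_vector_right_distrib matrix_vector_mult_diff_distrib
            C_def flip: matrix_vector_mul_assoc)
      ultimately show ?thesis by simp
    qed
    have q_bound: "norm (q x) \<le> N * p\<^sup>2" if x: "x \<in> {0..T}" for x
    proof -
      have ubR: "ub x \<in> cball 0 R" using bub[OF x] R(2) by simp
      have umR: "um \<in> cball 0 R" using R by simp
      have vR: "v \<in> cball 0 R"
      proof -
        have "norm v \<le> norm um + norm (v - um)" using norm_triangle_ineq[of um "v - um"] by simp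
        then show ?thesis using p(2,5) R(3) by simp
      qed
      have uR: "u x \<in> cball 0 R"
      proof -
        have "norm (u x) \<le> norm (ub x) + norm (d x)"
          using norm_triangle_ineq[of "ub x" "d x"] by (simp add: d_def)
        then show ?thesis using bub[OF x] dG(3)[OF x] R(2) by simp
      qed
      have d2: "(norm (d x))\<^sup>2 \<le> G\<^sup>2 * p\<^sup>2"
        using power_mono[OF dG(1)[OF x], of 2] by (simp add: power_mult_distrib)
      define t1 where "t1 = (B (u x) - B (ub x) - blinfun_apply (B' (ub x)) (d x)) *v du x"
      define t2 where "t2 = (B (u x) - B (ub x)) *v d' x"
      define t3 where "t3 = f (u x) - f (ub x) - blinfun_apply (f' (ub x)) (d x)"
      define t4 where "t4 = f v - f um - blinfun_apply (f' um) h"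
      define t5 where "t5 = s *\<^sub>R (d x - h)"
      have "q x = t3 - t1 - t2 - t4 - t5"
        unfolding q_def t1_def t2_def t3_def t4_def t5_def dfum A_apply fd[symmetric] Bd[symmetric]
        using difference_identity[OF eq[OF x], of x]
        by (simp add: d'_def d_def h_def lin_B_def algebra_simps)
      also have "norm \<dots> \<le> norm t3 + norm t1 + norm t2 + norm t4 + norm t5"
        by (smt (verit) norm_triangle_ineq4)
      finally have "norm (q x) \<le> norm t3 + norm t1 + norm t2 + norm t4 + norm t5" .
      moreover have "norm t1 \<le> MB * G\<^sup>2 * b * p\<^sup>2"
      proof -
        have "norm t1 \<le> norm (B (u x) - B (ub x) - blinfun_apply (B' (ub x)) (d x)) * norm (du x)"
          unfolding t1_def by (rule norm_matrix_vector_mult_le)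
        also have "\<dots> \<le> (MB * (norm (d x))\<^sup>2) * b"
          using MB(3)[OF ubR uR] bdu[OF x] MB(1) by (intro mult_mono) (auto simp: d_def)
        also have "\<dots> \<le> (MB * (G\<^sup>2 * p\<^sup>2)) * b"
          using d2 MB(1) b by (intro mult_right_mono mult_left_mono) auto
        finally show ?thesis by (simp add: mult_ac)
      qed
      moreover have "norm t2 \<le> MB * G * G * p\<^sup>2"
      proof -
        have "norm t2 \<le> norm (B (u x) - B (ub x)) * norm (d' x)"
          unfolding t2_def by (rule norm_matrix_vector_mult_le)
        also have "\<dots> \<le> (MB * norm (d x)) * (G * p)"
          using MB(2)[OF ubR uR] dG(2)[OF x] MB(1) by (intro mult_mono) (auto simp: d_def)
        also have "\<dots> \<le> (MB * (G * p)) * (G * p)"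
          using dG(1)[OF x] MB(1) G p(1) by (intro mult_right_mono mult_left_mono) auto
        finally show ?thesis by (simp add: power2_eq_square mult_ac)
      qed
      moreover have "norm t3 \<le> Mf * G\<^sup>2 * p\<^sup>2"
      proof -
        have "norm t3 \<le> Mf * (norm (d x))\<^sup>2" using Mf(2)[OF ubR uR] by (simp add: t3_def d_def)
        also have "\<dots> \<le> Mf * (G\<^sup>2 * p\<^sup>2)" using d2 Mf(1) by (intro mult_left_mono) auto
        finally show ?thesis by (simp add: mult_ac)
      qed
      moreover have "norm t4 \<le> Mf * p\<^sup>2"
      proof -
        have "norm t4 \<le> Mf * (norm h)\<^sup>2" using Mf(2)[OF umR vR] by (simp add: t4_def h_def)
        also have "\<dots> \<le> Mf * p\<^sup>2"
          using power_mono[OF p(2), of 2] Mf(1) by (intro mult_left_mono) (auto simp: h_def)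
        finally show ?thesis .
      qed
      moreover have "norm t5 \<le> (G + 1) * p\<^sup>2"
      proof -
        have "norm (d x - h) \<le> G * p + p"
          using norm_triangle_ineq4[of "d x" h] dG(1)[OF x] p(2) by (simp add: h_def)
        then have "\<bar>s\<bar> * norm (d x - h) \<le> p * (G * p + p)" using p by (intro mult_mono) auto
        also have "p * (G * p + p) = (G + 1) * p\<^sup>2" by (simp add: power2_eq_square algebra_simps)
        finally show ?thesis by (simp add: t5_def)
      qed
      ultimately show ?thesis by (simp add: N_def algebra_simps)
    qed
    have "norm (r x) \<le> gronwall_const b T * (norm (r 0) + b * N * p\<^sup>2)"
    proof (rule gronwall[OF rd _ _ _ x])
      fix x assume x: "x \<in> {0..T}"
      have "norm (C x *v r x + E x *v q x) \<le> norm (C x) * norm (r x) + norm (E x) * norm (q x)"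
        by (intro norm_triangle_mono norm_matrix_vector_mult_le)
      also have "\<dots> \<le> b * norm (r x) + b * (N * p\<^sup>2)"
        using bC[OF x] bE[OF x] q_bound[OF x] b by (intro add_mono mult_mono) auto
      finally show "norm (C x *v r x + E x *v q x) \<le> b * norm (r x) + b * N * p\<^sup>2" by simp
    qed (use b N in auto)
    then have "norm (r x) \<le> M * p\<^sup>2" by (simp add: r0 M_def)
    then show ?thesis by (simp add: r_def d_def l_def h_def p_def)
  qed
  have "\<forall>\<^sub>F (v, c, s) in nhds (um, u0, 0). perturbation v c s < min \<delta> 1"
  proof -
    have "isCont (\<lambda>(v, c, s). perturbation v c s) (um, u0, 0)"
      unfolding perturbation_def case_prod_unfold by (intro continuous_intros)
    then have "((\<lambda>(v, c, s). perturbation v c s) \<longlongrightarrow> perturbation um u0 0) (nhds (um, u0, 0))"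
      using isCont_tendsto_nhds by fastforce
    then have "\<forall>\<^sub>F x in nhds (um, u0, 0). (\<lambda>(v, c, s). perturbation v c s) x < min \<delta> 1"
      by (rule order_tendstoD) (use \<delta> in \<open>simp add: perturbation_def\<close>)
    then show ?thesis by (simp add: case_prod_unfold)
  qed
  then have "\<forall>\<^sub>F (v, c, s) in nhds (um, u0, 0). \<forall>x\<in>{0..T}.
      norm (U v c s x - ub x - first_variation (v - um) (c - u0) s x) \<le> M * (perturbation v c s)\<^sup>2"
    using family[unfolded profile_family_def]
    by eventually_elim (use est in auto)
  with M show ?thesis by (rule that)
qed

end

lemma has_derivative_quadratic_remainder:
  fixes g :: "'a::real_normed_vector \<Rightarrow> 'b::real_normed_vector"
  assumes D: "bounded_linear D"
    and ev: "\<forall>\<^sub>F y in nhds x. norm (g y - b - D (y - x)) \<le> M * (norm (y - x))\<^sup>2"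
  shows "g x = b" and "(g has_derivative D) (at x)"
proof -
  show b: "g x = b"
    using eventually_nhds_x_imp_x[OF ev] by (simp add: linear_0[OF bounded_linear.linear[OF D]])
  have ev': "\<forall>\<^sub>F y in at x. norm (g y - b - D (y - x)) \<le> M * (norm (y - x))\<^sup>2"
    using ev unfolding eventually_at_filter by (rule eventually_mono) simp
  have "((\<lambda>y. (g y - g x - D (y - x)) /\<^sub>R norm (y - x)) \<longlongrightarrow> 0) (at x)"
  proof (rule Lim_null_comparison)
    show "\<forall>\<^sub>F y in at x. norm ((g y - g x - D (y - x)) /\<^sub>R norm (y - x)) \<le> M * norm (y - x)"
      using ev' eventually_neq_at_within[of x x UNIV]
    proof eventually_elim
      case (elim y)
      then have pos: "norm (y - x) > 0" by simp
      have "norm ((g y - g x - D (y - x)) /\<^sub>R norm (y - x)) = norm (g y - b - D (y - x)) / norm (y -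
          x)"
        by (simp add: b divide_inverse)
      also have "\<dots> \<le> (M * (norm (y - x))\<^sup>2) / norm (y - x)"
        using elim(1) pos by (intro divide_right_mono) auto
      also have "\<dots> = M * norm (y - x)" using pos by (simp add: power2_eq_square)
      finally show ?case .
    qed
    have "((\<lambda>y. M * norm (y - x)) \<longlongrightarrow> M * norm (x - x)) (at x)"
      by (intro tendsto_intros)
    then show "((\<lambda>y. M * norm (y - x)) \<longlongrightarrow> 0) (at x)" by simp
  qed
  then show "(g has_derivative D) (at x)"
    unfolding has_derivative_at_within using D by blast
qed

text \<open>Implicit differentiation at a single point. The function \<open>q\<close> is given and known to be continuous at
  \<open>x0\<close>; then differentiability of \<open>G\<close> at the one point \<open>(x0, q x0)\<close> determines the derivative of \<open>q\<close>,
  if the partial derivative is bounded below on the subspace \<open>V\<close> in which \<open>q\<close> moves. This matters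
  because the profile family is differentiated at the base point only.\<close>

lemma implicit_has_derivative:
  fixes G :: "'a::real_normed_vector \<times> 'b::real_normed_vector \<Rightarrow> 'c::real_normed_vector"
  assumes G: "(G has_derivative DG) (at (x0, q x0))"
    and level: "\<forall>\<^sub>F x in nhds x0. G (x, q x) = G (x0, q x0)"
    and cont: "isCont q x0"
    and V: "subspace V" and qV: "\<forall>\<^sub>F x in nhds x0. q x - q x0 \<in> V"
    and m: "m > 0" and below: "\<And>y. y \<in> V \<Longrightarrow> m * norm y \<le> norm (DG (0, y))"
    and L: "bounded_linear L" and LV: "\<And>h. L h \<in> V" and DGL: "\<And>h. DG (h, L h) = 0"
  shows "(q has_derivative L) (at x0)"
proof -
  have linDG: "linear DG" using G by (rule has_derivative_linear)
  obtain l where l: "l > 0" "\<And>h. norm (L h) \<le> norm h * l" using bounded_linear.pos_bounded[OF L]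
      by blast
  have "\<exists>d>0. \<forall>x. norm (x - x0) < d \<longrightarrow> norm (q x - q x0 - L (x - x0)) \<le> e * norm (x - x0)"
      if e: "e > 0" for e
  proof -
    \<comment> \<open>Small enough to absorb \<open>\<eta> |r|\<close> on the left, and to leave the factor \<open>e\<close>.\<close>
    define \<eta> where "\<eta> = min (m / 2) (e * m / (2 * (1 + l)))"
    have \<eta>: "\<eta> > 0" "\<eta> \<le> m / 2" "2 * \<eta> * (1 + l) \<le> e * m"
    proof -
      show "\<eta> \<le> m / 2" unfolding \<eta>_def by (rule min.cobounded1)
      show "\<eta> > 0" using m e l by (auto simp: \<eta>_def)
      have "\<eta> \<le> e * m / (2 * (1 + l))" by (simp add: \<eta>_def)
      then show "2 * \<eta> * (1 + l) \<le> e * m" using l by (simp add: field_simps)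
    qed
    obtain d1 where d1: "d1 > 0" "\<And>p. norm (p - (x0, q x0)) < d1 \<Longrightarrow>
        norm (G p - G (x0, q x0) - DG (p - (x0, q x0))) \<le> \<eta> * norm (p - (x0, q x0))"
      using G \<eta>(1) unfolding has_derivative_at_alt by meson
    have "isCont (\<lambda>x. (x, q x)) x0" using cont by (intro continuous_intros)
    then have "((\<lambda>x. (x, q x)) \<longlongrightarrow> (x0, q x0)) (nhds x0)"
      by (rule isCont_tendsto_nhds)
    then have "\<forall>\<^sub>F x in nhds x0. norm ((x, q x) - (x0, q x0)) < d1"
      using tendstoD[OF _ d1(1), of "\<lambda>x. (x, q x)" "(x0, q x0)"] by (simp add: dist_norm)
    with level qV have "\<forall>\<^sub>F x in nhds x0. norm (q x - q x0 - L (x - x0)) \<le> e * norm (x - x0)"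
    proof eventually_elim
      case (elim x)
      define h where "h = x - x0"
      define k where "k = q x - q x0"
      define r where "r = k - L h"
      have r: "r \<in> V" unfolding r_def k_def by (rule subspace_diff[OF V elim(2) LV])
      have "DG (0, r) = DG ((h, k) - (h, L h))" by (simp add: r_def)
      also have "\<dots> = DG (h, k)" by (simp only: linear_diff[OF linDG] DGL) simp
      finally have DGr: "DG (0, r) = DG (h, k)" .
      have "norm (DG (h, k)) \<le> \<eta> * norm (h, k)"
        using d1(2)[OF elim(3)] elim(1) by (simp add: h_def k_def)
      also have "\<dots> \<le> \<eta> * (norm h + norm k)"
        using \<eta>(1) norm_Pair_le by (intro mult_left_mono) auto
      also have "\<dots> \<le> \<eta> * (norm h + (norm r + norm h * l))"
        using \<eta>(1) norm_triangle_ineq[of r "L h"] l(2)[of h]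
            by (intro mult_left_mono) (auto simp: r_def)
      finally have "m * norm r \<le> \<eta> * (1 + l) * norm h + \<eta> * norm r"
        using below[OF r] DGr by (simp add: algebra_simps)
      moreover have "\<eta> * norm r \<le> m / 2 * norm r" using \<eta>(2) by (intro mult_right_mono) auto
      ultimately have "m * norm r \<le> 2 * \<eta> * (1 + l) * norm h" by (simp add: algebra_simps)
      also have "\<dots> \<le> e * m * norm h" using \<eta>(3) by (intro mult_right_mono) auto
      finally have "m * norm r \<le> m * (e * norm h)" by (simp add: mult_ac)
      then have "norm r \<le> e * norm h" using m by (simp only: mult_le_cancel_left_pos)
      then show ?case by (simp add: r_def k_def h_def)
    qed
    then show ?thesis by (auto simp: eventually_nhds_metric dist_norm)
  qed
  then show ?thesis using L by (simp add: has_derivative_at_alt)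
qed

context periodic_profile
begin

lemma first_variation_linear: "bounded_linear (\<lambda>p. first_variation (fst p) (fst (snd p)) (snd (snd
    p)) x)"
  unfolding linear_conv_bounded_linear[symmetric] first_variation_def
  by (rule linearI) (simp_all add: algebra_simps matrix_vector_right_distrib)

lemma first_variation_continuous: "continuous_on {0..T} (first_variation v c s)"
  by (rule continuous_on_vector_derivative[OF first_variation_deriv])

lemma perturbation_le: "perturbation v c s \<le> 3 * norm ((v, c, s) - (um, u0, 0))"
proof -
  have "norm (v - um) \<le> norm ((v, c, s) - (um, u0, 0))"
    using norm_fst_le[of "v - um" "(c - u0, s)"] by simp
  moreover have "norm (c - u0, s) \<le> norm ((v, c, s) - (um, u0, 0))"
    using norm_snd_le[of "(c - u0, s)" "v - um"] by simp
  ultimately show ?thesis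
    using norm_fst_le[of "c - u0" s] norm_snd_le[of s "c - u0"] by (simp add: perturbation_def)
qed

lemma perturbation_sq_le: "M \<ge> 0 \<Longrightarrow>
    M * (perturbation v c s)\<^sup>2 \<le> (9 * M) * (norm ((v, c, s) - (um, u0, 0)))\<^sup>2"
proof -
  assume "M \<ge> 0"
  have "(perturbation v c s)\<^sup>2 \<le> (3 * norm ((v, c, s) - (um, u0, 0)))\<^sup>2"
    by (rule power_mono[OF perturbation_le]) (simp add: perturbation_def)
  then have "M * (perturbation v c s)\<^sup>2 \<le> M * (3 * norm ((v, c, s) - (um, u0, 0)))\<^sup>2"
    using \<open>M \<ge> 0\<close> by (rule mult_left_mono)
  then show ?thesis by (simp add: power_mult_distrib)
qed

lemma family_at_base: "profile_family f B um u0 T U \<Longrightarrow> x \<in> {0..T} \<Longrightarrow> U um u0 0 x = ub x"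
  and family_has_derivative: "profile_family f B um u0 T U \<Longrightarrow> x \<in> {0..T} \<Longrightarrow>
     ((\<lambda>(v, c, s). U v c s x) has_derivative (\<lambda>(v, c, s). first_variation v c s x)) (at (um, u0,
         0))"
proof -
  assume family: "profile_family f B um u0 T U" and x: "x \<in> {0..T}"
  obtain M where M: "M > 0" and ev: "\<forall>\<^sub>F (v, c, s) in nhds (um, u0, 0). \<forall>x\<in>{0..T}.
      norm (U v c s x - ub x - first_variation (v - um) (c - u0) s x) \<le> M * (perturbation v c s)\<^sup>2"
    using profile_expansion[OF family] by blast
  have "\<forall>\<^sub>F p in nhds (um, u0, 0). norm ((\<lambda>(v, c, s). U v c s x) p - ub x -
      (\<lambda>(v, c, s). first_variation v c s x) (p - (um, u0, 0))) \<le> (9 * M) * (norm (p - (um, u0,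
          0)))\<^sup>2"
    using ev
  proof eventually_elim
    case (elim p)
    obtain v c s where p: "p = (v, c, s)" by (cases p)
    have "norm (U v c s x - ub x - first_variation (v - um) (c - u0) s x) \<le>
        M * (perturbation v c s)\<^sup>2"
      using elim x by (simp add: p)
    also have "\<dots> \<le> (9 * M) * (norm ((v, c, s) - (um, u0, 0)))\<^sup>2"
      by (rule perturbation_sq_le) (use M in simp)
    finally show ?case by (simp add: p)
  qed
  from has_derivative_quadratic_remainder[OF _ this] first_variation_linear[of x]
  show "U um u0 0 x = ub x"
    "((\<lambda>(v, c, s). U v c s x) has_derivative (\<lambda>(v, c, s). first_variation v c s x))
        (at (um, u0, 0))"
    by (simp_all add: case_prod_unfold)
qed

lemma profile_solution_continuous:
  assumes "profile_solution f B v s S u"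
  shows "continuous_on S u"
  using assms unfolding profile_solution_def
  by (metis continuous_on_eq_continuous_within has_vector_derivative_continuous)

text \<open>The remainder in the expansion of the profile is uniform on the period, so it can be integrated.\<close>

lemma family_integral_has_derivative:
  assumes family: "profile_family f B um u0 T U"
  shows "((\<lambda>(v, c, s). integral {0..T} (U v c s)) has_derivative
     (\<lambda>(v, c, s). integral {0..T} (first_variation v c s))) (at (um, u0, 0))"
proof -
  obtain M where M: "M > 0" and ev: "\<forall>\<^sub>F (v, c, s) in nhds (um, u0, 0). \<forall>x\<in>{0..T}.
      norm (U v c s x - ub x - first_variation (v - um) (c - u0) s x) \<le> M * (perturbation v c s)\<^sup>2"
    using profile_expansion[OF family] by blast
  have int: "first_variation v c s integrable_on {0..T}" for v c s
    by (rule integrable_continuous_real[OF first_variation_continuous])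
  have "\<forall>\<^sub>F p in nhds (um, u0, 0). norm ((\<lambda>(v, c, s). integral {0..T} (U v c s)) p - integral {0..T}
      ub -
      (\<lambda>(v, c, s). integral {0..T} (first_variation v c s)) (p - (um, u0, 0)))
      \<le> (9 * (M * T)) * (norm (p - (um, u0, 0)))\<^sup>2"
    using ev family[unfolded profile_family_def]
  proof eventually_elim
    case (elim p)
    obtain v c s where p: "p = (v, c, s)" by (cases p)
    have iU: "U v c s integrable_on {0..T}"
      using elim(2) by (auto simp: p intro!: integrable_continuous_real profile_solution_continuous)
    have iu: "ub integrable_on {0..T}" by (rule integrable_continuous_real[OF continuous_ub])
    have "norm (integral {0..T} (\<lambda>x. U v c s x - ub x - first_variation (v - um) (c - u0) s x)) \<le>
        integral {0..T} (\<lambda>x. M * (perturbation v c s)\<^sup>2)"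
      using elim(1)
          by (intro integral_norm_bound_integral integrable_diff iU iu int integrable_const_ivl)
              (auto simp: p)
    also have "\<dots> = (M * T) * (perturbation v c s)\<^sup>2" using T_pos by simp
    also have "\<dots> \<le> (9 * (M * T)) * (norm ((v, c, s) - (um, u0, 0)))\<^sup>2"
      by (rule perturbation_sq_le) (use M T_pos in auto)
    finally show ?case
      by (simp add: p integral_diff integrable_diff iU iu int)
  qed
  moreover have "bounded_linear (\<lambda>(v, c, s). integral {0..T} (first_variation v c s))"
    unfolding linear_conv_bounded_linear[symmetric] case_prod_unfold
  proof (rule linearI)
    note lin = bounded_linear.linear[OF first_variation_linear]
    fix p q :: "(real^'n) \<times> (real^'n) \<times> real" and r :: real
    show "integral {0..T} (first_variation (fst (p + q)) (fst (snd (p + q))) (snd (snd (p + q)))) =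
       integral {0..T} (first_variation (fst p) (fst (snd p)) (snd (snd p))) +
       integral {0..T} (first_variation (fst q) (fst (snd q)) (snd (snd q)))"
      unfolding integral_add[OF int int, symmetric]
      by (intro integral_cong) (use linear_add[OF lin] in simp)
    show "integral {0..T} (first_variation (fst (r *\<^sub>R p)) (fst (snd (r *\<^sub>R p))) (snd (snd (r *\<^sub>R
        p)))) =
       r *\<^sub>R integral {0..T} (first_variation (fst p) (fst (snd p)) (snd (snd p)))"
      unfolding integral_cmul[symmetric]
      by (intro integral_cong) (use linear_scale[OF lin] in simp)
  qed
  ultimately show ?thesis by (rule has_derivative_quadratic_remainder(2)[rotated])
qed

lemma var_w_eq:
  assumes "profile_family f B um u0 T U" "x \<in> {0..T}"
  shows "var_w um u0 U j x = X x *v axis j 1"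
proof -
  have "((\<lambda>c. (um, c, 0)) has_derivative (\<lambda>c. (0, c, 0))) (at u0)"
    by (auto intro!: derivative_eq_intros)
  from has_derivative_compose[OF this family_has_derivative[OF assms]]
  have "((\<lambda>c. U um c 0 x) has_derivative (\<lambda>c. first_variation 0 c 0 x)) (at u0)" by simp
  from frechet_derivative_at[OF this]
  have "frechet_derivative (\<lambda>c. U um c 0 x) (at u0) = (\<lambda>c. first_variation 0 c 0 x)" by simp
  then show ?thesis unfolding var_w_def by (simp add: first_variation_def)
qed

lemma var_z_eq:
  assumes "profile_family f B um u0 T U" "x \<in> {0..T}"
  shows "var_z um u0 U x = z x"
proof -
  have "((\<lambda>s. (um, u0, s)) has_derivative (\<lambda>s. (0, 0, s))) (at 0)"
    by (auto intro!: derivative_eq_intros)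
  from has_derivative_compose[OF this family_has_derivative[OF assms]]
  have "((\<lambda>s. U um u0 s x) has_derivative (\<lambda>s. first_variation 0 0 s x)) (at 0)" by simp
  then have "((\<lambda>s. U um u0 s x) has_vector_derivative - z x) (at 0)"
    by (simp add: has_vector_derivative_def first_variation_def)
  from vector_derivative_at[OF this] show ?thesis by (simp add: var_z_def)
qed

text \<open>The matrix of the transversality determinant. Column \<open>i1\<close> of \<open>X T - mat 1\<close> vanishes, because the
  translation mode is periodic, so adding \<open>z T\<close> there puts it in the place of that column.\<close>

definition \<Gamma> :: "real^'n^'n" where
  "\<Gamma> = (X T - mat 1) + (\<chi> i j. if j = i1 then z T $ i else 0)"

text \<open>Both sides solve the same linear initial value problem.\<close>

lemma X_axis: "x \<in> {0..T} \<Longrightarrow> X x *v axis i1 1 = du x"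
proof -
  assume x: "x \<in> {0..T}"
  obtain b where b: "b > 0" "\<And>x. x \<in> {0..T} \<Longrightarrow> norm (C x) \<le> b" using coefficient_bounds by metis
  have "norm (X x *v axis i1 1 - du x) \<le> gronwall_const b T * (norm (X 0 *v axis i1 1 - du 0) + 0)"
  proof (rule gronwall[OF _ _ _ _ x])
    fix x assume x: "x \<in> {0..T}"
    show "((\<lambda>x. X x *v axis i1 1 - du x) has_vector_derivative C x *v (X x *v axis i1 1) - C x *v
        du x)
        (at x within {0..T})"
      by (intro has_vector_derivative_diff X_vector_deriv[OF x] has_vector_derivative_at_within[OF
          du_solves])
    show "norm (C x *v (X x *v axis i1 1) - C x *v du x) \<le> b * norm (X x *v axis i1 1 - du x) + 0"
      using norm_matrix_vector_mult_le[of "C x" "X x *v axis i1 1 - du x"] 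
        mult_right_mono[OF b(2)[OF x], of "norm (X x *v axis i1 1 - du x)"]
      by (simp add: matrix_vector_mult_diff_distrib)
  qed (use b in auto)
  then show ?thesis by (simp add: X_0 coords)
qed

lemma X_T_axis: "(X T - mat 1) *v axis i1 1 = 0"
  using X_axis[of T] T_pos by (simp add: matrix_vector_mult_diff_rdistrib du_T coords)

lemma \<Gamma>_mult: "\<Gamma> *v y = (X T - mat 1) *v y + y $ i1 *\<^sub>R z T"
proof -
  have "(\<chi> i j. if j = i1 then z T $ i else 0) *v y = y $ i1 *\<^sub>R z T"
    by (simp add: vec_eq_iff matrix_vector_mult_def if_distrib[of "\<lambda>a. a * _"] cong: if_cong)
  then show ?thesis by (simp add: \<Gamma>_def matrix_vector_mult_add_rdistrib)
qed

lemma transversality_eq: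
  assumes "profile_family f B um u0 T U"
  shows "transversality i1 um u0 T U = det \<Gamma>"
proof -
  have T: "T \<in> {0..T}" "0 \<in> {0..T}" using T_pos by auto
  have col: "(M *v axis j 1) $ i = M $ i $ j" for M :: "real^'n^'n" and i j
    by (simp add: matrix_vector_mult_def axis_def if_distrib cong: if_cong)
  have zero: "(X T - mat 1) $ i $ i1 = 0" for i
    using X_T_axis by (simp only: col[symmetric] zero_index)
  have diff: "(X T *v axis j 1 - X 0 *v axis j 1) $ i = (X T - mat 1) $ i $ j" for i j
    unfolding col[symmetric] by (simp add: X_0 matrix_vector_mult_diff_rdistrib)
  show ?thesis
    unfolding transversality_def \<Gamma>_def var_z_eq[OF assms T(1)] var_z_eq[OF assms T(2)]
      var_w_eq[OF assms T(1)] var_w_eq[OF assms T(2)]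
    by (intro arg_cong[of _ _ det])
       (simp add: vec_eq_iff z_0 zero diff del: vector_minus_component)
qed

end

section \<open>The integral of motion and the mass derivative\<close>

lemma invertible_bounded_below:
  fixes M :: "real^'n^'n"
  assumes "invertible M"
  obtains m where "m > 0" "\<And>y. m * norm y \<le> norm (M *v y)"
proof -
  define k where "k = norm (matrix_inv M) + 1"
  have k: "k > 0" by (simp add: k_def add_nonneg_pos)
  have "1 / k * norm y \<le> norm (M *v y)" for y
  proof -
    have "norm y = norm (matrix_inv M *v (M *v y))"
      by (simp add: matrix_vector_mul_assoc invertible_matrix_inv[OF assms])
    also have "\<dots> \<le> norm (matrix_inv M) * norm (M *v y)" by (rule norm_matrix_vector_mult_le)
    also have "\<dots> \<le> k * norm (M *v y)" by (intro mult_right_mono) (auto simp: k_def)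
    finally show ?thesis using k by (simp add: field_simps)
  qed
  then show ?thesis using that[of "1 / k"] k by simp
qed

context periodic_profile
begin

text \<open>The functional \<open>h\<close> is the derivative of \<open>H um\<close> at \<open>u0\<close>. Differentiating
  \<open>H v (U v c 0 T) = H v c\<close> at the base point in \<open>c\<close> and in \<open>v\<close> gives the first two equations; in the
  latter the derivative of \<open>H\<close> in its first argument cancels, since both sides depend on \<open>v\<close> through it in
  the same way. Differentiating \<open>H um (ub x) = H um u0\<close> at \<open>x = 0\<close> gives the third.\<close>

lemma integral_annihilates_variations:
  assumes family: "profile_family f B um u0 T U" and ham: "quasi_Hamiltonian f B 0 um u0"
    and df: "invertible (jacobian f (at um))"
  obtains h :: "real^'n \<Rightarrow> real" where "linear h" "h \<noteq> (\<lambda>_. 0)"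
    and "\<And>c. h ((X T - mat 1) *v c) = 0" and "\<And>b. h (K T *v b) = 0" and "h (axis i1 1) = 0"
proof -
  have T: "T \<in> {0..T}" using T_pos by simp
  obtain H :: "real^'n \<Rightarrow> real^'n \<Rightarrow> real" where H': "\<forall>v u I. is_interval I \<and> 0 \<in> I \<and>
      profile_solution f B v 0 I u \<longrightarrow>
         (\<forall>x\<in>I. H v (u x) = H v (u 0))"
    and diff: "(\<lambda>(v, c). H v c) differentiable (at (um, u0))"
    and nz: "frechet_derivative (H um) (at u0) \<noteq> (\<lambda>h. 0)"
    using ham unfolding quasi_Hamiltonian_def by (elim exE conjE) rule
  have H: "H v (u x) = H v (u 0)"
    if "is_interval I" "0 \<in> I" "profile_solution f B v 0 I u" "x \<in> I" for v u I x
    using H'[rule_format, of I v u x] that by simp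
  obtain HD where HD: "((\<lambda>(v, c). H v c) has_derivative HD) (at (um, u0))"
    using diff unfolding differentiable_def by blast
  have linHD: "linear HD" using HD by (rule has_derivative_linear)
  define h where "h c = HD (0, c)" for c
  have linh: "linear h"
    unfolding h_def using linear_compose[OF _ linHD, of "\<lambda>c. (0, c)"]
        by (simp add: o_def linear_iff)
  have "((\<lambda>c. (um, c)) has_derivative (\<lambda>c. (0, c))) (at u0)" by (auto intro!: derivative_eq_intros)
  from has_derivative_compose[OF this HD]
  have Hu: "(H um has_derivative h) (at u0)" by (simp add: h_def[abs_def])
  have hnz: "h \<noteq> (\<lambda>_. 0)" using nz frechet_derivative_at[OF Hu] by simp

  have embed: "((\<lambda>(v, c). (v, c, 0::real)) has_derivative (\<lambda>(v, c). (v, c, 0))) (at (um, u0))"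
    unfolding case_prod_unfold by (auto intro!: derivative_eq_intros)
  have "((\<lambda>(v, c). (v, c, 0::real)) \<longlongrightarrow> (um, u0, 0)) (nhds (um, u0))"
    using isCont_tendsto_nhds[OF has_derivative_continuous[OF embed]] by simp
  from filterlim_iff[THEN iffD1, rule_format, OF this, OF family[unfolded profile_family_def]]
  have ev: "\<forall>\<^sub>F (v, c) in nhds (um, u0). H v (U v c 0 T) = H v c"
  proof eventually_elim
    case (elim p)
    obtain v c where p: "p = (v, c)" by (cases p)
    have "U v c 0 0 = c" "profile_solution f B v 0 {0..T} (U v c 0)" using elim by (simp_all add: p)
    then show ?case using H[of "{0..T}" v "U v c 0" T] T_pos by (simp add: p is_interval_cc)
  qed
  have "((\<lambda>(v, c). U v c 0 T) has_derivative (\<lambda>(v, c). first_variation v c 0 T)) (at (um, u0))"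
    using has_derivative_compose[OF embed, of "\<lambda>(v, c, s). U v c s T" "\<lambda>(v, c, s). first_variation v
        c s T"]
      family_has_derivative[OF family T] by (simp add: case_prod_unfold)
  then have g: "((\<lambda>p. (fst p, U (fst p) (snd p) 0 T)) has_derivative
      (\<lambda>p. (fst p, first_variation (fst p) (snd p) 0 T))) (at (um, u0))"
    unfolding case_prod_unfold
    by (intro has_derivative_Pair has_derivative_fst has_derivative_ident)
  have UT: "U um u0 0 T = u0" using family_at_base[OF family T] by (simp add: ub_T)
  have "((\<lambda>p. H (fst p) (snd p)) has_derivative HD)
      (at (fst (um, u0), U (fst (um, u0)) (snd (um, u0)) 0 T))"
    unfolding fst_conv snd_conv UT using HD by (simp only: case_prod_unfold)
  from has_derivative_compose[OF g this]
  have "((\<lambda>p. H (fst p) (U (fst p) (snd p) 0 T)) has_derivative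
      (\<lambda>p. HD (fst p, first_variation (fst p) (snd p) 0 T))) (at (um, u0))"
    by (simp only: fst_conv snd_conv)
  moreover have "((\<lambda>p. H (fst p) (U (fst p) (snd p) 0 T)) has_derivative HD) (at (um, u0))"
  proof (rule has_derivative_transform_eventually[OF HD])
    show "\<forall>\<^sub>F p in at (um, u0). (\<lambda>(v, c). H v c) p = H (fst p) (U (fst p) (snd p) 0 T)"
      using ev unfolding eventually_at_filter by (rule eventually_mono) auto
    show "(\<lambda>(v, c). H v c) (um, u0) = H (fst (um, u0)) (U (fst (um, u0)) (snd (um, u0)) 0 T)"
      using eventually_nhds_x_imp_x[OF ev] by simp
  qed simp
  ultimately have HD_eq: "(\<lambda>p. HD (fst p, first_variation (fst p) (snd p) 0 T)) = HD"
    by (rule has_derivative_unique)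
  have eq: "HD (v, first_variation v c 0 T) = HD (v, c)" for v c
    using fun_cong[OF HD_eq, of "(v, c)"] by (simp only: fst_conv snd_conv)
  have h0: "h (first_variation v c 0 T - c) = 0" for v c
  proof -
    have "h (first_variation v c 0 T - c) = HD ((v, first_variation v c 0 T) - (v, c))"
        by (simp add: h_def)
    also have "\<dots> = 0" by (simp only: linear_diff[OF linHD] eq diff_self)
    finally show ?thesis .
  qed
  have "h ((X T - mat 1) *v c) = 0" for c
    using h0[of 0 c] by (simp add: first_variation_def matrix_vector_mult_diff_rdistrib)
  moreover have "h (K T *v b) = 0" for b
  proof -
    have "jacobian f (at um) *v (matrix_inv (jacobian f (at um)) *v b) = b"
      by (simp add: matrix_vector_mul_assoc invertible_matrix_inv[OF df])
    then have "h (- (K T *v b)) = 0"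
      using h0[of "matrix_inv (jacobian f (at um)) *v b" 0] by (simp add: first_variation_def)
    then show ?thesis using linear_neg[OF linh] by simp
  qed
  moreover have "h (axis i1 1) = 0"
  proof -
    have sol: "profile_solution f B um 0 UNIV ub"
      using profile by (simp add: nonconstant_periodic_profile_def)
    have "((\<lambda>x. H um (ub x)) has_derivative (\<lambda>t. h (t *\<^sub>R du 0))) (at 0)"
      using has_derivative_compose[of ub "\<lambda>t. t *\<^sub>R du 0" 0 UNIV "H um" h] ub_deriv[of 0] Hu
      by (simp add: has_vector_derivative_def base)
    moreover have "(\<lambda>x. H um (ub x)) = (\<lambda>x. H um (ub 0))"
      using H[OF _ _ sol] by (auto simp: is_interval_univ)
    then have "((\<lambda>x. H um (ub x)) has_derivative (\<lambda>t. 0)) (at 0)" by simp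
    ultimately have "(\<lambda>t. h (t *\<^sub>R du 0)) = (\<lambda>t. 0)" by (rule has_derivative_unique)
    from fun_cong[OF this, of 1] show ?thesis by (simp add: coords)
  qed
  ultimately show ?thesis using that[OF linh hnz] by blast
qed

text \<open>Where lemma \<open>solve_in_kernel\<close> below applies, \<open>K - X S\<close> is periodic: column \<open>j\<close> of \<open>S\<close> is the
  correction of the initial value that closes the response to the unit flux \<open>axis j 1\<close>.\<close>

definition S :: "real^'n^'n" where
  "S = matrix_inv \<Gamma> ** K T"

text \<open>The mass of the periodic responses \<open>K - X S\<close> to constant fluxes.\<close>

definition periodic_mass :: "real^'n^'n" where
  "periodic_mass = integral {0..T} (\<lambda>x. K x - X x ** S)"

text \<open>Since \<open>h\<close> kills every column of \<open>\<Gamma>\<close> but \<open>z T\<close>, and \<open>\<Gamma>\<close> is onto, \<open>h (z T) \<noteq> 0\<close>. So \<open>h b = 0\<close> forces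
  the coefficient of \<open>z T\<close> in the representation of \<open>b\<close> by the columns of \<open>\<Gamma>\<close> to vanish.\<close>

lemma solve_in_kernel:
  assumes \<Gamma>: "invertible \<Gamma>" and h: "linear h" "h \<noteq> (\<lambda>_. 0::real)"
    "\<And>c. h ((X T - mat 1) *v c) = 0" and b: "h b = 0"
  shows "(matrix_inv \<Gamma> *v b) $ i1 = 0" "(X T - mat 1) *v (matrix_inv \<Gamma> *v b) = b"
proof -
  have h\<Gamma>: "h (\<Gamma> *v y) = y $ i1 * h (z T)" for y
    by (simp add: \<Gamma>_mult linear_add[OF h(1)] linear_scale[OF h(1)] h(3))
  have inv: "\<Gamma> *v (matrix_inv \<Gamma> *v y) = y" for y
    by (simp add: matrix_vector_mul_assoc invertible_matrix_inv[OF \<Gamma>])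
  have "h (z T) \<noteq> 0"
  proof
    assume "h (z T) = 0"
    then have "h y = 0" for y using h\<Gamma>[of "matrix_inv \<Gamma> *v y"] by (simp add: inv)
    then show False using h(2) by blast
  qed
  then show z: "(matrix_inv \<Gamma> *v b) $ i1 = 0" using h\<Gamma>[of "matrix_inv \<Gamma> *v b"] by (simp add: inv b)
  show "(X T - mat 1) *v (matrix_inv \<Gamma> *v b) = b"
    using \<Gamma>_mult[of "matrix_inv \<Gamma> *v b"] by (simp add: inv z)
qed

text \<open>By implicit differentiation along the surface of periodic profiles, with \<open>u\<^sub>0\<^sup>1\<close> fixed: the candidate
  \<open>(u\<^sub>0, s)' = (S df(u\<^sub>-), 0)\<close> keeps the first component of \<open>u\<^sub>0\<close> and solves the linearized periodicity condition.\<close>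

lemma mass_derivative_eq:
  assumes family: "profile_family f B um u0 T U" and \<Gamma>: "invertible \<Gamma>"
    and surface: "periodic_surface i1 um u0 T U Q"
    and S1: "\<And>b. (S *v b) $ i1 = 0" and S: "\<And>b. (X T - mat 1) *v (S *v b) = K T *v b"
  shows "mass_derivative i1 um u0 T U Q = - (periodic_mass ** jacobian f (at um))"
proof -
  let ?J = "jacobian f (at um)"
  have T: "T \<in> {0..T}" using T_pos by simp
  define a where "a = u0 $ i1"
  define q where "q v = Q (v, a)" for v
  have cont: "isCont Q (um, a)"
    and comp: "\<forall>\<^sub>F (v, a) in nhds (um, a). fst (Q (v, a)) $ i1 = a"
    and param: "\<forall>\<^sub>F (v, c, s) in nhds (um, u0, 0). U v c s T = c \<longleftrightarrow> Q (v, c $ i1) = (c, s)"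
    using surface by (simp_all add: periodic_surface_def a_def)
  have UT: "U um u0 0 T = u0" using family_at_base[OF family T] by (simp add: ub_T)
  have q0: "q um = (u0, 0)"
    using eventually_nhds_x_imp_x[OF param] UT by (simp add: q_def a_def)
  have contq: "isCont q um"
    unfolding q_def by (rule isCont_o2[where f = "\<lambda>v. (v, a)" and a = um
        and g = Q, OF _ cont]) (intro continuous_intros)
  have lim: "((\<lambda>v. (v, a)) \<longlongrightarrow> (um, a)) (nhds um)"
    by (rule isCont_tendsto_nhds[where g = "\<lambda>v. (v, a)"]) (intro continuous_intros)
  have q1: "\<forall>\<^sub>F v in nhds um. fst (q v) $ i1 = a"
    using filterlim_iff[THEN iffD1, rule_format, OF lim, OF comp] by (simp add: q_def)
  have "isCont (\<lambda>v. (v, q v)) um" using contq by (intro continuous_intros)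
  from isCont_tendsto_nhds[OF this]
  have limq: "((\<lambda>v. (v, q v)) \<longlongrightarrow> (um, u0, 0)) (nhds um)" by (simp add: q0)
  have level: "\<forall>\<^sub>F v in nhds um. U v (fst (q v)) (snd (q v)) T = fst (q v)"
    using filterlim_iff[THEN iffD1, rule_format, OF limq, OF param] q1
    by eventually_elim (simp add: case_prod_unfold q_def)
  define G where "G p = U (fst p) (fst (snd p)) (snd (snd p)) T - fst (snd p)" for p
  define DG where "DG p = first_variation (fst p) (fst (snd p)) (snd (snd p)) T - fst (snd p)" for p
  have G: "(G has_derivative DG) (at (um, q um))"
    using family_has_derivative[OF family T] unfolding G_def DG_def q0 case_prod_unfold
    by (intro has_derivative_diff) (auto intro!: derivative_eq_intros)
  define V where "V = {p :: (real^'n) \<times> real. fst p $ i1 = 0}"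
  define L where "L v = (S *v (?J *v v), 0 :: real)" for v
  obtain m where m: "m > 0" "\<And>y. m * norm y \<le> norm (\<Gamma> *v y)" using invertible_bounded_below[OF \<Gamma>]
      by blast
  have q: "(q has_derivative L) (at um)"
  proof (rule implicit_has_derivative[OF G _ contq])
    show "\<forall>\<^sub>F v in nhds um. G (v, q v) = G (um, q um)"
      using level by eventually_elim (simp add: G_def q0 UT)
    show "subspace V" by (auto simp: V_def subspace_def)
    show "\<forall>\<^sub>F v in nhds um. q v - q um \<in> V"
      using q1 by eventually_elim (simp add: V_def q0 a_def)
    show "m / 3 > 0" using m by simp
    show "m / 3 * norm p \<le> norm (DG (0, p))" if "p \<in> V" for p
    proof -
      obtain c s where p: "p = (c, s)" by (cases p)
      have c: "c $ i1 = 0" using that by (simp add: V_def p)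
      \<comment> \<open>Since \<open>c\<close> has no component \<open>i1\<close>, the pair \<open>(c, s)\<close> is encoded in one vector, and the partial derivative becomes \<open>\<Gamma>\<close>.\<close>
      define y where "y = c - s *\<^sub>R axis i1 1"
      have y1: "y $ i1 = - s" by (simp add: y_def c)
      have "DG (0, p) = (X T - mat 1) *v c - s *\<^sub>R z T"
        by (simp add: DG_def p first_variation_def matrix_vector_mult_diff_rdistrib)
      also have "\<dots> = \<Gamma> *v y"
        unfolding \<Gamma>_mult y1
            by (simp add: y_def matrix_vector_mult_diff_distrib matrix_vector_mult_scaleR X_T_axis)
      finally have DG: "norm (DG (0, p)) \<ge> m * norm y" using m by simp
      have s: "\<bar>s\<bar> \<le> norm y" using component_le_norm_cart[of y i1] by (simp add: y1)
      have "c = y + s *\<^sub>R axis i1 1" by (simp add: y_def)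
      then have "norm c \<le> norm y + \<bar>s\<bar>" using norm_triangle_ineq[of y "s *\<^sub>R axis i1 1"] by simp
      then have "norm p \<le> 3 * norm y" using norm_Pair_le[of c s] s by (simp add: p)
      then have "m / 3 * norm p \<le> m / 3 * (3 * norm y)" using m by (intro mult_left_mono) auto
      then show ?thesis using DG by simp
    qed
    show "bounded_linear L"
      unfolding L_def by (intro bounded_linear_Pair bounded_linear_zero
        bounded_linear_compose[OF matrix_vector_mul_bounded_linear
            matrix_vector_mul_bounded_linear])
    show "L h \<in> V" for h by (simp add: L_def V_def S1)
    show "DG (h, L h) = 0" for h
      by (simp add: DG_def L_def first_variation_def S[symmetric] matrix_vector_mult_diff_rdistrib)
  qed
  have "((\<lambda>v. (v, q v)) has_derivative (\<lambda>v. (v, L v))) (at um)"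
    by (intro has_derivative_Pair has_derivative_ident q)
  from has_derivative_compose[OF this, of "\<lambda>(v, c, s). integral {0..T} (U v c s)"
      "\<lambda>(v, c, s). integral {0..T} (first_variation v c s)"]
  have D: "((\<lambda>v. mean_mass T U Q v a) has_derivative
      (\<lambda>v. integral {0..T} (first_variation v (S *v (?J *v v)) 0))) (at um)"
    using family_integral_has_derivative[OF family]
    by (simp add: q0[unfolded q_def] case_prod_unfold L_def q_def mean_mass_def[abs_def])
  have int: "(\<lambda>x. K x - X x ** S) integrable_on {0..T}"
    by (intro integrable_continuous_real continuous_intros continuous_on_matrix_matrix
        continuous_on_vector_derivative[OF X_deriv] continuous_on_vector_derivative[OF K_deriv])
  have "integral {0..T} (first_variation v (S *v (?J *v v)) 0) = - (periodic_mass ** ?J) *v v" for v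
  proof -
    have "integral {0..T} (\<lambda>x. (K x - X x ** S) *v (?J *v v)) = periodic_mass *v (?J *v v)"
      unfolding periodic_mass_def
      using integral_linear[OF int bounded_bilinear.bounded_linear_left[OF
          bounded_bilinear_matrix_vector_mult, of "?J *v v"]]
      by (simp add: o_def)
    moreover have "X x *v (S *v b) - K x *v b = - ((K x - X x ** S) *v b)" for x b
      by (simp add: matrix_vector_mult_diff_rdistrib flip: matrix_vector_mul_assoc)
    then have "first_variation v (S *v (?J *v v)) 0 = (\<lambda>x. - ((K x - X x ** S) *v (?J *v v)))"
      by (intro ext) (simp only: first_variation_def scaleR_zero_left diff_zero)
    ultimately have "integral {0..T} (first_variation v (S *v (?J *v v)) 0) =
        - (periodic_mass *v (?J *v v))"
      by (simp add: integral_neg)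
    then show ?thesis
      by (simp add: bounded_bilinear.minus_left[OF bounded_bilinear_matrix_vector_mult]
          matrix_vector_mul_assoc)
  qed
  with D have D': "((\<lambda>v. mean_mass T U Q v a) has_derivative (\<lambda>v. - (periodic_mass ** ?J) *v v))
      (at um)" by simp
  show ?thesis
    unfolding mass_derivative_def jacobian_def a_def[symmetric] frechet_derivative_at[OF D',
        symmetric]
    by simp
qed

end

section \<open>Block determinants and their perturbation\<close>

text \<open>Permutations of a disjoint union that preserve the two parts have as sign the product of the signs
  on the parts; it is enough to embed the transpositions of each part.\<close>

lemma swapidseq_map_sum_left: "swapidseq n p \<Longrightarrow> swapidseq n (map_sum p id)"
proof (induction rule: swapidseq.induct)
  case id
  then show ?case unfolding map_sum.id by (rule swapidseq.id)
next
  case (comp_Suc n p a b)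
  have "map_sum (Transposition.transpose a b \<circ> p) id =
      Transposition.transpose (Inl a) (Inl b) \<circ> map_sum p id"
    by (rule ext, rename_tac x, case_tac x) (auto simp: Transposition.transpose_def)
  moreover have "Inl a \<noteq> Inl b" using comp_Suc.hyps by simp
  ultimately show ?case using swapidseq.comp_Suc[OF comp_Suc.IH] by metis
qed

lemma swapidseq_map_sum_right: "swapidseq n p \<Longrightarrow> swapidseq n (map_sum id p)"
proof (induction rule: swapidseq.induct)
  case id
  then show ?case unfolding map_sum.id by (rule swapidseq.id)
next
  case (comp_Suc n p a b)
  have "map_sum id (Transposition.transpose a b \<circ> p) =
      Transposition.transpose (Inr a) (Inr b) \<circ> map_sum id p"
    by (rule ext, rename_tac x, case_tac x) (auto simp: Transposition.transpose_def)
  moreover have "Inr a \<noteq> Inr b" using comp_Suc.hyps by simp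
  ultimately show ?case using swapidseq.comp_Suc[OF comp_Suc.IH] by metis
qed

lemma sign_map_sum:
  assumes p: "permutation p" and q: "permutation q"
  shows "sign (map_sum p q) = sign p * sign q"
proof -
  obtain m where m: "swapidseq m p" using p by (auto simp: permutation_def)
  obtain n where n: "swapidseq n q" using q by (auto simp: permutation_def)
  have s: "swapidseq (m + n) (map_sum p q)"
    using swapidseq_comp_add[OF swapidseq_map_sum_left[OF m] swapidseq_map_sum_right[OF n]]
    by (simp add: map_sum.comp)
  have e: "evenperm (map_sum p q) = even (m + n)" "evenperm p = even m" "evenperm q = even n"
    using evenperm_unique[OF s refl] evenperm_unique[OF m refl] evenperm_unique[OF n refl]
        by simp_all
  show ?thesis by (simp add: sign_def e)
qed

lemma sum_UNIV_sum: "(\<Sum>i\<in>UNIV. g (i :: 'a::finite + 'b::finite)) =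
    (\<Sum>a\<in>UNIV. g (Inl a)) + (\<Sum>b\<in>UNIV. g (Inr b))"
  by (simp add: UNIV_Plus_UNIV[symmetric] sum.Plus o_def del: UNIV_Plus_UNIV)

lemma prod_UNIV_sum: "(\<Prod>i\<in>UNIV. g (i :: 'a::finite + 'b::finite)) =
    (\<Prod>a\<in>UNIV. g (Inl a)) * (\<Prod>b\<in>UNIV. g (Inr b))"
  by (simp add: UNIV_Plus_UNIV[symmetric] prod.Plus o_def del: UNIV_Plus_UNIV)

lemma permutes_map_sum:
  assumes "p permutes (UNIV :: 'a set)" "q permutes (UNIV :: 'b set)"
  shows "map_sum p q permutes UNIV"
proof -
  have "bij (map_sum p q)"
    by (rule o_bij[of "map_sum (inv p) (inv q)"])
       (simp_all add: map_sum.comp permutes_inv_o[OF assms(1)] permutes_inv_o[OF assms(2)]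
           map_sum.id)
  then show ?thesis by (intro bij_imp_permutes) auto
qed

lemma permutes_sum_split:
  fixes p :: "'a::finite + 'b::finite \<Rightarrow> 'a + 'b"
  assumes p: "p permutes UNIV" and left: "\<And>a. \<exists>a'. p (Inl a) = Inl a'"
  obtains p1 p2 where "p1 permutes UNIV" "p2 permutes UNIV" "p = map_sum p1 p2"
proof -
  have inj: "inj p" using p by (rule permutes_inj)
  have sub: "p ` range Inl \<subseteq> range Inl" using left by fastforce
  have "p ` range Inl = range Inl"
    by (rule card_subset_eq[OF _ sub]) (simp_all add: card_image inj_on_subset[OF inj])
  have right: "\<exists>b'. p (Inr b) = Inr b'" for b
  proof (cases "p (Inr b)")
    case (Inl a)
    then have "p (Inr b) \<in> p ` range Inl" using \<open>p ` range Inl = range Inl\<close> by auto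
    then obtain a' where "p (Inr b) = p (Inl a')" by auto
    then show ?thesis using inj by (auto dest: injD)
  qed auto
  obtain p1 where p1: "\<And>a. p (Inl a) = Inl (p1 a)" using left by metis
  obtain p2 where p2: "\<And>b. p (Inr b) = Inr (p2 b)" using right by metis
  have "inj p1" using inj p1 by (metis injD injI sum.inject(1))
  have "inj p2" using inj p2 by (metis injD injI sum.inject(2))
  have "p1 permutes UNIV" "p2 permutes UNIV"
    using \<open>inj p1\<close> \<open>inj p2\<close> by (auto intro!: bij_imp_permutes simp: bij_def finite_UNIV_inj_surj)
  moreover have "p = map_sum p1 p2"
    by (rule ext, rename_tac x, case_tac x) (auto simp: p1 p2)
  ultimately show ?thesis by (rule that)
qed

text \<open>In the Leibniz expansion only permutations that map the first block to itself contribute, and these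
  are the pairs of permutations of the two blocks.\<close>

lemma det_block_lower_triangular:
  fixes P R S :: "'a::comm_ring_1^'n^'n"
  shows "det (block_matrix P 0 R S) = det P * det S"
proof -
  let ?M = "block_matrix P 0 R S"
  let ?Pn = "{p. p permutes (UNIV :: 'n set)}"
  let ?Q = "{p. p permutes (UNIV :: ('n + 'n) set)}"
  let ?t = "\<lambda>p. of_int (sign p) * (\<Prod>i\<in>UNIV. ?M $ i $ p i)"
  let ?f = "\<lambda>(p, q). map_sum p q :: 'n + 'n \<Rightarrow> 'n + 'n"
  have "det ?M = sum ?t ?Q" by (simp add: det_def)
  also have "\<dots> = sum ?t (?f ` (?Pn \<times> ?Pn))"
  proof (rule sum.mono_neutral_right)
    show "finite ?Q" by (rule finite_permutations) simp
    show "?f ` (?Pn \<times> ?Pn) \<subseteq> ?Q" by (auto intro: permutes_map_sum)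
    show "\<forall>p\<in>?Q - ?f ` (?Pn \<times> ?Pn). ?t p = 0"
    proof
      fix p assume p: "p \<in> ?Q - ?f ` (?Pn \<times> ?Pn)"
      have "\<exists>a. \<nexists>a'. p (Inl a) = Inl a'"
      proof (rule ccontr)
        assume "\<not> ?thesis"
        then obtain p1 p2 where "p1 permutes UNIV" "p2 permutes UNIV" "p = map_sum p1 p2"
          using permutes_sum_split[of p] p by blast
        then show False using p by auto
      qed
      then obtain a where "\<nexists>a'. p (Inl a) = Inl a'" by blast
      then obtain b where b: "p (Inl a) = Inr b" by (cases "p (Inl a)") auto
      have "?M $ Inl a $ p (Inl a) = 0" by (simp add: b block_matrix_def)
      then have "(\<Prod>i\<in>UNIV. ?M $ i $ p i) = 0" by (intro prod_zero) auto
      then show "?t p = 0" by simp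
    qed
  qed
  also have "\<dots> = sum (?t \<circ> ?f) (?Pn \<times> ?Pn)"
  proof (rule sum.reindex)
    show "inj_on ?f (?Pn \<times> ?Pn)"
    proof (rule inj_onI)
      fix x y assume eq: "?f x = ?f y"
      have "fst x a = fst y a" for a using fun_cong[OF eq, of "Inl a"]
          by (simp add: case_prod_unfold)
      moreover have "snd x b = snd y b" for b using fun_cong[OF eq, of "Inr b"]
          by (simp add: case_prod_unfold)
      ultimately show "x = y" by (simp add: prod_eq_iff fun_eq_iff)
    qed
  qed
  also have "\<dots> = (\<Sum>(p, q)\<in>?Pn \<times> ?Pn.
      (of_int (sign p) * (\<Prod>i\<in>UNIV. P $ i $ p i)) * (of_int (sign q) * (\<Prod>i\<in>UNIV. S $ i $ q i)))"
  proof (rule sum.cong[OF refl])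
    fix x assume "x \<in> ?Pn \<times> ?Pn"
    then obtain p q where x: "x = (p, q)" and pq: "p permutes UNIV" "q permutes UNIV" by auto
    then have "sign (map_sum p q) = sign p * sign q"
      by (intro sign_map_sum) (auto simp: permutation_permutes intro: exI[of _ UNIV])
    then show "(?t \<circ> ?f) x = (case x of (p, q) \<Rightarrow>
      (of_int (sign p) * (\<Prod>i\<in>UNIV. P $ i $ p i)) * (of_int (sign q) * (\<Prod>i\<in>UNIV. S $ i $ q i)))"
      by (simp add: x prod_UNIV_sum block_matrix_def mult_ac)
  qed
  also have "\<dots> = det P * det S"
    by (simp add: det_def sum_product sum.cartesian_product)
  finally show ?thesis .
qed

lemma block_matrix_mult:
  "block_matrix P Q R S ** block_matrix P' Q' R' S' =
    block_matrix (P ** P' + Q ** R') (P ** Q' + Q ** S') (R ** P' + S ** R') (R ** Q' + S ** S')"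
  for P :: "'a::comm_ring_1^'n^'n"
  by (auto simp: vec_eq_iff block_matrix_def matrix_matrix_mult_def sum_UNIV_sum split: sum.split)

lemma mat_block: "mat a = block_matrix (mat a) 0 0 (mat (a :: 'a::comm_ring_1))"
  by (auto simp: vec_eq_iff block_matrix_def mat_def split: sum.split)

lemma det_block_unipotent_upper: "det (block_matrix (mat 1) Q 0 (mat 1)) = 1"
  for Q :: "'a::comm_ring_1^'n^'n"
proof -
  have "transpose (block_matrix (mat 1) Q 0 (mat 1)) = block_matrix (mat 1) 0 (transpose Q) (mat 1)"
    by (auto simp: vec_eq_iff block_matrix_def mat_def transpose_def split: sum.split)
  then show ?thesis
    using det_transpose[of "block_matrix (mat 1) Q 0 (mat 1)"]
    by (simp add: det_block_lower_triangular)
qed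

lemma mat_mult_commute: "mat a ** M = M ** mat (a :: 'a::comm_ring_1)"
  by (simp add: vec_eq_iff matrix_matrix_mult_def mat_def if_distrib[of "\<lambda>b. b * _"]
      if_distrib[of "\<lambda>b. _ * b"] mult.commute cong: if_cong)

lemma det_similarity:
  fixes P R M :: "'a::comm_ring_1^'m^'m"
  assumes PR: "P ** R = mat 1"
  shows "det (P ** M ** R - mat a) = det (M - mat a)"
proof -
  have "P ** M ** R - mat a = P ** (M - mat a) ** R"
  proof -
    have "P ** mat a ** R = mat a ** (P ** R)" by (simp add: mat_mult_commute matrix_mul_assoc)
    then have "P ** mat a ** R = mat a" by (simp add: PR)
    moreover have "P ** (M - mat a) ** R = P ** M ** R - P ** mat a ** R"
      by (simp add: vec_eq_iff matrix_matrix_mult_def algebra_simps sum_subtractf)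
    ultimately show ?thesis by simp
  qed
  moreover have "det P * det R = 1" using arg_cong[OF PR, of det] by (simp add: det_mul)
  then have "det P * d * det R = d" for d by (metis mult.commute mult.left_commute mult_1)
  ultimately show ?thesis by (simp add: det_mul)
qed

text \<open>The telescoping identity \<open>M P' - N P = (M - N) P + M (P' - P)\<close> drives the induction.\<close>

lemma prod_bigo_perturbation:
  fixes M N :: "'i \<Rightarrow> 'x \<Rightarrow> 'b::real_normed_field" and \<epsilon> :: "'x \<Rightarrow> 'b"
  assumes "finite I" and \<epsilon>: "\<epsilon> \<in> O[F](\<lambda>_. 1)"
    and N: "\<And>i. i \<in> I \<Longrightarrow> N i \<in> O[F](\<lambda>x. \<epsilon> x ^ e i)"
    and D: "\<And>i. i \<in> I \<Longrightarrow> (\<lambda>x. M i x - N i x) \<in> O[F](\<lambda>x. \<epsilon> x ^ Suc (e i))"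
  shows "(\<lambda>x. \<Prod>i\<in>I. N i x) \<in> O[F](\<lambda>x. \<epsilon> x ^ sum e I)"
    and "(\<lambda>x. (\<Prod>i\<in>I. M i x) - (\<Prod>i\<in>I. N i x)) \<in> O[F](\<lambda>x. \<epsilon> x ^ Suc (sum e I))"
proof -
  have "(\<lambda>x. \<Prod>i\<in>I. N i x) \<in> O[F](\<lambda>x. \<epsilon> x ^ sum e I) \<and>
    (\<lambda>x. (\<Prod>i\<in>I. M i x) - (\<Prod>i\<in>I. N i x)) \<in> O[F](\<lambda>x. \<epsilon> x ^ Suc (sum e I))"
    using assms(1) N D
  proof (induction I rule: finite_induct)
    case empty
    show ?case by simp
  next
    case (insert i I)
    let ?PM = "\<lambda>x. \<Prod>i\<in>I. M i x" and ?PN = "\<lambda>x. \<Prod>i\<in>I. N i x"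
    have IH: "?PN \<in> O[F](\<lambda>x. \<epsilon> x ^ sum e I)" "(\<lambda>x. ?PM x - ?PN x) \<in> O[F](\<lambda>x. \<epsilon> x ^ Suc (sum e I))"
      using insert by auto
    have Ni: "N i \<in> O[F](\<lambda>x. \<epsilon> x ^ e i)" and Di: "(\<lambda>x. M i x - N i x) \<in> O[F](\<lambda>x. \<epsilon> x ^ Suc (e i))"
      using insert.prems by auto
    have "(\<lambda>x. \<epsilon> x ^ Suc (e i)) \<in> O[F](\<lambda>x. \<epsilon> x ^ e i)"
      using landau_o.big.mult[OF \<epsilon> landau_o.big_refl[of "\<lambda>x. \<epsilon> x ^ e i"]] by simp
    from landau_o.big_trans[OF Di this] have "(\<lambda>x. N i x + (M i x - N i x)) \<in> O[F](\<lambda>x. \<epsilon> x ^ e i)"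
      by (rule sum_in_bigo(1)[OF Ni])
    then have Mi: "M i \<in> O[F](\<lambda>x. \<epsilon> x ^ e i)" by simp
    have "(\<lambda>x. N i x * ?PN x) \<in> O[F](\<lambda>x. \<epsilon> x ^ e i * \<epsilon> x ^ sum e I)"
      by (rule landau_o.big.mult[OF Ni IH(1)])
    moreover have "(\<lambda>x. (M i x - N i x) * ?PN x + M i x * (?PM x - ?PN x)) \<in>
        O[F](\<lambda>x. \<epsilon> x ^ Suc (e i + sum e I))"
      using landau_o.big.mult[OF Di IH(1)] landau_o.big.mult[OF Mi IH(2)]
      by (intro sum_in_bigo) (simp_all add: power_add mult_ac)
    moreover have "(\<lambda>x. (M i x - N i x) * ?PN x + M i x * (?PM x - ?PN x)) =
        (\<lambda>x. M i x * ?PM x - N i x * ?PN x)"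
      by (simp add: algebra_simps)
    ultimately show ?case using insert.hyps by (simp add: power_add)
  qed
  then show "(\<lambda>x. \<Prod>i\<in>I. N i x) \<in> O[F](\<lambda>x. \<epsilon> x ^ sum e I)"
    "(\<lambda>x. (\<Prod>i\<in>I. M i x) - (\<Prod>i\<in>I. N i x)) \<in> O[F](\<lambda>x. \<epsilon> x ^ Suc (sum e I))" by auto
qed

text \<open>The weights \<open>r i + c j\<close> let rows and columns be small of different orders. Every term of the Leibniz
  expansion uses each row and each column once, so all terms have the same total weight, and a
  perturbation by one additional order in each entry costs one order in the determinant.\<close>

lemma det_bigo_perturbation:
  fixes M N :: "'x \<Rightarrow> 'b::real_normed_field^'m^'m" and \<epsilon> :: "'x \<Rightarrow> 'b"
  assumes \<epsilon>: "\<epsilon> \<in> O[F](\<lambda>_. 1)"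
    and N: "\<And>i j. (\<lambda>x. N x $ i $ j) \<in> O[F](\<lambda>x. \<epsilon> x ^ (r i + c j))"
    and D: "\<And>i j. (\<lambda>x. M x $ i $ j - N x $ i $ j) \<in> O[F](\<lambda>x. \<epsilon> x ^ Suc (r i + c j))"
  shows "(\<lambda>x. det (M x) - det (N x)) \<in> O[F](\<lambda>x. \<epsilon> x ^ Suc (sum r UNIV + sum c UNIV))"
proof -
  have "(\<lambda>x. of_int (sign p) * ((\<Prod>i\<in>UNIV. M x $ i $ p i) - (\<Prod>i\<in>UNIV. N x $ i $ p i)))
      \<in> O[F](\<lambda>x. \<epsilon> x ^ Suc (sum r UNIV + sum c UNIV))" if p: "p permutes UNIV" for p
  proof -
    have "(\<lambda>x. (\<Prod>i\<in>UNIV. M x $ i $ p i) - (\<Prod>i\<in>UNIV. N x $ i $ p i))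
        \<in> O[F](\<lambda>x. \<epsilon> x ^ Suc (\<Sum>i\<in>UNIV. r i + c (p i)))"
      by (rule prod_bigo_perturbation(2)[OF _ \<epsilon> N D]) simp
    moreover have "(\<Sum>i\<in>UNIV. c (p i)) = sum c UNIV"
      using sum.permute[OF p, of c] by (simp add: o_def)
    ultimately show ?thesis by (simp add: sum.distrib)
  qed
  then have "(\<lambda>x. \<Sum>p | p permutes UNIV. of_int (sign p) * ((\<Prod>i\<in>UNIV. M x $ i $ p i) -
      (\<Prod>i\<in>UNIV. N x $ i $ p i)))
      \<in> O[F](\<lambda>x. \<epsilon> x ^ Suc (sum r UNIV + sum c UNIV))"
    by (intro big_sum_in_bigo) auto
  then show ?thesis by (simp add: det_def sum_subtractf[symmetric] right_diff_distrib)
qed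

section \<open>The monodromy matrix at low frequency\<close>

definition vjoin :: "'a^'n \<Rightarrow> 'a^'n \<Rightarrow> 'a^('n + 'n)" where
  "vjoin a b = (\<chi> i. case i of Inl k \<Rightarrow> a $ k | Inr k \<Rightarrow> b $ k)"

definition vtop :: "'a^('n + 'n) \<Rightarrow> 'a^'n" where
  "vtop y = (\<chi> k. y $ Inl k)"

definition vbot :: "'a^('n + 'n) \<Rightarrow> 'a^'n" where
  "vbot y = (\<chi> k. y $ Inr k)"

lemma vjoin_simps [simp]: "vtop (vjoin a b) = a" "vbot (vjoin a b) = b" "vjoin (vtop y) (vbot y) =
    y"
  by (auto simp: vjoin_def vtop_def vbot_def vec_eq_iff split: sum.split)

lemma block_matrix_vjoin:
  "block_matrix P Q R S *v vjoin a b = vjoin (P *v a + Q *v b) (R *v a + S *v b)"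
  by (auto simp: vec_eq_iff vjoin_def block_matrix_def matrix_vector_mult_def sum_UNIV_sum split:
      sum.split)

lemma bounded_linear_vtop: "bounded_linear (vtop :: complex^('n::finite + 'n) \<Rightarrow> _)"
  and bounded_linear_vbot: "bounded_linear (vbot :: complex^('n::finite + 'n) \<Rightarrow> _)"
  unfolding linear_conv_bounded_linear[symmetric]
  by (auto intro!: linearI simp: vtop_def vbot_def vec_eq_iff)

lemma norm_cmat [simp]: "norm (cmat M) = norm M"
  by (simp add: norm_vec_def)

lemma norm_cvec [simp]: "norm (cvec v) = norm v"
  by (simp add: norm_vec_def)

lemma norm_scalar_mult [simp]: "norm (c *s v) = norm c * norm (v :: complex^'n)"
  by (simp add: norm_vec_def norm_mult L2_set_right_distrib)

lemma bounded_linear_scalar_mult: "bounded_linear (\<lambda>v :: complex^'n::finite. c *s v)"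
  unfolding linear_conv_bounded_linear[symmetric]
  by (auto intro!: linearI simp: vec_eq_iff algebra_simps)

lemmas has_vector_derivative_cmat = bounded_linear.has_vector_derivative[OF bounded_linear_cmat]
lemmas has_vector_derivative_cvec = bounded_linear.has_vector_derivative[OF bounded_linear_cvec]

lemma cvec_add: "cvec (a + b) = cvec a + cvec b"
  by (rule linear_add[OF bounded_linear.linear[OF bounded_linear_cvec]])

lemma cmat_diff: "cmat (a - b) = cmat a - cmat b"
  by (rule linear_diff[OF bounded_linear.linear[OF bounded_linear_cmat]])

context periodic_profile
begin

text \<open>The change of unknowns from \<open>(w, w')\<close> to \<open>(w, B w' - A w)\<close>, and its inverse.\<close>

definition to_flux :: "real \<Rightarrow> complex^('n + 'n)^('n + 'n)" where
  "to_flux x = block_matrix (mat 1) 0 (- cmat (A x)) (cmat (Bx x))"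

definition from_flux :: "real \<Rightarrow> complex^('n + 'n)^('n + 'n)" where
  "from_flux x = block_matrix (mat 1) 0 (cmat (C x)) (cmat (E x))"

lemma to_from_flux: "to_flux x ** from_flux x = mat 1"
proof -
  have "cmat (Bx x) ** cmat (E x) = mat 1"
    unfolding cmat_mult[symmetric] B_E cmat_mat by simp
  moreover have "cmat (Bx x) ** cmat (C x) = cmat (A x)"
    unfolding cmat_mult[symmetric] C_def matrix_mul_assoc B_E by simp
  ultimately show ?thesis
    unfolding to_flux_def from_flux_def block_matrix_mult by (simp add: mat_block[of 1])
qed

definition monodromy :: "(real \<Rightarrow> complex \<Rightarrow> complex^('n + 'n)^('n + 'n)) \<Rightarrow> complex \<Rightarrow> complex^('n +
    'n)^('n + 'n)" where
  "monodromy \<Psi> lam = to_flux T ** \<Psi> T lam ** from_flux 0"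

text \<open>The change of unknowns is the same at both ends of the period.\<close>

lemma evans_D_monodromy:
  "evans_D \<Psi> T k lam = det (monodromy \<Psi> lam - mat (exp (\<i> * complex_of_real (k * T))))"
proof -
  have "to_flux T = to_flux 0" by (simp add: to_flux_def A_T B_T)
  then show ?thesis
    unfolding evans_D_def monodromy_def by (simp add: det_similarity[OF to_from_flux])
qed

text \<open>The eigenvalue equation as a system for \<open>w\<close> and the flux \<open>F\<close>, with a source \<open>g\<close> that absorbs the
  residual of approximate solutions.\<close>

definition flux_solution ::
  "complex \<Rightarrow> (real \<Rightarrow> complex^'n) \<Rightarrow> (real \<Rightarrow> complex^'n) \<Rightarrow> (real \<Rightarrow> complex^'n) \<Rightarrow> bool" where
  "flux_solution lam g w F \<longleftrightarrow> (\<forall>x\<in>{0..T}.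
     (w has_vector_derivative cmat (C x) *v w x + cmat (E x) *v F x) (at x within {0..T}) \<and>
     (F has_vector_derivative lam *s w x + g x) (at x within {0..T}))"

text \<open>The term \<open>A' w\<close> in the coefficient matrix is the part of the derivative of \<open>A w\<close> that does not involve \<open>w'\<close>;
  together with \<open>B' w'\<close> it completes the derivative of the flux, so that only \<open>lam w\<close> remains.\<close>

lemma evans_flux_solution:
  assumes fundamental: "evans_fundamental_solution f B ub \<Psi>"
  obtains w F where "flux_solution lam (\<lambda>_. 0) w F" "w 0 = a" "F 0 = b"
    and "w T = vtop (monodromy \<Psi> lam *v vjoin a b)" "F T = vbot (monodromy \<Psi> lam *v vjoin a b)"
proof -
  define \<eta> where "\<eta> = from_flux 0 *v vjoin a b"
  define y where "y x = \<Psi> x lam *v \<eta>" for x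
  define w where "w x = vtop (y x)" for x
  define p where "p x = vbot (y x)" for x
  define F where "F x = cmat (Bx x) *v p x - cmat (A x) *v w x" for x
  define A' where "A' x = vector_derivative A (at x)" for x
  define B' where "B' x = vector_derivative Bx (at x)" for x
  have yx: "y x = vjoin (w x) (p x)" for x by (simp add: w_def p_def)
  have \<Psi>0: "\<Psi> 0 lam = mat 1"
    and \<Psi>d: "((\<lambda>y. \<Psi> y lam) has_vector_derivative evans_matrix f B ub lam x ** \<Psi> x lam) (at x)"
        for x
    using fundamental unfolding evans_fundamental_solution_def by auto
  have y0: "y 0 = vjoin a (cmat (C 0) *v a + cmat (E 0) *v b)"
    by (simp add: y_def \<Psi>0 \<eta>_def from_flux_def block_matrix_vjoin)
  have w0: "w 0 = a" and p0: "p 0 = cmat (C 0) *v a + cmat (E 0) *v b"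
    by (simp_all add: w_def p_def y0)
  have flux: "to_flux x *v y x = vjoin (w x) (F x)" for x
    unfolding yx to_flux_def block_matrix_vjoin F_def
    by (simp add: bounded_bilinear.minus_left[OF bounded_bilinear_matrix_vector_mult])
  have unflux: "p x = cmat (C x) *v w x + cmat (E x) *v F x" for x
  proof -
    have "cmat (E x) *v (cmat (Bx x) *v p x) = p x"
      by (simp add: matrix_vector_mul_assoc cmat_mult[symmetric] E_B cmat_mat)
    moreover have "cmat (E x) *v (cmat (A x) *v w x) = cmat (C x) *v w x"
      by (simp add: matrix_vector_mul_assoc cmat_mult[symmetric] C_def)
    ultimately show ?thesis by (simp add: F_def matrix_vector_mult_diff_distrib)
  qed
  have F0: "F 0 = b"
  proof -
    have "to_flux 0 *v y 0 = (to_flux 0 ** from_flux 0) *v vjoin a b"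
      by (simp add: y_def \<Psi>0 \<eta>_def matrix_vector_mul_assoc)
    then have "vjoin (w 0) (F 0) = vjoin a b" by (simp add: flux to_from_flux)
    then show ?thesis by (metis vjoin_simps(2))
  qed
  define q where "q x = cmat (E x) *v ((mat lam + cmat (A' x)) *v w x) +
      cmat (E x) *v (cmat (A x - B' x) *v p x)" for x
  have yd: "(y has_vector_derivative vjoin (p x) (q x)) (at x)" for x
  proof -
    have "(y has_vector_derivative evans_matrix f B ub lam x *v y x) (at x)"
      using has_vector_derivative_matrix_vector[OF \<Psi>d has_vector_derivative_const[of \<eta>], of x]
      unfolding y_def by (simp add: matrix_vector_mul_assoc)
    moreover have "evans_matrix f B ub lam x *v y x = vjoin (p x) (q x)"
      unfolding yx evans_matrix_def block_matrix_vjoin q_def A'_def B'_def E_def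
      by (simp add: matrix_vector_mul_assoc)
    ultimately show ?thesis by simp
  qed
  have wd: "(w has_vector_derivative p x) (at x)" and pd: "(p has_vector_derivative q x) (at x)"
      for x
    using bounded_linear.has_vector_derivative[OF bounded_linear_vtop yd[of x]]
      bounded_linear.has_vector_derivative[OF bounded_linear_vbot yd[of x]]
    by (simp_all add: w_def[abs_def] p_def[abs_def])
  have Ad: "(A has_vector_derivative A' x) (at x)" and Bd: "(Bx has_vector_derivative B' x) (at x)"
      for x
    unfolding A'_def B'_def using A_differentiable B_differentiable vector_derivative_works
        by blast+
  have Fd: "(F has_vector_derivative lam *s w x) (at x)" for x
  proof -
    have "(F has_vector_derivative (cmat (Bx x) *v q x + cmat (B' x) *v p x)
         - (cmat (A x) *v p x + cmat (A' x) *v w x)) (at x)"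
      unfolding F_def
      by (intro has_vector_derivative_diff has_vector_derivative_matrix_vector
          has_vector_derivative_cmat wd pd Ad Bd)
    moreover have "cmat (Bx x) *v (cmat (E x) *v v) = v" for v
      by (simp add: matrix_vector_mul_assoc cmat_mult[symmetric] B_E cmat_mat)
    then have "cmat (Bx x) *v q x = (mat lam + cmat (A' x)) *v w x + cmat (A x - B' x) *v p x"
      by (simp add: q_def matrix_vector_right_distrib)
    moreover have "mat lam *v w x = lam *s w x"
      by (simp add: vec_eq_iff matrix_vector_mult_def mat_def if_distrib[of "\<lambda>b. b * _"] cong:
          if_cong)
    ultimately show ?thesis
      by (simp add: cmat_diff matrix_vector_mult_add_rdistrib matrix_vector_mult_diff_rdistrib)
  qed
  have sol: "flux_solution lam (\<lambda>_. 0) w F"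
    unfolding flux_solution_def unflux[symmetric] add_0_right
    by (intro ballI conjI has_vector_derivative_at_within[OF wd] has_vector_derivative_at_within[OF
        Fd])
  have "monodromy \<Psi> lam *v vjoin a b = vjoin (w T) (F T)"
    using flux[of T] unfolding monodromy_def y_def \<eta>_def
        by (simp only: matrix_vector_mul_assoc matrix_mul_assoc)
  then have "vtop (monodromy \<Psi> lam *v vjoin a b) = w T" "vbot (monodromy \<Psi> lam *v vjoin a b) = F T"
    by simp_all
  then show ?thesis using that[OF sol w0 F0] by simp
qed

text \<open>The constant does not depend on \<open>lam\<close> in the unit disc; so an approximate solution with residual of
  size \<open>h\<close> differs from the exact one by \<open>O(h)\<close>, uniformly.\<close>

lemma flux_gronwall:
  obtains c where "c > 0"
    and "\<And>lam w F g h x. \<lbrakk>norm lam \<le> 1; 0 \<le> h; flux_solution lam g w F; w 0 = 0; F 0 = 0;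
      \<And>x. x \<in> {0..T} \<Longrightarrow> norm (g x) \<le> h; x \<in> {0..T}\<rbrakk> \<Longrightarrow> norm (w x) \<le> c * h \<and> norm (F x) \<le> c * h"
proof -
  obtain b where b: "b > 0" "\<And>x. x \<in> {0..T} \<Longrightarrow> norm (E x) \<le> b" "\<And>x. x \<in> {0..T} \<Longrightarrow> norm (C x) \<le> b"
    using coefficient_bounds by metis
  define L where "L = 2 * b + 1"
  show ?thesis
  proof (rule that[of "gronwall_const L T"])
    show "gronwall_const L T > 0" using T_pos by (intro gronwall_const_pos) auto
    fix lam :: complex and w F g :: "real \<Rightarrow> complex^'n" and h x :: real
    assume lam: "norm lam \<le> 1" and h: "0 \<le> h" and w0: "w 0 = 0" and F0: "F 0 = 0"
      and sol: "flux_solution lam g w F"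
      and g: "\<And>x. x \<in> {0..T} \<Longrightarrow> norm (g x) \<le> h" and x: "x \<in> {0..T}"
    have w: "(w has_vector_derivative cmat (C x) *v w x + cmat (E x) *v F x) (at x within {0..T})"
      and F: "(F has_vector_derivative lam *s w x + g x) (at x within {0..T})" if "x \<in> {0..T}" for x
      using sol that unfolding flux_solution_def by auto
    have "norm (w x, F x) \<le> gronwall_const L T * (norm (w 0, F 0) + h)"
    proof (rule gronwall[of T "\<lambda>x. (w x, F x)" _ L h x])
      fix x assume x: "x \<in> {0..T}"
      show "((\<lambda>x. (w x, F x)) has_vector_derivative
          (cmat (C x) *v w x + cmat (E x) *v F x, lam *s w x + g x)) (at x within {0..T})"
        by (rule has_vector_derivative_Pair[OF w[OF x] F[OF x]])
      have nw: "norm (w x) \<le> norm (w x, F x)" and nF: "norm (F x) \<le> norm (w x, F x)"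
        using norm_fst_le norm_snd_le by blast+
      have "norm (cmat (C x) *v w x + cmat (E x) *v F x) \<le>
          norm (C x) * norm (w x) + norm (E x) * norm (F x)"
        using norm_matrix_vector_mult_le[of "cmat (C x)" "w x"] norm_matrix_vector_mult_le[of
            "cmat (E x)" "F x"]
        by (intro order_trans[OF norm_triangle_ineq] add_mono) simp_all
      also have "\<dots> \<le> b * norm (w x, F x) + b * norm (w x, F x)"
        using b(2,3)[OF x] nw nF b(1) by (intro add_mono mult_mono) auto
      finally have 1: "norm (cmat (C x) *v w x + cmat (E x) *v F x) \<le> 2 * b * norm (w x, F x)"
          by simp
      have "norm (lam *s w x + g x) \<le> norm lam * norm (w x) + norm (g x)"
        using norm_triangle_ineq[of "lam *s w x" "g x"] by simp
      also have "\<dots> \<le> 1 * norm (w x, F x) + h"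
        using lam nw g[OF x] by (intro add_mono mult_mono) auto
      finally have 2: "norm (lam *s w x + g x) \<le> norm (w x, F x) + h" by simp
      show "norm (cmat (C x) *v w x + cmat (E x) *v F x, lam *s w x + g x) \<le>
          L * norm (w x, F x) + h"
        using norm_Pair_le[of "cmat (C x) *v w x + cmat (E x) *v F x" "lam *s w x + g x"] 1 2
        by (simp add: L_def algebra_simps)
    qed (use b h x in \<open>auto simp: L_def\<close>)
    then show "norm (w x) \<le> gronwall_const L T * h \<and> norm (F x) \<le> gronwall_const L T * h"
      using norm_fst_le[of "w x" "F x"] norm_snd_le[of "F x" "w x"] by (simp add: w0 F0)
  qed
qed

lemma flux_solution_continuous:
  assumes "flux_solution lam (\<lambda>_. 0) w F"
  shows "continuous_on {0..T} w" "continuous_on {0..T} F"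
  using assms unfolding flux_solution_def by (auto intro!: continuous_on_vector_derivative)

lemma flux_increment:
  assumes "flux_solution lam (\<lambda>_. 0) w F"
  shows "F T = F 0 + lam *s integral {0..T} w"
proof -
  have "((\<lambda>x. lam *s w x) has_integral (F T - F 0)) {0..T}"
    using assms T_pos unfolding flux_solution_def by (intro fundamental_theorem_of_calculus) auto
  moreover have "((\<lambda>x. lam *s w x) has_integral (lam *s integral {0..T} w)) {0..T}"
    using has_integral_linear[OF integrable_integral[OF integrable_continuous_real[OF
        flux_solution_continuous(1)[OF assms]]]
      bounded_linear_scalar_mult[of lam]] by (simp add: o_def)
  ultimately show ?thesis by (metis add.commute diff_add_cancel has_integral_unique)
qed

lemma continuous_X: "continuous_on {0..T} X" and continuous_K: "continuous_on {0..T} K"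
  by (rule continuous_on_vector_derivative[OF X_deriv] continuous_on_vector_derivative[OF K_deriv];
      assumption)+

text \<open>The solution at \<open>lam = 0\<close> has residual \<open>lam v\<close>, hence error \<open>O(lam)\<close>. The flux is one order better
  because its increment is \<open>lam\<close> times the integral of the solution.\<close>

lemma monodromy_first_order:
  assumes fundamental: "evans_fundamental_solution f B ub \<Psi>"
  obtains c where "c > 0"
    and "\<And>lam. norm lam \<le> 1 \<Longrightarrow>
      norm (vtop (monodromy \<Psi> lam *v vjoin (cvec a) (cvec b)) - cvec (X T *v a + K T *v b)) \<le> c *
          norm lam"
    and "\<And>lam. norm lam \<le> 1 \<Longrightarrow>
      norm (vbot (monodromy \<Psi> lam *v vjoin (cvec a) (cvec b)) - cvec b
        - lam *s cvec (integral {0..T} (\<lambda>x. X x *v a + K x *v b))) \<le> c * (norm lam)\<^sup>2"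
proof -
  define v where "v x = X x *v a + K x *v b" for x
  have v0: "v 0 = a" by (simp add: v_def X_0 K_0)
  have vd: "(v has_vector_derivative C x *v v x + E x *v b) (at x within {0..T})" if "x \<in> {0..T}"
      for x
    unfolding v_def
        using has_vector_derivative_add[OF X_vector_deriv[OF that] K_vector_deriv[OF that], of a b]
    by (simp add: matrix_vector_right_distrib add.assoc)
  have vc: "continuous_on {0..T} v" by (rule continuous_on_vector_derivative[OF vd])
  obtain m where m: "\<And>x. x \<in> {0..T} \<Longrightarrow> norm (v x) \<le> m"
    using continuous_on_interval_bounded[OF vc] by metis
  have m0: "0 \<le> m" using m[of 0] T_pos by (smt (verit) atLeastAtMost_iff norm_ge_zero)
  obtain c0 where c0: "c0 > 0"
    and gr: "\<And>lam w F g h x. \<lbrakk>norm lam \<le> 1; 0 \<le> h; flux_solution lam g w F; w 0 = 0; F 0 = 0;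
      \<And>x. x \<in> {0..T} \<Longrightarrow> norm (g x) \<le> h; x \<in> {0..T}\<rbrakk> \<Longrightarrow> norm (w x) \<le> c0 * h \<and> norm (F x) \<le> c0 * h"
    using flux_gronwall by blast
  define c where "c = c0 * m + T * (c0 * m) + 1"
  have nonneg: "0 \<le> c0 * m" "0 \<le> T * (c0 * m)" using c0 m0 T_pos by auto
  have c: "c > 0" "c0 * m \<le> c" "T * (c0 * m) \<le> c"
    unfolding c_def using nonneg by linarith+
  have "norm (vtop (monodromy \<Psi> lam *v vjoin (cvec a) (cvec b)) - cvec (v T)) \<le> c * norm lam \<and>
    norm (vbot (monodromy \<Psi> lam *v vjoin (cvec a) (cvec b)) - cvec b - lam *s cvec (integral {0..T}
        v)) \<le> c * (norm lam)\<^sup>2"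
    if lam: "norm lam \<le> 1" for lam
  proof -
    obtain w F where sol: "flux_solution lam (\<lambda>_. 0) w F" and w0: "w 0 = cvec a"
        and F0: "F 0 = cvec b"
      and wT: "w T = vtop (monodromy \<Psi> lam *v vjoin (cvec a) (cvec b))"
      and FT: "F T = vbot (monodromy \<Psi> lam *v vjoin (cvec a) (cvec b))"
      using evans_flux_solution[OF fundamental] by blast
    define w1 where "w1 x = w x - cvec (v x)" for x
    define F1 where "F1 x = F x - cvec b" for x
    have d: "norm (w1 x) \<le> c0 * (norm lam * m)" if x: "x \<in> {0..T}" for x
    proof -
      have "norm (w1 x) \<le> c0 * (norm lam * m) \<and> norm (F1 x) \<le> c0 * (norm lam * m)"
      proof (rule gr[of lam "norm lam * m" "\<lambda>x. lam *s cvec (v x)" w1 F1 x])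
        show "flux_solution lam (\<lambda>x. lam *s cvec (v x)) w1 F1"
          unfolding flux_solution_def
        proof (intro ballI conjI)
          fix x assume x: "x \<in> {0..T}"
          have "(w1 has_vector_derivative cmat (C x) *v w x + cmat (E x) *v F x - cvec (C x *v v x +
              E x *v b))
              (at x within {0..T})"
            unfolding w1_def using sol x
            by (intro has_vector_derivative_diff has_vector_derivative_cvec vd) (auto simp:
                flux_solution_def)
          moreover have "cmat (C x) *v w x + cmat (E x) *v F x - cvec (C x *v v x + E x *v b) =
              cmat (C x) *v w1 x + cmat (E x) *v F1 x"
            unfolding w1_def F1_def cvec_add matrix_vector_mult_diff_distrib cmat_mult_cvec by simp
          ultimately show "(w1 has_vector_derivative cmat (C x) *v w1 x + cmat (E x) *v F1 x)
              (at x within {0..T})" by simp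
          have "(F1 has_vector_derivative lam *s w x - 0) (at x within {0..T})"
            unfolding F1_def using sol x
            by (intro has_vector_derivative_diff has_vector_derivative_const) (auto simp:
                flux_solution_def)
          moreover have "lam *s w x - 0 = lam *s w1 x + lam *s cvec (v x)"
            by (simp add: w1_def vec_eq_iff algebra_simps)
          ultimately show "(F1 has_vector_derivative lam *s w1 x + lam *s cvec (v x))
              (at x within {0..T})" by simp
        qed
        show "norm (lam *s cvec (v x)) \<le> norm lam * m" if "x \<in> {0..T}" for x
          using m[OF that] by (simp add: mult_left_mono)
      qed (use lam m0 x in \<open>simp_all add: w1_def F1_def w0 F0 v0\<close>)
      then show ?thesis by blast
    qed
    have T: "T \<in> {0..T}" using T_pos by simp
    have "norm (w1 T) \<le> c * norm lam"
      using d[OF T] mult_right_mono[OF c(2), of "norm lam"] by (simp add: mult_ac)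
    moreover have "norm (F T - cvec b - lam *s cvec (integral {0..T} v)) \<le> c * (norm lam)\<^sup>2"
    proof -
      have iw: "w integrable_on {0..T}"
          by (rule integrable_continuous_real[OF flux_solution_continuous(1)[OF sol]])
      have iv: "(\<lambda>x. cvec (v x)) integrable_on {0..T}"
        by (intro integrable_continuous_real bounded_linear.continuous_on[OF bounded_linear_cvec]
            vc)
      have "cvec (integral {0..T} v) = integral {0..T} (\<lambda>x. cvec (v x))"
        using integral_linear[OF integrable_continuous_real[OF vc] bounded_linear_cvec]
            by (simp add: o_def)
      then have "F T - cvec b - lam *s cvec (integral {0..T} v) = lam *s integral {0..T} w1"
        unfolding flux_increment[OF sol] F0 w1_def integral_diff[OF iw iv]
        by (simp add: vec_eq_iff algebra_simps)
      moreover have "norm (integral {0..T} w1) \<le> integral {0..T} (\<lambda>x. c0 * (norm lam * m))"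
      proof (rule integral_norm_bound_integral)
        show "w1 integrable_on {0..T}" unfolding w1_def by (rule integrable_diff[OF iw iv])
      qed (use d in auto)
      then have "norm (integral {0..T} w1) \<le> T * (c0 * m) * norm lam" using T_pos
          by (simp add: mult_ac)
      then have "norm (integral {0..T} w1) \<le> c * norm lam"
        using mult_right_mono[OF c(3) norm_ge_zero[of lam]] by (rule order_trans)
      then have "norm lam * norm (integral {0..T} w1) \<le> norm lam * (c * norm lam)"
          by (rule mult_left_mono) simp
      ultimately show ?thesis by (simp add: power2_eq_square mult_ac)
    qed
    ultimately show ?thesis by (simp add: w1_def wT FT)
  qed
  then show ?thesis using that[OF c(1)] unfolding v_def by blast
qed

text \<open>The approximation \<open>w = ub' + lam (z - K (u\<^sub>0 - u\<^sub>-))\<close>, \<open>F = lam (ub - u\<^sub>0)\<close> has residual \<open>O(lam\<^sup>2)\<close>. Its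
  flux vanishes at both ends, as the profile is periodic.\<close>

lemma monodromy_translation_mode:
  assumes fundamental: "evans_fundamental_solution f B ub \<Psi>"
  obtains c where "c > 0"
    and "\<And>lam. norm lam \<le> 1 \<Longrightarrow>
      norm (vtop (monodromy \<Psi> lam *v vjoin (cvec (axis i1 1)) 0) - cvec (axis i1 1)
        - lam *s cvec (z T - K T *v (u0 - um))) \<le> c * (norm lam)\<^sup>2"
    and "\<And>lam. norm lam \<le> 1 \<Longrightarrow>
      norm (vbot (monodromy \<Psi> lam *v vjoin (cvec (axis i1 1)) 0)) \<le> c * (norm lam)\<^sup>2"
proof -
  define y where "y x = z x - K x *v (u0 - um)" for x
  define G where "G x = ub x - u0" for x
  have y0: "y 0 = 0" by (simp add: y_def z_0 K_0)
  have G0: "G 0 = 0" "G T = 0" by (simp_all add: G_def base ub_T)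
  have yd: "(y has_vector_derivative C x *v y x + E x *v G x) (at x within {0..T})" if "x \<in> {0..T}"
      for x
  proof -
    have "(y has_vector_derivative (C x *v z x + E x *v (ub x - um)) -
        (C x *v (K x *v (u0 - um)) + E x *v (u0 - um))) (at x within {0..T})"
      unfolding y_def by (intro has_vector_derivative_diff z_deriv[OF that] K_vector_deriv[OF that])
    then show ?thesis by (simp add: y_def G_def matrix_vector_mult_diff_distrib algebra_simps)
  qed
  have yc: "continuous_on {0..T} y" by (rule continuous_on_vector_derivative[OF yd])
  obtain m where m: "\<And>x. x \<in> {0..T} \<Longrightarrow> norm (y x) \<le> m"
    using continuous_on_interval_bounded[OF yc] by metis
  have m0: "0 \<le> m" using m[of 0] T_pos by (smt (verit) atLeastAtMost_iff norm_ge_zero)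
  obtain c0 where c0: "c0 > 0"
    and gr: "\<And>lam w F g h x. \<lbrakk>norm lam \<le> 1; 0 \<le> h; flux_solution lam g w F; w 0 = 0; F 0 = 0;
      \<And>x. x \<in> {0..T} \<Longrightarrow> norm (g x) \<le> h; x \<in> {0..T}\<rbrakk> \<Longrightarrow> norm (w x) \<le> c0 * h \<and> norm (F x) \<le> c0 * h"
    using flux_gronwall by blast
  define c where "c = c0 * m + 1"
  have c: "c > 0" "c0 * m \<le> c" using c0 m0 by (auto simp: c_def add_nonneg_pos)
  have "norm (vtop (monodromy \<Psi> lam *v vjoin (cvec (axis i1 1)) 0) - cvec (axis i1 1) - lam *s
      cvec (y T)) \<le> c * (norm lam)\<^sup>2 \<and>
      norm (vbot (monodromy \<Psi> lam *v vjoin (cvec (axis i1 1)) 0)) \<le> c * (norm lam)\<^sup>2"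
    if lam: "norm lam \<le> 1" for lam
  proof -
    obtain w F where sol: "flux_solution lam (\<lambda>_. 0) w F" and w0: "w 0 = cvec (axis i1 1)"
        and F0: "F 0 = 0"
      and wT: "w T = vtop (monodromy \<Psi> lam *v vjoin (cvec (axis i1 1)) 0)"
      and FT: "F T = vbot (monodromy \<Psi> lam *v vjoin (cvec (axis i1 1)) 0)"
      using evans_flux_solution[OF fundamental] by blast
    define w1 where "w1 x = w x - cvec (du x) - lam *s cvec (y x)" for x
    define F1 where "F1 x = F x - lam *s cvec (G x)" for x
    have T: "T \<in> {0..T}" using T_pos by simp
    have "norm (w1 T) \<le> c0 * ((norm lam)\<^sup>2 * m) \<and> norm (F1 T) \<le> c0 * ((norm lam)\<^sup>2 * m)"
    proof (rule gr[of lam "(norm lam)\<^sup>2 * m" "\<lambda>x. lam\<^sup>2 *s cvec (y x)" w1 F1 T])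
      show "flux_solution lam (\<lambda>x. lam\<^sup>2 *s cvec (y x)) w1 F1"
        unfolding flux_solution_def
      proof (intro ballI conjI)
        fix x assume x: "x \<in> {0..T}"
        note sm = bounded_linear.has_vector_derivative[OF bounded_linear_scalar_mult]
        have "(w1 has_vector_derivative cmat (C x) *v w x + cmat (E x) *v F x - cvec (C x *v du x)
            - lam *s cvec (C x *v y x + E x *v G x)) (at x within {0..T})"
          unfolding w1_def using sol x
          by (intro has_vector_derivative_diff sm has_vector_derivative_cvec yd
               has_vector_derivative_at_within[OF du_solves]) (auto simp: flux_solution_def)
        moreover have "cmat M *v (lam *s cvec v) = lam *s cvec (M *v v)" for M :: "real^'n^'n" and v
          by (simp add: vec_eq_iff matrix_vector_mult_def sum_distrib_left mult_ac)
        then have "cmat (C x) *v w x + cmat (E x) *v F x - cvec (C x *v du x) - lam *s cvec (C x *v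
            y x + E x *v G x) =
            cmat (C x) *v w1 x + cmat (E x) *v F1 x"
          unfolding w1_def F1_def cvec_add vector_add_ldistrib matrix_vector_mult_diff_distrib
              cmat_mult_cvec
          by simp
        ultimately show "(w1 has_vector_derivative cmat (C x) *v w1 x + cmat (E x) *v F1 x)
            (at x within {0..T})" by simp
        have "(F1 has_vector_derivative lam *s w x - lam *s cvec (du x - 0)) (at x within {0..T})"
          unfolding F1_def G_def using sol x
          by (intro has_vector_derivative_diff sm has_vector_derivative_cvec
              has_vector_derivative_const
              has_vector_derivative_at_within[OF ub_deriv]) (auto simp: flux_solution_def)
        moreover have "lam *s w x - lam *s cvec (du x - 0) = lam *s w1 x + lam\<^sup>2 *s cvec (y x)"
          by (simp add: w1_def vec_eq_iff algebra_simps power2_eq_square)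
        ultimately show "(F1 has_vector_derivative lam *s w1 x + lam\<^sup>2 *s cvec (y x))
            (at x within {0..T})" by simp
      qed
      show "norm (lam\<^sup>2 *s cvec (y x)) \<le> (norm lam)\<^sup>2 * m" if "x \<in> {0..T}" for x
        using m[OF that] by (simp add: norm_power mult_left_mono)
    qed (use lam m0 T in \<open>simp_all add: w1_def F1_def w0 F0 y0 G0 coords vec_eq_iff\<close>)
    moreover have "c0 * ((norm lam)\<^sup>2 * m) \<le> c * (norm lam)\<^sup>2"
      using mult_right_mono[OF c(2), of "(norm lam)\<^sup>2"] by (simp add: mult_ac)
    moreover have "F1 T = F T" by (simp add: F1_def G0 vec_eq_iff)
    ultimately show ?thesis by (simp add: w1_def wT FT du_T coords)
  qed
  then show ?thesis using that[OF c(1)] unfolding y_def by blast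
qed

end

section \<open>The leading matrix\<close>

abbreviation freq :: "real \<times> complex \<Rightarrow> complex" where
  "freq p \<equiv> complex_of_real (\<bar>fst p\<bar> + norm (snd p))"

lemma eventually_freq_le_1: "\<forall>\<^sub>F p in nhds (0 :: real, 0 :: complex). \<bar>fst p\<bar> + norm (snd p) \<le> 1"
proof -
  have "isCont (\<lambda>p :: real \<times> complex. \<bar>fst p\<bar> + norm (snd p)) (0, 0)"
    by (intro continuous_intros)
  from isCont_tendsto_nhds[OF this]
  have "((\<lambda>p :: real \<times> complex. \<bar>fst p\<bar> + norm (snd p)) \<longlongrightarrow> 0) (nhds (0, 0))" by simp
  from order_tendstoD(2)[OF this, of 1] show ?thesis
    by (auto elim: eventually_mono)
qed

lemma bigo_freqI:
  assumes "\<And>k lam. norm lam \<le> 1 \<Longrightarrow> norm (g (k, lam)) \<le> c * (\<bar>k\<bar> + norm lam) ^ m"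
  shows "g \<in> O[nhds (0, 0)](\<lambda>p. freq p ^ m)"
proof (rule bigoI[of _ c])
  show "\<forall>\<^sub>F p in nhds (0, 0). norm (g p) \<le> c * norm (freq p ^ m)"
    using eventually_freq_le_1
  proof eventually_elim
    case (elim p)
    obtain k lam where p: "p = (k, lam)" by (cases p)
    have "norm lam \<le> 1" using elim by (simp add: p)
    moreover have "norm (freq p) = \<bar>k\<bar> + norm lam" unfolding norm_of_real by (simp add: p)
    ultimately show ?case using assms[of lam k] by (simp add: p norm_power)
  qed
qed

lemma bigo_freq_lamI:
  assumes "\<And>lam. norm lam \<le> 1 \<Longrightarrow> norm (g lam) \<le> c * norm lam ^ m"
  shows "(\<lambda>p. g (snd p)) \<in> O[nhds (0, 0)](\<lambda>p. freq p ^ m)"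
proof (rule bigo_freqI[where c = "\<bar>c\<bar>"])
  fix k :: real and lam :: complex assume "norm lam \<le> 1"
  then have "norm (g lam) \<le> c * norm lam ^ m" by (rule assms)
  also have "\<dots> \<le> \<bar>c\<bar> * (\<bar>k\<bar> + norm lam) ^ m"
    by (intro mult_mono power_mono) auto
  finally show "norm (g (snd (k, lam))) \<le> \<bar>c\<bar> * (\<bar>k\<bar> + norm lam) ^ m" by simp
qed

lemma bigo_freq_1: "freq \<in> O[nhds (0, 0)](\<lambda>_. 1)"
proof (rule bigoI[of _ 1])
  show "\<forall>\<^sub>F p in nhds (0, 0). norm (freq p) \<le> 1 * norm (1 :: complex)"
    using eventually_freq_le_1 by eventually_elim (simp only: norm_of_real, simp)
qed

lemma bigo_freq_lam: "(\<lambda>p. snd p) \<in> O[nhds (0, 0)](\<lambda>p. freq p ^ 1)"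
  by (rule bigo_freq_lamI[where c = 1]) simp

lemma bigo_freq_multiplier:
  "(\<lambda>p. \<i> * complex_of_real (fst p * T)) \<in> O[nhds (0, 0)](\<lambda>p. freq p ^ 1)"
  "(\<lambda>p. exp (\<i> * complex_of_real (fst p * T)) - 1) \<in> O[nhds (0, 0)](\<lambda>p. freq p ^ 1)"
  "(\<lambda>p. exp (\<i> * complex_of_real (fst p * T)) - 1 - \<i> * complex_of_real (fst p * T))
     \<in> O[nhds (0, 0)](\<lambda>p. freq p ^ 2)"
proof -
  have kT: "norm (\<i> * complex_of_real (k * T)) = \<bar>T\<bar> * \<bar>k\<bar>" for k
    unfolding norm_mult norm_of_real by (simp add: abs_mult)
  have le: "\<bar>k\<bar> \<le> \<bar>k\<bar> + norm lam" for k and lam :: complex by simp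
  have 1: "norm (exp (\<i> * complex_of_real (k * T)) - 1) \<le> \<bar>T\<bar> * \<bar>k\<bar>" for k
    using Taylor_exp[of "\<i> * complex_of_real (k * T)" 0] unfolding kT by simp
  have 2: "norm (exp (\<i> * complex_of_real (k * T)) - 1 - \<i> * complex_of_real (k * T)) \<le>
      (\<bar>T\<bar> * \<bar>k\<bar>)\<^sup>2" for k
    using Taylor_exp[of "\<i> * complex_of_real (k * T)" 1] unfolding kT
    by (simp add: diff_diff_eq power2_eq_square)
  show "(\<lambda>p. \<i> * complex_of_real (fst p * T)) \<in> O[nhds (0, 0)](\<lambda>p. freq p ^ 1)"
    by (rule bigo_freqI[where c = "\<bar>T\<bar>"]) (unfold fst_conv kT, simp add: mult_left_mono)
  show "(\<lambda>p. exp (\<i> * complex_of_real (fst p * T)) - 1) \<in> O[nhds (0, 0)](\<lambda>p. freq p ^ 1)"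
  proof (rule bigo_freqI[where c = "\<bar>T\<bar>"])
    fix k :: real and lam :: complex
    show "norm (exp (\<i> * complex_of_real (fst (k, lam) * T)) - 1) \<le> \<bar>T\<bar> * (\<bar>k\<bar> + norm lam) ^ 1"
      unfolding fst_conv power_one_right by (rule order_trans[OF 1 mult_left_mono[OF le]]) simp
  qed
  show "(\<lambda>p. exp (\<i> * complex_of_real (fst p * T)) - 1 - \<i> * complex_of_real (fst p * T))
     \<in> O[nhds (0, 0)](\<lambda>p. freq p ^ 2)"
  proof (rule bigo_freqI[where c = "\<bar>T\<bar>\<^sup>2"])
    fix k :: real and lam :: complex
    have "(\<bar>T\<bar> * \<bar>k\<bar>)\<^sup>2 \<le> \<bar>T\<bar>\<^sup>2 * (\<bar>k\<bar> + norm lam)\<^sup>2"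
      unfolding power_mult_distrib by (intro mult_left_mono power_mono) auto
    then show "norm (exp (\<i> * complex_of_real (fst (k, lam) * T)) - 1 - \<i> * complex_of_real (fst (k,
        lam) * T))
        \<le> \<bar>T\<bar>\<^sup>2 * (\<bar>k\<bar> + norm lam)\<^sup>2"
      unfolding fst_conv using 2[of k] by (rule order_trans[rotated])
  qed
qed

lemma matrix_vector_axis: "(M *v axis j 1) $ i = M $ i $ j"
  for M :: "'a::semiring_1^'m^'n"
  by (simp add: matrix_vector_mult_def axis_def if_distrib cong: if_cong)

lemma vjoin_axis: "axis (Inl j) 1 = vjoin (axis j 1) 0" "axis (Inr j) 1 = vjoin 0 (axis j 1)"
  by (auto simp: vjoin_def axis_def vec_eq_iff split: sum.split)

lemma cvec_axis: "cvec (axis j 1) = axis j 1" "cvec 0 = 0"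
  by (simp_all add: vec_eq_iff axis_def)

context periodic_profile
begin

lemma integral_X_K:
  "integral {0..T} (\<lambda>x. X x *v a + K x *v b) = integral {0..T} X *v a + integral {0..T} K *v b"
proof -
  note lin = bounded_bilinear.bounded_linear_left[OF bounded_bilinear_matrix_vector_mult]
  have iX: "X integrable_on {0..T}" and iK: "K integrable_on {0..T}"
    by (rule integrable_continuous_real continuous_X continuous_K)+
  have "((\<lambda>x. X x *v a) has_integral integral {0..T} X *v a) {0..T}"
    using has_integral_linear[OF integrable_integral[OF iX] lin[of a]] by (simp add: o_def)
  moreover have "((\<lambda>x. K x *v b) has_integral integral {0..T} K *v b) {0..T}"
    using has_integral_linear[OF integrable_integral[OF iK] lin[of b]] by (simp add: o_def)
  ultimately show ?thesis by (intro integral_unique has_integral_add)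
qed

lemma periodic_mass_eq: "periodic_mass = integral {0..T} K - integral {0..T} X ** S"
proof -
  note lin = bounded_bilinear.bounded_linear_left[OF bounded_bilinear_matrix_matrix_mult]
  have iX: "X integrable_on {0..T}" and iK: "K integrable_on {0..T}"
    by (rule integrable_continuous_real continuous_X continuous_K)+
  have "((\<lambda>x. X x ** S) has_integral integral {0..T} X ** S) {0..T}"
    using has_integral_linear[OF integrable_integral[OF iX] lin[of S]] by (simp add: o_def)
  then show ?thesis
    unfolding periodic_mass_def by (intro integral_unique has_integral_diff integrable_integral iK)
qed

lemma monodromy_entries:
  assumes fundamental: "evans_fundamental_solution f B ub \<Psi>"
  shows "(\<lambda>p. monodromy \<Psi> (snd p) $ Inl i $ Inl j - of_real (X T $ i $ j))
      \<in> O[nhds (0, 0)](\<lambda>p. freq p ^ 1)" (is ?XT)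
    and "(\<lambda>p. monodromy \<Psi> (snd p) $ Inr i $ Inl j - snd p * of_real (integral {0..T} X $ i $ j))
      \<in> O[nhds (0, 0)](\<lambda>p. freq p ^ 2)" (is ?XI)
    and "(\<lambda>p. monodromy \<Psi> (snd p) $ Inl i $ Inr j - of_real (K T $ i $ j))
      \<in> O[nhds (0, 0)](\<lambda>p. freq p ^ 1)" (is ?KT)
    and "(\<lambda>p. monodromy \<Psi> (snd p) $ Inr i $ Inr j - (if i = j then 1 else 0)
        - snd p * of_real (integral {0..T} K $ i $ j)) \<in> O[nhds (0, 0)](\<lambda>p. freq p ^ 2)" (is ?KI)
    and "(\<lambda>p. monodromy \<Psi> (snd p) $ Inl i $ Inl i1 - (if i = i1 then 1 else 0)
        - snd p * of_real ((z T - K T *v (u0 - um)) $ i)) \<in> O[nhds (0, 0)](\<lambda>p. freq p ^ 2)" (is ?t1)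
    and "(\<lambda>p. monodromy \<Psi> (snd p) $ Inr i $ Inl i1) \<in> O[nhds (0, 0)](\<lambda>p. freq p ^ 2)" (is ?t2)
proof -
  let ?M = "monodromy \<Psi>"
  have Mt: "vtop (?M lam *v vjoin (axis j 1) 0) $ i = ?M lam $ Inl i $ Inl j"
    and Mb: "vbot (?M lam *v vjoin (axis j 1) 0) $ i = ?M lam $ Inr i $ Inl j"
    and Mt': "vtop (?M lam *v vjoin 0 (axis j 1)) $ i = ?M lam $ Inl i $ Inr j"
    and Mb': "vbot (?M lam *v vjoin 0 (axis j 1)) $ i = ?M lam $ Inr i $ Inr j" for lam i j
    unfolding vjoin_axis[symmetric] vtop_def vbot_def by (simp_all add: matrix_vector_axis)
  have ax: "axis j 1 $ i = (if i = j then 1 else (0 :: complex))" for i j :: 'n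
    by (simp add: axis_def)
  obtain c where "c > 0"
      and "\<And>lam. norm lam \<le> 1 \<Longrightarrow>
          norm (vtop (?M lam *v vjoin (axis j 1) 0) - cvec (X T *v axis j 1)) \<le> c * norm lam"
    and "\<And>lam. norm lam \<le> 1 \<Longrightarrow>
        norm (vbot (?M lam *v vjoin (axis j 1) 0) - lam *s cvec (integral {0..T} X *v axis j 1)) \<le> c
            * (norm lam)\<^sup>2"
    by (rule monodromy_first_order[OF fundamental, of "axis j 1" 0, unfolded integral_X_K, unfolded
        cvec_axis
        matrix_vector_mult_0_right add_0_right diff_zero]) (rule that)
  note c = this
  have "norm (?M lam $ Inl i $ Inl j - of_real (X T $ i $ j)) \<le> c * norm lam ^ 1"
    "norm (?M lam $ Inr i $ Inl j - lam * of_real (integral {0..T} X $ i $ j)) \<le> c * norm lam ^ 2"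
        if "norm lam \<le> 1" for lam
    using c(2,3)[OF that] order_trans[OF Finite_Cartesian_Product.norm_nth_le[where i = i
        and x = "vtop (?M lam *v vjoin (axis j 1) 0) - cvec (X T *v axis j 1)"]]
      order_trans[OF Finite_Cartesian_Product.norm_nth_le[where i = i
          and x = "vbot (?M lam *v vjoin (axis j 1) 0) - lam *s cvec (integral {0..T} X *v
              axis j 1)"]]
    by (simp_all add: Mt Mb matrix_vector_axis)
  then show ?XT ?XI by (intro bigo_freq_lamI; blast)+
  obtain c where "c > 0"
      and "\<And>lam. norm lam \<le> 1 \<Longrightarrow>
          norm (vtop (?M lam *v vjoin 0 (axis j 1)) - cvec (K T *v axis j 1)) \<le> c * norm lam"
    and "\<And>lam. norm lam \<le> 1 \<Longrightarrow>
        norm (vbot (?M lam *v vjoin 0 (axis j 1)) - axis j 1 - lam *s cvec (integral {0..T} K *v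
            axis j 1)) \<le> c * (norm lam)\<^sup>2"
    by (rule monodromy_first_order[OF fundamental, of 0 "axis j 1", unfolded integral_X_K, unfolded
        cvec_axis
        matrix_vector_mult_0_right add_0_left]) (rule that)
  note c = this
  have "norm (?M lam $ Inl i $ Inr j - of_real (K T $ i $ j)) \<le> c * norm lam ^ 1"
    "norm (?M lam $ Inr i $ Inr j - (if i = j then 1 else 0) - lam * of_real (integral {0..T} K $ i
        $ j)) \<le> c * norm lam ^ 2" if "norm lam \<le> 1" for lam
    using c(2,3)[OF that] order_trans[OF Finite_Cartesian_Product.norm_nth_le[where i = i
        and x = "vtop (?M lam *v vjoin 0 (axis j 1)) - cvec (K T *v axis j 1)"]]
      order_trans[OF Finite_Cartesian_Product.norm_nth_le[where i = i
          and x = "vbot (?M lam *v vjoin 0 (axis j 1)) - axis j 1 - lam *s cvec (integral {0..T} K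
              *v axis j 1)"]]
    by (simp_all add: Mt' Mb' matrix_vector_axis ax)
  then show ?KT ?KI by (intro bigo_freq_lamI; blast)+
  obtain c where "c > 0"
      and "\<And>lam. norm lam \<le> 1 \<Longrightarrow> norm (vtop (?M lam *v vjoin (axis i1 1) 0) - axis i1 1 - lam *s
          cvec (z T - K T *v (u0 - um))) \<le> c * (norm lam)\<^sup>2"
    and "\<And>lam. norm lam \<le> 1 \<Longrightarrow> norm (vbot (?M lam *v vjoin (axis i1 1) 0)) \<le> c * (norm lam)\<^sup>2"
    by (rule monodromy_translation_mode[OF fundamental, unfolded cvec_axis]) (rule that)
  note c = this
  have "norm (?M lam $ Inl i $ Inl i1 - (if i = i1 then 1 else 0) - lam * of_real ((z T - K T *v
      (u0 - um)) $ i)) \<le> c * norm lam ^ 2"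
    "norm (?M lam $ Inr i $ Inl i1) \<le> c * norm lam ^ 2" if "norm lam \<le> 1" for lam
    using c(2,3)[OF that] order_trans[OF Finite_Cartesian_Product.norm_nth_le[where i = i
        and x = "vtop (?M lam *v vjoin (axis i1 1) 0) - axis i1 1 - lam *s cvec (z T - K T *v (u0 -
            um))"]]
      order_trans[OF Finite_Cartesian_Product.norm_nth_le[where i = i
          and x = "vbot (?M lam *v vjoin (axis i1 1) 0)"]]
    by (simp_all add: Mt Mb ax)
  then show ?t1 ?t2 by (intro bigo_freq_lamI; blast)+
qed

text \<open>The leading order of each entry of the monodromy matrix minus \<open>e\<^sup>i\<^sup>k\<^sup>T\<close>. The flux rows of the column of the
  translation mode are kept exact: they are \<open>O(|lam|\<^sup>2)\<close> and do not contribute to the determinant,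
  as the block opposite to them can be eliminated.\<close>

definition leading_matrix ::
  "(real \<Rightarrow> complex \<Rightarrow> complex^('n + 'n)^('n + 'n)) \<Rightarrow> real \<times> complex \<Rightarrow> complex^('n + 'n)^('n + 'n)"
      where
  "leading_matrix \<Psi> p = block_matrix
     (\<chi> i j. if j = i1
             then snd p * of_real ((z T - K T *v (u0 - um)) $ i) - (if i = i1 then \<i> *
                 complex_of_real (fst p * T) else 0)
             else of_real ((X T - mat 1) $ i $ j))
     (cmat (K T))
     (\<chi> i j.
         if j = i1 then monodromy \<Psi> (snd p) $ Inr i $ Inl i1 else snd p * of_real (integral {0..T} X
             $ i $ j))
     (\<chi> i j. snd p * of_real (integral {0..T} K $ i $ j) - (if i = j then \<i> * complex_of_real (fst p
         * T) else 0))"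

text \<open>Subtracting the left block column times \<open>S\<close> clears the upper right block, since \<open>(X T - mat 1) S = K T\<close>,
  and the translation column does not take part, since row \<open>i1\<close> of \<open>S\<close> vanishes. The upper left block
  is \<open>\<Gamma>\<close> with column \<open>i1\<close> replaced by an image \<open>\<Gamma> y\<close> with \<open>y\<^sub>i\<^sub>1 = lam\<close>, so Cramer's rule evaluates it;
  here \<open>axis i1 1\<close> lies in the range of \<open>X T - mat 1\<close>, hence the term with \<open>k\<close> drops out.\<close>

lemma det_leading_matrix:
  assumes e1: "(matrix_inv \<Gamma> *v axis i1 1) $ i1 = 0" and \<Gamma>: "invertible \<Gamma>"
    and S1: "\<And>b. (S *v b) $ i1 = 0" and S: "\<And>b. (X T - mat 1) *v (S *v b) = K T *v b"
  shows "det (leading_matrix \<Psi> p) =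
    of_real (det \<Gamma>) * snd p * det (mat (snd p) ** cmat periodic_mass - mat (\<i> * complex_of_real (fst
        p * T)))"
proof -
  obtain k lam where p: "p = (k, lam)" by (cases p)
  define \<kappa> where "\<kappa> = \<i> * complex_of_real (k * T)"
  define P1 :: "complex^'n^'n" where "P1 = (\<chi> i j. if j = i1
             then lam * of_real ((z T - K T *v (u0 - um)) $ i) - (if i = i1 then \<kappa> else 0)
             else of_real ((X T - mat 1) $ i $ j))"
  define R1 :: "complex^'n^'n" where "R1 = (\<chi> i j. if j = i1 then monodromy \<Psi> lam $ Inr i $ Inl i1
     else lam * of_real (integral {0..T} X $ i $ j))"
  define S1' :: "complex^'n^'n"
      where "S1' = (\<chi> i j. lam * of_real (integral {0..T} K $ i $ j) - (if i = j then \<kappa> else 0))"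
  have L: "leading_matrix \<Psi> p = block_matrix P1 (cmat (K T)) R1 S1'"
    by (simp only: leading_matrix_def p P1_def R1_def S1'_def \<kappa>_def fst_conv snd_conv)
  have Srow: "S $ i1 $ j = 0" for j using S1[of "axis j 1"] by (simp add: matrix_vector_axis)
  have XS: "(X T - mat 1) ** S = K T"
    using S by (simp add: matrix_eq flip: matrix_vector_mul_assoc)
  have PS: "P1 ** cmat S = cmat (K T)"
  proof -
    have "P1 ** cmat S = cmat (X T - mat 1) ** cmat S"
      unfolding matrix_matrix_mult_def vec_eq_iff
      by (auto simp: P1_def Srow intro!: sum.cong)
    then show ?thesis by (simp only: cmat_mult[symmetric] XS)
  qed
  have RS: "R1 ** cmat S = mat lam ** cmat (integral {0..T} X ** S)"
  proof -
    have mat_mult: "(mat lam ** M) $ i $ j = lam * M $ i $ j" for M :: "complex^'n^'n" and i j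
      by (simp add: matrix_matrix_mult_def mat_def if_distrib[of "\<lambda>b. b * _"] cong: if_cong)
    have "R1 ** cmat S = (mat lam ** cmat (integral {0..T} X)) ** cmat S"
      unfolding matrix_matrix_mult_def[of R1] matrix_matrix_mult_def[of "_ ** _"] vec_eq_iff
      by (auto simp: R1_def Srow mat_mult intro!: sum.cong)
    then show ?thesis by (simp only: cmat_mult matrix_mul_assoc)
  qed
  have S1'': "S1' - mat lam ** cmat (integral {0..T} X ** S) =
      mat lam ** cmat periodic_mass - mat \<kappa>"
  proof -
    have mat_mult: "(mat lam ** M) $ i $ j = lam * M $ i $ j" for M :: "complex^'n^'n" and i j
      by (simp add: matrix_matrix_mult_def mat_def if_distrib[of "\<lambda>b. b * _"] cong: if_cong)
    have mat_entry: "mat \<kappa> $ i $ j = (if i = j then \<kappa> else 0)" for i j :: 'n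
      by (simp add: mat_def)
    show ?thesis
      by (simp add: vec_eq_iff mat_mult mat_entry S1'_def periodic_mass_eq algebra_simps)
  qed
  have "block_matrix P1 (cmat (K T)) R1 S1' ** block_matrix (mat 1) (- cmat S) 0 (mat 1) =
      block_matrix P1 0 R1 (mat lam ** cmat periodic_mass - mat \<kappa>)"
    unfolding block_matrix_mult
    by (simp add: bounded_bilinear.minus_right[OF bounded_bilinear_matrix_matrix_mult] PS RS flip:
        S1'')
  from arg_cong[OF this, of det]
  have "det (leading_matrix \<Psi> p) * det (block_matrix (mat 1) (- cmat S) 0 (mat 1)) =
      det P1 * det (mat lam ** cmat periodic_mass - mat \<kappa>)"
    by (simp only: L det_mul det_block_lower_triangular)
  then have "det (leading_matrix \<Psi> p) = det P1 * det (mat lam ** cmat periodic_mass - mat \<kappa>)"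
    by (simp only: det_block_unipotent_upper mult_1_right)
  moreover have "det P1 = lam * of_real (det \<Gamma>)"
  proof -
    define y where "y = lam *s cvec (axis i1 1 - S *v (u0 - um)) - \<kappa> *s cvec (matrix_inv \<Gamma> *v
        axis i1 1)"
    have sm: "cmat \<Gamma> *v (a *s cvec v) = a *s cvec (\<Gamma> *v v)" for a v
      by (simp add: vec_eq_iff matrix_vector_mult_def sum_distrib_left mult_ac)
    have "\<Gamma> *v (axis i1 1 - S *v (u0 - um)) = z T - K T *v (u0 - um)"
      unfolding \<Gamma>_mult by (simp add: S1 matrix_vector_mult_diff_distrib X_T_axis S)
    moreover have "\<Gamma> *v (matrix_inv \<Gamma> *v axis i1 1) = axis i1 1"
      by (simp add: matrix_vector_mul_assoc invertible_matrix_inv[OF \<Gamma>])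
    ultimately have \<Gamma>y: "cmat \<Gamma> *v y = lam *s cvec (z T - K T *v (u0 - um)) - \<kappa> *s cvec (axis i1 1)"
      unfolding y_def matrix_vector_mult_diff_distrib sm by simp
    have "P1 = (\<chi> i j. if j = i1 then (cmat \<Gamma> *v y) $ i else cmat \<Gamma> $ i $ j)"
      unfolding \<Gamma>y by (simp add: P1_def vec_eq_iff \<Gamma>_def axis_def)
    then have "det P1 = y $ i1 * det (cmat \<Gamma>)" by (simp only: cramer_lemma)
    moreover have "y $ i1 = lam" by (simp add: y_def S1 e1)
    ultimately show ?thesis by (simp add: det_cmat)
  qed
  ultimately show ?thesis by (simp add: p \<kappa>_def)
qed

text \<open>The flux rows and the translation column carry weight one each, so the total weight is \<open>n + 1\<close>.\<close>

lemma evans_leading_matrix: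
  assumes fundamental: "evans_fundamental_solution f B ub \<Psi>"
  shows "(\<lambda>p. evans_D \<Psi> T (fst p) (snd p) - det (leading_matrix \<Psi> p))
    \<in> O[nhds (0, 0)](\<lambda>p. freq p ^ (CARD('n) + 2))"
proof -
  define r :: "'n + 'n \<Rightarrow> nat" where "r i = (case i of Inl _ \<Rightarrow> 0 | Inr _ \<Rightarrow> 1)" for i
  define c :: "'n + 'n \<Rightarrow> nat" where "c j = (if j = Inl i1 then 1 else 0)" for j
  let ?\<kappa> = "\<lambda>p :: real \<times> complex. \<i> * complex_of_real (fst p * T)"
  let ?\<mu> = "\<lambda>p :: real \<times> complex. exp (?\<kappa> p)"
  let ?M = "\<lambda>p. monodromy \<Psi> (snd p) - mat (?\<mu> p)"
  let ?N = "leading_matrix \<Psi>"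
  note entries = monodromy_entries[OF fundamental]
  note mult = bigo_freq_multiplier[of T]
  have cases: "(\<forall>i j. j \<noteq> i1 \<longrightarrow> Q (Inl i) (Inl j)) \<Longrightarrow> (\<forall>i. Q (Inl i) (Inl i1)) \<Longrightarrow>
      (\<forall>i j. Q (Inl i) (Inr j)) \<Longrightarrow>
      (\<forall>i j. j \<noteq> i1 \<longrightarrow> Q (Inr i) (Inl j)) \<Longrightarrow> (\<forall>i. Q (Inr i) (Inl i1)) \<Longrightarrow> (\<forall>i j. Q (Inr i) (Inr j)) \<Longrightarrow> Q
          i j"
    for Q :: "'n + 'n \<Rightarrow> 'n + 'n \<Rightarrow> bool" and i j
    by (cases i; cases j) metis+
  have delta: "(\<lambda>p. if b then g p else 0) \<in> O[F](h)" if "g \<in> O[F](h)" for b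
      and g h :: "real \<times> complex \<Rightarrow> complex" and F
    by (cases b) (simp_all add: that)
  have lam: "(\<lambda>p. snd p * a) \<in> O[nhds (0, 0)](\<lambda>p. freq p ^ 1)" for a
    using bigo_freq_lam by simp
  have N: "(\<lambda>p. ?N p $ i $ j) \<in> O[nhds (0, 0)](\<lambda>p. freq p ^ (r i + c j))" for i j
  proof (rule cases[of "\<lambda>i j. (\<lambda>p. ?N p $ i $ j) \<in> O[nhds (0, 0)](\<lambda>p. freq p ^ (r i + c j))"]; intro
      allI impI)
    fix i j :: 'n assume "j \<noteq> i1"
    then show "(\<lambda>p. ?N p $ Inl i $ Inl j) \<in> O[nhds (0, 0)](\<lambda>p. freq p ^ (r (Inl i) + c (Inl j)))"
      "(\<lambda>p. ?N p $ Inr i $ Inl j) \<in> O[nhds (0, 0)](\<lambda>p. freq p ^ (r (Inr i) + c (Inl j)))"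
      using bigo_freq_lam by (simp_all add: leading_matrix_def block_matrix_def r_def c_def)
  next
    fix i j :: 'n
    show "(\<lambda>p. ?N p $ Inl i $ Inl i1) \<in> O[nhds (0, 0)](\<lambda>p. freq p ^ (r (Inl i) + c (Inl i1)))"
      using sum_in_bigo(2)[OF lam delta[OF mult(1)]]
          by (simp add: leading_matrix_def block_matrix_def r_def c_def)
    show "(\<lambda>p. ?N p $ Inl i $ Inr j) \<in> O[nhds (0, 0)](\<lambda>p. freq p ^ (r (Inl i) + c (Inr j)))"
      by (simp add: leading_matrix_def block_matrix_def r_def c_def)
    show "(\<lambda>p. ?N p $ Inr i $ Inl i1) \<in> O[nhds (0, 0)](\<lambda>p. freq p ^ (r (Inr i) + c (Inl i1)))"
      using entries(6)[of i]
          by (simp add: leading_matrix_def block_matrix_def r_def c_def numeral_2_eq_2)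
    show "(\<lambda>p. ?N p $ Inr i $ Inr j) \<in> O[nhds (0, 0)](\<lambda>p. freq p ^ (r (Inr i) + c (Inr j)))"
      using sum_in_bigo(2)[OF lam delta[OF mult(1)]]
          by (simp add: leading_matrix_def block_matrix_def r_def c_def)
  qed
  have D: "(\<lambda>p. ?M p $ i $ j - ?N p $ i $ j) \<in> O[nhds (0, 0)](\<lambda>p. freq p ^ Suc (r i + c j))" for i j
  proof (rule cases[of "\<lambda>i j. (\<lambda>p. ?M p $ i $ j - ?N p $ i $ j) \<in>
      O[nhds (0, 0)](\<lambda>p. freq p ^ Suc (r i + c j))"]; intro allI impI)
    fix i j :: 'n assume j: "j \<noteq> i1"
    have "(\<lambda>p. (monodromy \<Psi> (snd p) $ Inl i $ Inl j - of_real (X T $ i $ j)) - (if i =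
        j then ?\<mu> p - 1 else 0))
        \<in> O[nhds (0, 0)](\<lambda>p. freq p ^ 1)"
      by (rule sum_in_bigo(2)[OF entries(1) delta[OF mult(2)]])
    moreover have "?M p $ Inl i $ Inl j - ?N p $ Inl i $ Inl j =
        (monodromy \<Psi> (snd p) $ Inl i $ Inl j - of_real (X T $ i $ j)) - (if i = j then ?\<mu> p - 1 else
            0)" for p
      using j by (simp add: leading_matrix_def block_matrix_def mat_def)
    ultimately show "(\<lambda>p. ?M p $ Inl i $ Inl j - ?N p $ Inl i $ Inl j) \<in>
        O[nhds (0, 0)](\<lambda>p. freq p ^ Suc (r (Inl i) + c (Inl j)))"
      using j by (simp only: r_def c_def sum.case sum.inject if_False) simp
    have eq: "?M p $ Inr i $ Inl j - ?N p $ Inr i $ Inl j = monodromy \<Psi> (snd p) $ Inr i $ Inl j -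
        snd p * of_real (integral {0..T} X $ i $ j)" for p
      using j by (simp add: leading_matrix_def block_matrix_def mat_def)
    show "(\<lambda>p. ?M p $ Inr i $ Inl j - ?N p $ Inr i $ Inl j) \<in>
        O[nhds (0, 0)](\<lambda>p. freq p ^ Suc (r (Inr i) + c (Inl j)))"
      unfolding eq using j entries(2)[of i j] by (simp add: r_def c_def numeral_2_eq_2)
  next
    fix i j :: 'n
    have "(\<lambda>p. (monodromy \<Psi> (snd p) $ Inl i $ Inl i1 - (if i = i1 then 1 else 0)
        - snd p * of_real ((z T - K T *v (u0 - um)) $ i)) - (if i = i1 then ?\<mu> p - 1 - ?\<kappa> p else 0))
        \<in> O[nhds (0, 0)](\<lambda>p. freq p ^ 2)"
      by (rule sum_in_bigo(2)[OF entries(5) delta[OF mult(3)]])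
    moreover have "?M p $ Inl i $ Inl i1 - ?N p $ Inl i $ Inl i1 =
        (monodromy \<Psi> (snd p) $ Inl i $ Inl i1 - (if i = i1 then 1 else 0)
        - snd p * of_real ((z T - K T *v (u0 - um)) $ i)) - (if i = i1 then ?\<mu> p - 1 - ?\<kappa> p else
            0)" for p
      by (simp add: leading_matrix_def block_matrix_def mat_def)
    ultimately show "(\<lambda>p. ?M p $ Inl i $ Inl i1 - ?N p $ Inl i $ Inl i1) \<in>
        O[nhds (0, 0)](\<lambda>p. freq p ^ Suc (r (Inl i) + c (Inl i1)))"
      by (simp only: r_def c_def sum.case if_True add_0 Suc_1 simp_thms)
    have eq: "?M p $ Inl i $ Inr j - ?N p $ Inl i $ Inr j = monodromy \<Psi> (snd p) $ Inl i $ Inr j -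
        of_real (K T $ i $ j)" for p
      by (simp add: leading_matrix_def block_matrix_def mat_def)
    show "(\<lambda>p. ?M p $ Inl i $ Inr j - ?N p $ Inl i $ Inr j) \<in>
        O[nhds (0, 0)](\<lambda>p. freq p ^ Suc (r (Inl i) + c (Inr j)))"
      unfolding eq using entries(3)[of i j] by (simp add: r_def c_def)
    have eq: "?M p $ Inr i $ Inl i1 - ?N p $ Inr i $ Inl i1 = 0" for p
      by (simp add: leading_matrix_def block_matrix_def mat_def)
    show "(\<lambda>p. ?M p $ Inr i $ Inl i1 - ?N p $ Inr i $ Inl i1) \<in>
        O[nhds (0, 0)](\<lambda>p. freq p ^ Suc (r (Inr i) + c (Inl i1)))"
      unfolding eq by simp
    have "(\<lambda>p. (monodromy \<Psi> (snd p) $ Inr i $ Inr j - (if i = j then 1 else 0)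
        - snd p * of_real (integral {0..T} K $ i $ j)) - (if i = j then ?\<mu> p - 1 - ?\<kappa> p else 0))
        \<in> O[nhds (0, 0)](\<lambda>p. freq p ^ 2)"
      by (rule sum_in_bigo(2)[OF entries(4) delta[OF mult(3)]])
    moreover have "?M p $ Inr i $ Inr j - ?N p $ Inr i $ Inr j =
        (monodromy \<Psi> (snd p) $ Inr i $ Inr j - (if i = j then 1 else 0)
        - snd p * of_real (integral {0..T} K $ i $ j)) - (if i = j then ?\<mu> p - 1 - ?\<kappa> p else
            0)" for p
      by (simp add: leading_matrix_def block_matrix_def mat_def)
    ultimately show "(\<lambda>p. ?M p $ Inr i $ Inr j - ?N p $ Inr i $ Inr j) \<in>
        O[nhds (0, 0)](\<lambda>p. freq p ^ Suc (r (Inr i) + c (Inr j)))"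
      by (simp only: r_def c_def sum.case sum.distinct if_False add_0_right Suc_1)
  qed
  have "sum r UNIV = CARD('n)" by (simp add: sum_UNIV_sum r_def)
  moreover have "sum c UNIV = 1" by (simp add: c_def)
  moreover have "(\<lambda>p. det (?M p) - det (?N p)) \<in> O[nhds (0, 0)](\<lambda>p. freq p ^ Suc (sum r UNIV +
      sum c UNIV))"
    by (rule det_bigo_perturbation[OF bigo_freq_1 N D])
  ultimately show ?thesis by (simp add: evans_D_monodromy)
qed

end

theorem theorem6p1:
  fixes f :: "real^'n \<Rightarrow> real^'n"
    and B :: "real^'n \<Rightarrow> real^'n^'n"
    and ub :: "real \<Rightarrow> real^'n"
    and um u0 :: "real^'n"
    and T :: real
    and i1 :: 'n
    and \<Psi> :: "real \<Rightarrow> complex \<Rightarrow> complex^('n + 'n)^('n + 'n)"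
    and U :: "real^'n \<Rightarrow> real^'n \<Rightarrow> real \<Rightarrow> real \<Rightarrow> real^'n"
    and Q :: "(real^'n) \<times> real \<Rightarrow> (real^'n) \<times> real"
  assumes profile: "nonconstant_periodic_profile f B um T ub"
    and base: "ub 0 = u0"
    and coords: "vector_derivative ub (at 0) = axis i1 1"
    and fundamental: "evans_fundamental_solution f B ub \<Psi>"
    and family: "profile_family f B um u0 T U"
    and smooth: "C2 f" "C2 B"
    and parabolic: "\<And>x \<mu>. \<mu> \<in> mat_spectrum (cmat (B (ub x))) \<Longrightarrow> Re \<mu> > 0"
    and df_invertible: "invertible (jacobian f (at um))"
    and transversal: "transversality i1 um u0 T U \<noteq> 0"
    and surface: "periodic_surface i1 um u0 T U Q"
    and quasi_Ham: "quasi_Hamiltonian f B 0 um u0"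
  shows "(\<lambda>(k, lam). evans_D \<Psi> T k lam
            - complex_of_real (transversality i1 um u0 T U) * lam *
              det (- (mat lam ** cmat (mass_derivative i1 um u0 T U Q ** matrix_inv (jacobian f (at um))))
                   - mat (\<i> * complex_of_real (k * T))))
         \<in> O[nhds (0 :: real, 0 :: complex)](\<lambda>(k, lam). complex_of_real ((\<bar>k\<bar> + norm lam) ^ (CARD('n) + 2)))"
proof -
  interpret periodic_profile f B ub um u0 T i1
    by unfold_locales (use profile base coords smooth in auto, rule invertible_of_spectrum, rule
        parabolic)
  have \<Gamma>: "invertible \<Gamma>"
    using transversal by (simp add: transversality_eq[OF family] invertible_det_nz)
  obtain h :: "real^'n \<Rightarrow> real" where h: "linear h" "h \<noteq> (\<lambda>_. 0)" "\<And>c. h ((X T - mat 1) *v c) = 0"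
    and hK: "\<And>b. h (K T *v b) = 0" and h1: "h (axis i1 1) = 0"
    using integral_annihilates_variations[OF family quasi_Ham df_invertible] by blast
  have S1: "(S *v b) $ i1 = 0" and S: "(X T - mat 1) *v (S *v b) = K T *v b" for b
    using solve_in_kernel[OF \<Gamma> h hK[of b]] by (simp_all add: S_def matrix_vector_mul_assoc)
  have e1: "(matrix_inv \<Gamma> *v axis i1 1) $ i1 = 0" by (rule solve_in_kernel(1)[OF \<Gamma> h h1])
  have mass: "mass_derivative i1 um u0 T U Q ** matrix_inv (jacobian f (at um)) = - periodic_mass"
  proof -
    have "mass_derivative i1 um u0 T U Q ** matrix_inv (jacobian f (at um)) =
        - (periodic_mass ** (jacobian f (at um) ** matrix_inv (jacobian f (at um))))"
      unfolding mass_derivative_eq[OF family \<Gamma> surface S1 S]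
      by (simp add: bounded_bilinear.minus_left[OF bounded_bilinear_matrix_matrix_mult]
          matrix_mul_assoc)
    then show ?thesis by (simp add: invertible_matrix_inv[OF df_invertible])
  qed
  have minus: "- (mat lam ** cmat (- periodic_mass)) = mat lam ** cmat periodic_mass" for lam
  proof -
    have "cmat (- periodic_mass) = - cmat periodic_mass" by (simp add: vec_eq_iff)
    then show ?thesis
        by (simp add: bounded_bilinear.minus_right[OF bounded_bilinear_matrix_matrix_mult])
  qed
  have "(\<lambda>p. evans_D \<Psi> T (fst p) (snd p) - of_real (det \<Gamma>) * snd p *
      det (mat (snd p) ** cmat periodic_mass - mat (\<i> * complex_of_real (fst p * T))))
      \<in> O[nhds (0, 0)](\<lambda>p. freq p ^ (CARD('n) + 2))"
    using evans_leading_matrix[OF fundamental] unfolding det_leading_matrix[OF e1 \<Gamma> S1 S] .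
  then show ?thesis
    unfolding case_prod_unfold mass minus transversality_eq[OF family] of_real_power .
qed

end
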